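(* Let $1<\alpha<\beta$, $I_1=[0,1]$, $I_2=[\alpha,\beta]$, let $\phi,\psi,\theta\in\mathbb{R}$ and $0<w<1$, and let $P_B$ be the selfadjoint restriction of the maximal momentum operator associated with the matrix $B=B(w,\phi,\psi,\theta)$. Then the spectrum of $P_B$ is pure point, with the eigenvalue list equal to the sequence $\{\lambda_n\}$ of real numbers $\lambda$ solving the equation $$e\bigl(\theta-\phi+(\beta-\alpha)\lambda\bigr)=\frac{w\,e(\phi+\lambda)-1}{e(\phi+\lambda)-w}.$$ Every number $\lambda_n$ in the spectrum of $P_B$ is isolated, and, for $n$ fixed, the corresponding eigenspace is spanned by the function $$\bigl(a\chi_{I_1}(x)+\chi_{I_2}(x)\bigr)e(\lambda_n x),\qquad\text{where } a=\frac{\sqrt{1-w^2}\,e(\theta-\psi+\beta\lambda_n)}{w\,e(\phi+\lambda_n)-1}.$$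
   Context: $e(x):=e^{i2\pi x}$; $\chi_S$ is the indicator function of $S$. The maximal momentum operator is $P=\frac{1}{i2\pi}\frac{d}{dt}$ on $L^2(I_1\cup I_2)$, with domain $\mathscr{D}(P)$ the absolutely continuous functions $f$ on $I_1\cup I_2$ with $f'\in L^2(I_1\cup I_2)$. For $0\le w\le 1$ and $\phi,\psi,\theta\in\mathbb{R}$, $$B=B(w,\phi,\psi,\theta)=\begin{pmatrix} w\,e(\phi) & -\sqrt{1-w^2}\,e(\theta-\psi)\\ \sqrt{1-w^2}\,e(\psi) & w\,e(\theta-\phi)\end{pmatrix},$$ and $P_B$ is the restriction of $P$ to $\mathscr{D}(P_B)=\{f\in\mathscr{D}(P) : B\,(f(1),f(\beta))^T=(f(0),f(\alpha))^T\}$. *)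

theory Defs
  imports "HOL-Analysis.Analysis"
begin

section \<open>The Hilbert space of square-integrable functions on a set\<close>

text \<open>
  An element of the Hilbert space is represented by any of its representatives: functions on the
  whole real line, identified when they agree almost everywhere on \<open>S\<close>; values outside \<open>S\<close> are
  irrelevant.
\<close>

definition ae_eq :: "real set \<Rightarrow> (real \<Rightarrow> complex) \<Rightarrow> (real \<Rightarrow> complex) \<Rightarrow> bool" where
  "ae_eq S f g \<longleftrightarrow> (AE x in lebesgue_on S. f x = g x)"

definition L2 :: "real set \<Rightarrow> (real \<Rightarrow> complex) set" where
  "L2 S = {f. f \<in> borel_measurable (lebesgue_on S) \<and>
              integrable (lebesgue_on S) (\<lambda>x. (cmod (f x))\<^sup>2)}"

definition L2_inner :: "real set \<Rightarrow> (real \<Rightarrow> complex) \<Rightarrow> (real \<Rightarrow> complex) \<Rightarrow> complex" where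
  "L2_inner S f g = (LINT x|lebesgue_on S. cnj (f x) * g x)"

definition L2_norm :: "real set \<Rightarrow> (real \<Rightarrow> complex) \<Rightarrow> real" where
  "L2_norm S f = sqrt (LINT x|lebesgue_on S. (cmod (f x))\<^sup>2)"


section \<open>Spectral notions for unbounded operators\<close>

text \<open>
  An unbounded operator on \<open>L2 S\<close> is given by its domain \<open>D\<close> and its action \<open>T\<close> on \<open>D\<close>. A complex
  number \<open>z\<close> is in the resolvent set iff \<open>T - z\<close> is one-to-one from \<open>D\<close> onto \<open>L2 S\<close> with bounded
  inverse.
\<close>

definition resolvent_set ::
  "real set \<Rightarrow> (real \<Rightarrow> complex) set \<Rightarrow> ((real \<Rightarrow> complex) \<Rightarrow> (real \<Rightarrow> complex)) \<Rightarrow> complex set" where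
  "resolvent_set S D T = {z.
     (\<forall>f\<in>D. ae_eq S (\<lambda>x. T f x - z * f x) (\<lambda>x. 0) \<longrightarrow> ae_eq S f (\<lambda>x. 0)) \<and>
     (\<forall>h\<in>L2 S. \<exists>f\<in>D. ae_eq S (\<lambda>x. T f x - z * f x) h) \<and>
     (\<exists>C. \<forall>f\<in>D. L2_norm S f \<le> C * L2_norm S (\<lambda>x. T f x - z * f x))}"

definition op_spectrum ::
  "real set \<Rightarrow> (real \<Rightarrow> complex) set \<Rightarrow> ((real \<Rightarrow> complex) \<Rightarrow> (real \<Rightarrow> complex)) \<Rightarrow> complex set" where
  "op_spectrum S D T = - resolvent_set S D T"

text \<open>The eigenspace contains all representatives of its elements, not just those in \<open>D\<close>.\<close>

definition eigenspace ::
  "real set \<Rightarrow> (real \<Rightarrow> complex) set \<Rightarrow> ((real \<Rightarrow> complex) \<Rightarrow> (real \<Rightarrow> complex)) \<Rightarrow> complex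
    \<Rightarrow> (real \<Rightarrow> complex) set" where
  "eigenspace S D T z =
     {f \<in> L2 S. \<exists>g\<in>D. ae_eq S f g \<and> ae_eq S (T g) (\<lambda>x. z * g x)}"

definition eigenvalues ::
  "real set \<Rightarrow> (real \<Rightarrow> complex) set \<Rightarrow> ((real \<Rightarrow> complex) \<Rightarrow> (real \<Rightarrow> complex)) \<Rightarrow> complex set" where
  "eigenvalues S D T = {z. \<exists>f\<in>eigenspace S D T z. \<not> ae_eq S f (\<lambda>x. 0)}"

text \<open>
  Pure point spectrum: the Hilbert space has an orthonormal basis, i.e. an orthonormal set whose
  orthogonal complement is zero, consisting of eigenvectors.
\<close>

definition pure_point ::
  "real set \<Rightarrow> (real \<Rightarrow> complex) set \<Rightarrow> ((real \<Rightarrow> complex) \<Rightarrow> (real \<Rightarrow> complex)) \<Rightarrow> bool" where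
  "pure_point S D T \<longleftrightarrow>
     (\<exists>E. E \<subseteq> (\<Union>z. eigenspace S D T z) \<and>
          (\<forall>u\<in>E. \<forall>v\<in>E. L2_inner S u v = (if u = v then 1 else 0)) \<and>
          (\<forall>f\<in>L2 S. (\<forall>u\<in>E. L2_inner S u f = 0) \<longrightarrow> ae_eq S f (\<lambda>x. 0)))"

definition spanned_by :: "real set \<Rightarrow> (real \<Rightarrow> complex) \<Rightarrow> (real \<Rightarrow> complex) set" where
  "spanned_by S u = {f \<in> L2 S. \<exists>c. ae_eq S f (\<lambda>x. c * u x)}"


section \<open>The momentum operator on two intervals\<close>

definition ee :: "real \<Rightarrow> complex" where
  "ee x = exp (\<i> * of_real (2 * pi * x))"

text \<open>
  For a disjoint union of two compact intervals, every interval \<open>{l i..u i}\<close> lies in one of the two,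
  so this is absolute continuity on each of them.
\<close>

definition abs_continuous_on :: "real set \<Rightarrow> (real \<Rightarrow> complex) \<Rightarrow> bool" where
  "abs_continuous_on S f \<longleftrightarrow>
     (\<forall>\<epsilon>>0. \<exists>\<delta>>0. \<forall>(n::nat) (l::nat \<Rightarrow> real) (u::nat \<Rightarrow> real).
        (\<forall>i<n. l i \<le> u i \<and> {l i..u i} \<subseteq> S) \<and>
        disjoint_family_on (\<lambda>i. {l i<..<u i}) {..<n} \<and>
        (\<Sum>i<n. u i - l i) < \<delta>
        \<longrightarrow> (\<Sum>i<n. cmod (f (u i) - f (l i))) < \<epsilon>)"

definition momentum :: "real set \<Rightarrow> (real \<Rightarrow> complex) \<Rightarrow> (real \<Rightarrow> complex)" where
  "momentum S f = (\<lambda>x. 1 / (\<i> * of_real (2 * pi)) * vector_derivative f (at x within S))"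

text \<open>
  By Lebesgue's theorem the almost everywhere differentiability is automatic for absolutely
  continuous functions; it makes the derivative in the last condition meaningful.
\<close>

definition momentum_dom :: "real set \<Rightarrow> (real \<Rightarrow> complex) set" where
  "momentum_dom S = {f. abs_continuous_on S f \<and>
     (AE x in lebesgue_on S. f differentiable (at x within S)) \<and>
     (\<lambda>x. vector_derivative f (at x within S)) \<in> L2 S}"

definition Bmat :: "real \<Rightarrow> real \<Rightarrow> real \<Rightarrow> real \<Rightarrow> complex^2^2" where
  "Bmat w \<phi> \<psi> \<theta> = vector
     [vector [of_real w * ee \<phi>, - (of_real (sqrt (1 - w\<^sup>2)) * ee (\<theta> - \<psi>))],
      vector [of_real (sqrt (1 - w\<^sup>2)) * ee \<psi>, of_real w * ee (\<theta> - \<phi>)]]"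

text \<open>The domain of \<open>P\<^sub>B\<close>, for the intervals \<open>{0..1}\<close> and \<open>{\<alpha>..\<beta>}\<close>; its action is \<^const>\<open>momentum\<close>.\<close>

definition PB_dom :: "real \<Rightarrow> real \<Rightarrow> complex^2^2 \<Rightarrow> (real \<Rightarrow> complex) set" where
  "PB_dom \<alpha> \<beta> B = {f \<in> momentum_dom ({0..1} \<union> {\<alpha>..\<beta>}).
     B *v (vector [f 1, f \<beta>] :: complex^2) = vector [f 0, f \<alpha>]}"

end

theory Submission
  imports Defs "HOL-Complex_Analysis.Complex_Analysis"
begin

text \<open>
  On each of the two intervals the equation \<open>P u = z u + h\<close> is a linear differential equation of
  first order, so \<open>u\<close> is determined by \<open>h\<close> and the two starting values \<open>u 0\<close> and \<open>u \<alpha>\<close>, through an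
  explicit formula with the factor \<open>e(z x)\<close>. Inserting the formula into the boundary condition
  leaves a linear system of two equations for the starting values
  (\<open>boundary_condition_resolvent_iff\<close>). Its upper right coefficient is \<open>B\<^bsub>12\<^esub> e(z (\<beta> - \<alpha>))\<close>, which
  never vanishes because \<open>w < 1\<close>. Hence \<open>u 0\<close> always determines \<open>u \<alpha>\<close>, every eigenspace is at most
  one-dimensional, and everything depends on the determinant \<open>char_det z\<close> of the system, an entire
  function of \<open>z\<close>.

  Since \<open>B\<close> is unitary, integration by parts shows that the operator is symmetric
  (\<open>momentum_B_symmetric\<close>), so the zeros of the determinant are real. If the determinant is nonzero
  at \<open>z\<close>, solving the system gives a bounded resolvent. If it is zero at \<open>z\<close>, there is an
  eigenfunction, and \<open>P u = z u + h\<close> remains solvable, with a bound, within the orthogonal complement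
  of that eigenfunction (\<open>resolvent_solvable\<close>, \<open>resolvent_bound\<close>). So spectrum and eigenvalues both
  are the zero set of a nontrivial entire function: countable and made of isolated points. For real
  \<open>z\<close> the vanishing of the determinant is the equation of the theorem.

  For completeness of the eigenfunctions, let \<open>h\<close> be orthogonal to all of them. Then \<open>P u = z u + h\<close>
  has a solution \<open>u = R z\<close> orthogonal to all eigenfunctions for \<^emph>\<open>every\<close> complex \<open>z\<close>, eigenvalues
  included, so the inner products of \<open>R z\<close> with fixed vectors are entire functions of \<open>z\<close>. Symmetry
  bounds them by a multiple of \<open>1 / \<bar>Im z\<bar>\<close>. An entire function with such a bound is zero
  (\<open>entire_eq_0_if_bounded_by_inverse_Im\<close>), which forces \<open>h = 0\<close> (\<open>eigen_perp_trivial\<close>). The argument takes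
  the place of the spectral theorem for compact selfadjoint operators.

  The equation has infinitely many solutions because it says that a continuous real function of
  \<open>\<lambda>\<close>, a linear function with positive slope plus a bounded one, takes an integer value
  (\<open>infinite_eigenvalue_equation\<close>).

  The domain of the operator consists of absolutely continuous functions with square-integrable
  derivative. These are exactly the indefinite integrals of square-integrable functions
  (\<open>momentum_dom_iff_L2_primitive\<close>); one direction is the fundamental theorem of calculus for
  absolutely continuous functions, the other one Lebesgue's differentiation theorem. Both are
  proved here for the gauge integral.
\<close>

section \<open>Differentiation and integration of absolutely continuous functions\<close>

text \<open>
  Lebesgue's differentiation theorem on the line. If difference quotients at a point miss the
  integrand by at least \<open>e\<close> for arbitrarily small increments, there are arbitrarily small intervals
  whose Riemann term differs from the integral by at least \<open>e\<close> times the length. Henstock's lemma makes the sum of such differences over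
  disjoint intervals small, and Vitali's covering lemma selects disjoint intervals whose fivefold
  enlargements cover all these points.
\<close>
lemma indefinite_integral_has_derivative_AE:
  fixes g :: "real \<Rightarrow> 'a::euclidean_space"
  assumes g: "g integrable_on {a..b}"
  shows "negligible {x\<in>{a<..<b}. \<not> ((\<lambda>y. integral {a..y} g) has_vector_derivative g x) (at x)}"
proof -
  define G where "G = (\<lambda>y. integral {a..y} g)"
  have G_diff: "G v - G u = integral {u..v} g" if "a \<le> u" "u \<le> v" "v \<le> b" for u v
  proof -
    have "g integrable_on {a..v}"
      using g that by (auto intro: integrable_subinterval_real)
    then show ?thesis
      using Henstock_Kurzweil_Integration.integral_combine[of a u v g] that by (simp add: G_def algebra_simps)
  qed
  define bad where "bad e = {x\<in>{a<..<b}. \<forall>d>0. \<exists>y\<in>{a<..<b}. y \<noteq> x \<and> \<bar>y - x\<bar> < d \<and>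
      e * \<bar>y - x\<bar> \<le> norm (G y - G x - (y - x) *\<^sub>R g x)}" for e :: real
  have bad_negligible: "negligible (bad e)" if "e > 0" for e
    unfolding negligible_outer_le
  proof (intro allI impI)
    fix \<eta> :: real
    assume "\<eta> > 0"
    \<comment> \<open>Balls of radius \<open>5 r\<close> have length \<open>10 r\<close>, hence the factor 10.\<close>
    then have "e * \<eta> / 10 > 0" using \<open>e > 0\<close> by simp
    then obtain \<gamma> where \<gamma>: "gauge \<gamma>"
      and Hen: "\<And>p. \<lbrakk>p tagged_partial_division_of (cbox a b); \<gamma> fine p\<rbrakk> \<Longrightarrow>
             (\<Sum>(x,k)\<in>p. norm (measure lborel k *\<^sub>R g x - integral k g)) < e * \<eta> / 10"
      using Henstock_lemma[of g a b "e * \<eta> / 10"] g by auto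
    have "\<exists>y. y \<in> {a<..<b} \<and> y \<noteq> x \<and> cball x \<bar>y - x\<bar> \<subseteq> \<gamma> x \<and>
        e * \<bar>y - x\<bar> \<le> norm (G y - G x - (y - x) *\<^sub>R g x)" if x: "x \<in> bad e" for x
    proof -
      obtain d where "d > 0" "ball x d \<subseteq> \<gamma> x"
        using \<gamma> unfolding gauge_def by (meson openE)
      moreover obtain y where "y\<in>{a<..<b}" "y \<noteq> x" "\<bar>y - x\<bar> < d"
         "e * \<bar>y - x\<bar> \<le> norm (G y - G x - (y - x) *\<^sub>R g x)"
        using x \<open>d > 0\<close> unfolding bad_def by blast
      moreover have "cball x \<bar>y - x\<bar> \<subseteq> ball x d"
        using \<open>\<bar>y - x\<bar> < d\<close> by (auto simp: dist_norm)
      ultimately show ?thesis by blast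
    qed
    then obtain y where y: "\<And>x. x \<in> bad e \<Longrightarrow> y x \<in> {a<..<b}" "\<And>x. x \<in> bad e \<Longrightarrow> y x \<noteq> x"
      and y_fine: "\<And>x. x \<in> bad e \<Longrightarrow> cball x \<bar>y x - x\<bar> \<subseteq> \<gamma> x"
      and y_bad: "\<And>x. x \<in> bad e \<Longrightarrow> e * \<bar>y x - x\<bar> \<le> norm (G (y x) - G x - (y x - x) *\<^sub>R g x)"
      by metis
    define r where "r x = \<bar>y x - x\<bar>" for x
    define K where "K x = {min x (y x)..max x (y x)}" for x
    have bad_sub: "x \<in> {a<..<b}" if "x \<in> bad e" for x
      using that by (auto simp: bad_def)
    have r: "0 < r x \<and> r x \<le> b - a" if "x \<in> bad e" for x
      using y[OF that] bad_sub[OF that] by (auto simp: r_def abs_le_iff)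
    have "bad e \<subseteq> (\<Union>x\<in>bad e. cball x (r x))"
      using r by (force simp: less_imp_le)
    then obtain C where C: "countable C" "C \<subseteq> bad e"
       "pairwise (\<lambda>i j. disjnt (cball i (r i)) (cball j (r j))) C"
       "bad e \<subseteq> (\<Union>i\<in>C. cball i (5 * r i))"
      by (rule Vitali_covering_lemma_cballs[of "bad e" "\<lambda>x. x" r "bad e" "b - a"])
        (use r in blast)+
    have K_sub: "K x \<subseteq> cball x (r x)" for x
      by (auto simp: K_def r_def dist_norm)
    have sum_r: "(\<Sum>x\<in>F. r x) \<le> \<eta> / 10" if F: "finite F" "F \<subseteq> C" for F
    proof -
      have inj: "inj_on (\<lambda>x. (x, K x)) F" by (auto simp: inj_on_def)
      have "((\<lambda>x. (x, K x)) ` F) tagged_partial_division_of (cbox a b)"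
        unfolding tagged_partial_division_of_def
      proof (intro conjI allI impI; (elim conjE)?)
        fix x L assume "(x, L) \<in> (\<lambda>x. (x, K x)) ` F"
        then have x: "x \<in> bad e" "L = K x" using F C by auto
        show "x \<in> L" using x by (auto simp: K_def)
        show "L \<subseteq> cbox a b" using x y(1)[OF x(1)] bad_sub[OF x(1)] by (auto simp: K_def)
        show "\<exists>a b. L = cbox a b" using x by (auto simp: K_def)
      next
        fix x1 K1 x2 K2
        assume *: "(x1, K1) \<in> (\<lambda>x. (x, K x)) ` F" "(x2, K2) \<in> (\<lambda>x. (x, K x)) ` F" "(x1, K1) \<noteq> (x2, K2)"
        then have "x1 \<noteq> x2" "x1 \<in> C" "x2 \<in> C" "K1 = K x1" "K2 = K x2" using F by auto
        then have "K1 \<inter> K2 = {}"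
          using C(3) K_sub[of x1] K_sub[of x2] unfolding pairwise_def disjnt_def by blast
        then show "interior K1 \<inter> interior K2 = {}"
          using interior_subset by blast
      qed (use F in auto)
      moreover have "\<gamma> fine ((\<lambda>x. (x, K x)) ` F)"
        using y_fine K_sub F C unfolding fine_def r_def by blast
      ultimately have "(\<Sum>(x,k)\<in>(\<lambda>x. (x, K x)) ` F. norm (measure lborel k *\<^sub>R g x - integral k g)) < e * \<eta> / 10"
        by (rule Hen)
      then have 1: "(\<Sum>x\<in>F. norm (measure lborel (K x) *\<^sub>R g x - integral (K x) g)) < e * \<eta> / 10"
        by (simp add: sum.reindex[OF inj])
      have "e * r x \<le> norm (measure lborel (K x) *\<^sub>R g x - integral (K x) g)" if "x \<in> F" for x
      proof -
        have xb: "x \<in> bad e" using that F C by auto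
        note yx = y(1)[OF xb] and xx = bad_sub[OF xb]
        have "norm (measure lborel (K x) *\<^sub>R g x - integral (K x) g) = norm (G (y x) - G x - (y x - x) *\<^sub>R g x)"
        proof (cases "x \<le> y x")
          case True
          then have "integral (K x) g = G (y x) - G x"
            using G_diff[of x "y x"] yx xx by (simp add: K_def)
          then show ?thesis using True by (simp add: K_def norm_minus_commute)
        next
          case False
          then have "integral (K x) g = G x - G (y x)"
            using G_diff[of "y x" x] yx xx by (simp add: K_def)
          moreover have "measure lborel (K x) = x - y x" using False by (simp add: K_def)
          ultimately have "measure lborel (K x) *\<^sub>R g x - integral (K x) g
              = G (y x) - G x - (y x - x) *\<^sub>R g x"
            by (simp add: scaleR_diff_left)
          then show ?thesis by simp
        qed
        then show ?thesis using y_bad[OF xb] by (simp add: r_def)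
      qed
      then have "(\<Sum>x\<in>F. e * r x) < e * \<eta> / 10"
        using 1 by (intro order_le_less_trans[OF sum_mono 1]) auto
      then have "e * (\<Sum>x\<in>F. r x) < e * (\<eta> / 10)" by (simp add: sum_distrib_left)
      then show ?thesis using \<open>e > 0\<close> by simp
    qed
    have bnd: "measure lebesgue (\<Union>x\<in>F. cball x (5 * r x)) \<le> \<eta>" if F: "finite F" "F \<subseteq> C" for F
    proof -
      have "measure lebesgue (\<Union>x\<in>F. cball x (5 * r x)) \<le> (\<Sum>x\<in>F. measure lebesgue (cball x (5 * r x)))"
        using F by (intro measure_UNION_le) auto
      also have "\<dots> = (\<Sum>x\<in>F. 10 * r x)"
      proof (rule sum.cong[OF refl])
        fix x assume "x \<in> F"
        then have "r x > 0" using r F C by blast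
        then show "measure lebesgue (cball x (5 * r x)) = 10 * r x"
          by (simp add: cball_eq_atLeastAtMost)
      qed
      also have "\<dots> \<le> \<eta>" using sum_r[OF F] by (simp add: sum_distrib_left[symmetric])
      finally show ?thesis .
    qed
    show "\<exists>T. bad e \<subseteq> T \<and> T \<in> lmeasurable \<and> measure lebesgue T \<le> \<eta>"
    proof (intro exI conjI)
      show "(\<Union>x\<in>C. cball x (5 * r x)) \<in> lmeasurable"
        by (rule fmeasurable_UN_bound[OF C(1) _ bnd]) auto
      show "measure lebesgue (\<Union>x\<in>C. cball x (5 * r x)) \<le> \<eta>"
        by (rule measure_UN_bound[OF C(1) _ bnd]) auto
    qed (use C in auto)
  qed
  have "{x\<in>{a<..<b}. \<not> (G has_vector_derivative g x) (at x)} \<subseteq> (\<Union>n. bad (1 / Suc n))"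
  proof
    fix x assume x: "x \<in> {x\<in>{a<..<b}. \<not> (G has_vector_derivative g x) (at x)}"
    then obtain e where "e > 0" and e: "\<And>d. d > 0 \<Longrightarrow> \<exists>y. \<bar>y - x\<bar> < d \<and>
        norm (G y - G x - (y - x) *\<^sub>R g x) > e * \<bar>y - x\<bar>"
      by (auto simp: has_vector_derivative_def has_derivative_at_alt bounded_linear_scaleR_left not_le)
    obtain n where n: "1 / Suc n < e" using \<open>e > 0\<close> by (metis nat_approx_posE)
    have "\<exists>y\<in>{a<..<b}. y \<noteq> x \<and> \<bar>y - x\<bar> < d \<and> (1 / Suc n) * \<bar>y - x\<bar> \<le> norm (G y - G x - (y - x) *\<^sub>R g x)"
      if "d > 0" for d
    proof -
      have "min d (min (x - a) (b - x)) > 0" using x \<open>d > 0\<close> by auto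
      then obtain y where y: "\<bar>y - x\<bar> < min d (min (x - a) (b - x))"
        "norm (G y - G x - (y - x) *\<^sub>R g x) > e * \<bar>y - x\<bar>" using e by blast
      have "(1 / Suc n) * \<bar>y - x\<bar> \<le> e * \<bar>y - x\<bar>"
        using n by (intro mult_right_mono) auto
      moreover have "y \<noteq> x" using y(2) by auto
      moreover have "y \<in> {a<..<b}" using y(1) by (auto simp: abs_less_iff)
      moreover have "\<bar>y - x\<bar> < d" using y(1) by auto
      ultimately show ?thesis using y(2) by (intro bexI[of _ y]) auto
    qed
    then show "x \<in> (\<Union>n. bad (1 / Suc n))" using x by (auto simp: bad_def)
  qed
  moreover have "negligible (\<Union>n. bad (1 / Suc n))"
    by (intro negligible_countable_Union) (auto intro: bad_negligible)
  ultimately show ?thesis unfolding G_def using negligible_subset by blast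
qed

text \<open>
  The definition of absolute continuity numbers the intervals; the intervals of a tagged division
  are indexed by the division itself.
\<close>
lemma abs_continuous_on_finite_sum:
  assumes "abs_continuous_on S f" "\<epsilon> > 0"
  shows "\<exists>\<delta>>0. \<forall>(J::'a set) l u. finite J \<longrightarrow> (\<forall>j\<in>J. l j \<le> u j \<and> {l j..u j} \<subseteq> S) \<longrightarrow>
       disjoint_family_on (\<lambda>j. {l j<..<u j}) J \<longrightarrow> (\<Sum>j\<in>J. u j - l j) < \<delta> \<longrightarrow>
       (\<Sum>j\<in>J. cmod (f (u j) - f (l j))) < \<epsilon>"
proof -
  obtain \<delta> where "\<delta> > 0" and \<delta>: "\<And>(n::nat) l u.
        (\<forall>i<n. l i \<le> u i \<and> {l i..u i} \<subseteq> S) \<and>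
        disjoint_family_on (\<lambda>i. {l i<..<u i}) {..<n} \<and> (\<Sum>i<n. u i - l i) < \<delta>
        \<Longrightarrow> (\<Sum>i<n. cmod (f (u i) - f (l i))) < \<epsilon>"
    using assms unfolding abs_continuous_on_def by blast
  show ?thesis
  proof (intro exI[of _ \<delta>] conjI \<open>\<delta> > 0\<close> allI impI)
    fix J :: "'a set" and l u
    assume J: "finite J" "\<forall>j\<in>J. l j \<le> u j \<and> {l j..u j} \<subseteq> S"
       "disjoint_family_on (\<lambda>j. {l j<..<u j}) J" "(\<Sum>j\<in>J. u j - l j) < \<delta>"
    obtain h where h: "bij_betw h {..<card J} J"
      using ex_bij_betw_nat_finite[OF J(1)] by (auto simp: atLeast0LessThan)
    have "(\<Sum>i<card J. cmod (f (u (h i)) - f (l (h i)))) < \<epsilon>"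
    proof (rule \<delta>[of "card J" "l \<circ> h" "u \<circ> h", unfolded o_def], intro conjI allI impI)
      show "disjoint_family_on (\<lambda>i. {l (h i)<..<u (h i)}) {..<card J}"
        using J(3) h unfolding disjoint_family_on_def bij_betw_def inj_on_def by blast
      show "(\<Sum>i<card J. u (h i) - l (h i)) < \<delta>"
        using J(4) sum.reindex_bij_betw[OF h, of "\<lambda>j. u j - l j"] by simp
    qed (use J h in \<open>auto simp: bij_betw_def\<close>)
    then show "(\<Sum>j\<in>J. cmod (f (u j) - f (l j))) < \<epsilon>"
      using sum.reindex_bij_betw[OF h, of "\<lambda>j. cmod (f (u j) - f (l j))"] by simp
  qed
qed

text \<open>
  The exceptional set \<open>N\<close> may be any null set, which absolute continuity makes possible: the gauge
  forces the intervals tagged in \<open>N\<close> to lie in an open set of small measure, so the increments of \<open>f\<close>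
  over them have a small sum. The other intervals are treated as in the classical case.
\<close>
lemma fundamental_theorem_of_calculus_abs_continuous:
  fixes f :: "real \<Rightarrow> complex"
  assumes "a \<le> b" and AC: "abs_continuous_on {a..b} f" and N: "negligible N"
    and der: "\<And>x. x \<in> {a..b} - N \<Longrightarrow> (f has_vector_derivative f' x) (at x within {a..b})"
  shows "(f' has_integral (f b - f a)) {a..b}"
proof -
  define g where "g x = (if x \<in> N then 0 else f' x)" for x
  \<comment> \<open>Redefining \<open>f'\<close> as zero on \<open>N\<close> removes the Riemann terms tagged in \<open>N\<close>.\<close>
  have "(g has_integral (f b - f a)) {a..b}"
    unfolding has_integral_real
  proof (intro allI impI)
    fix e :: real assume "e > 0"
    define \<epsilon> where "\<epsilon> = e / (2 * (b - a + 1))"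
    have \<epsilon>: "\<epsilon> > 0" "\<epsilon> * (b - a) < e / 2"
      using \<open>e > 0\<close> \<open>a \<le> b\<close> by (auto simp: \<epsilon>_def field_simps add_pos_nonneg)
    obtain \<delta> where "\<delta> > 0" and \<delta>: "\<forall>(J::(real \<times> real set) set) l u.
       finite J \<longrightarrow> (\<forall>j\<in>J. l j \<le> u j \<and> {l j..u j} \<subseteq> {a..b}) \<longrightarrow>
       disjoint_family_on (\<lambda>j. {l j<..<u j}) J \<longrightarrow> (\<Sum>j\<in>J. u j - l j) < \<delta>
       \<longrightarrow> (\<Sum>j\<in>J. cmod (f (u j) - f (l j))) < e / 2"
      using abs_continuous_on_finite_sum[OF AC half_gt_zero[OF \<open>e > 0\<close>]] by blast
    obtain U where U: "open U" "N \<subseteq> U" "U \<in> lmeasurable" "measure lebesgue U < \<delta>"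
    proof -
      have N0: "N \<in> null_sets lebesgue" using N by (simp add: negligible_iff_null_sets)
      obtain U where U: "open U" "N \<subseteq> U" "U - N \<in> lmeasurable" "emeasure lebesgue (U - N) < ennreal \<delta>"
        using sets_lebesgue_outer_open[of N \<delta>] N0 \<open>\<delta> > 0\<close> by blast
      have "emeasure lebesgue U = emeasure lebesgue (U - N)"
        using emeasure_Diff_null_set[OF N0, of U] U(1) by (simp add: lborelD)
      then have less: "emeasure lebesgue U < ennreal \<delta>" using U by simp
      have "U \<in> lmeasurable"
        using U(1) order.strict_trans[OF less ennreal_less_top] by (intro fmeasurableI) auto
      then have "measure lebesgue U < \<delta>"
        using \<open>\<delta> > 0\<close> less by (simp add: emeasure_eq_measure2 ennreal_less_iff)
      then show thesis using that U \<open>U \<in> lmeasurable\<close> by blast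
    qed
    have "\<exists>d>0. (x \<in> {a..b} - N \<longrightarrow> (\<forall>y\<in>{a..b}. \<bar>y - x\<bar> < d \<longrightarrow>
             norm (f y - f x - (y - x) *\<^sub>R f' x) \<le> \<epsilon> * \<bar>y - x\<bar>)) \<and> (x \<in> N \<longrightarrow> ball x d \<subseteq> U)" for x
    proof (cases "x \<in> N")
      case True
      then show ?thesis using U(1,2) by (meson DiffE openE subsetD)
    next
      case False
      then show ?thesis
        using der[of x] \<epsilon>(1) unfolding has_vector_derivative_def has_derivative_within_alt
        by (cases "x \<in> {a..b}") (auto intro: zero_less_one)
    qed
    then obtain d where d: "\<And>x. d x > 0"
      "\<And>x y. \<lbrakk>x \<in> {a..b} - N; y \<in> {a..b}; \<bar>y - x\<bar> < d x\<rbrakk> \<Longrightarrow> norm (f y - f x - (y - x) *\<^sub>R f' x) \<le> \<epsilon> * \<bar>y - x\<bar>"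
      "\<And>x. x \<in> N \<Longrightarrow> ball x (d x) \<subseteq> U"
      by metis
    show "\<exists>\<gamma>. gauge \<gamma> \<and> (\<forall>p. p tagged_division_of {a..b} \<and> \<gamma> fine p \<longrightarrow>
        norm ((\<Sum>(x,k)\<in>p. measure lborel k *\<^sub>R g x) - (f b - f a)) < e)"
    proof (intro exI conjI allI impI; (elim conjE)?)
      show "gauge (\<lambda>x. ball x (d x))" using d(1) gauge_ball_dependent by blast
      fix p assume p: "p tagged_division_of {a..b}" and fine: "(\<lambda>x. ball x (d x)) fine p"
      have "finite p" using p by blast
      define l u where "l = (\<lambda>j::real \<times> real set. Inf (snd j))" and "u = (\<lambda>j::real \<times> real set. Sup (snd j))"
      have lu: "l (x,k) \<le> x \<and> x \<le> u (x,k) \<and> k = {l (x,k)..u (x,k)} \<and> k \<subseteq> {a..b} \<and> k \<subseteq> ball x (d x)" if "(x,k) \<in> p" for x k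
      proof -
        have "x \<in> k" "k \<subseteq> {a..b}" "\<exists>u v. k = cbox u v" "k \<subseteq> ball x (d x)"
          using tagged_division_ofD(2-4)[OF p that] fineD[OF fine that] by auto
        then show ?thesis by (auto simp: l_def u_def)
      qed
      define p1 where "p1 = {j\<in>p. fst j \<notin> N}"
      define p2 where "p2 = {j\<in>p. fst j \<in> N}"
      have p12: "p = p1 \<union> p2" "p1 \<inter> p2 = {}" "finite p1" "finite p2"
        using \<open>finite p\<close> by (auto simp: p1_def p2_def)
      have sumf: "(\<Sum>j\<in>p. f (u j) - f (l j)) = f b - f a"
        using additive_tagged_division_1[OF \<open>a \<le> b\<close> p, of f] by (simp add: l_def u_def split_def)
      have sumlen: "(\<Sum>j\<in>p. u j - l j) = b - a"
        using additive_tagged_division_1[OF \<open>a \<le> b\<close> p, of "\<lambda>x. x"] by (simp add: l_def u_def split_def)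
      have good: "norm (measure lborel (snd j) *\<^sub>R g (fst j) - (f (u j) - f (l j))) \<le> \<epsilon> * (u j - l j)" if "j \<in> p1" for j
      proof -
        obtain x k where j: "j = (x,k)" by force
        have xk: "(x,k) \<in> p" "x \<notin> N" using that j by (auto simp: p1_def)
        note L = lu[OF xk(1)]
        define L' U' where "L' = l (x,k)" and "U' = u (x,k)"
        have L'U': "L' \<le> x" "x \<le> U'" "k = {L'..U'}" "k \<subseteq> {a..b}" "k \<subseteq> ball x (d x)"
          using L unfolding L'_def U'_def by auto
        have "x \<in> {a..b} - N" "L' \<in> {a..b}" "U' \<in> {a..b}" "L' \<in> ball x (d x)" "U' \<in> ball x (d x)"
          using L'U'(1,2) subsetD[OF L'U'(4)] subsetD[OF L'U'(5)] xk(2) unfolding L'U'(3) by auto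
        then have "norm (f U' - f x - (U' - x) *\<^sub>R f' x) \<le> \<epsilon> * (U' - x)"
          "norm (f L' - f x - (L' - x) *\<^sub>R f' x) \<le> \<epsilon> * (x - L')"
          using d(2)[of x U'] d(2)[of x L'] L'U'(1,2) by (auto simp: dist_real_def)
        then have "norm ((f L' - f x - (L' - x) *\<^sub>R f' x) - (f U' - f x - (U' - x) *\<^sub>R f' x)) \<le> \<epsilon> * (x - L') + \<epsilon> * (U' - x)"
          by (intro order_trans[OF norm_triangle_ineq4]) auto
        also have "(f L' - f x - (L' - x) *\<^sub>R f' x) - (f U' - f x - (U' - x) *\<^sub>R f' x) = (U' - L') *\<^sub>R f' x - (f U' - f L')"
          by (simp add: algebra_simps)
        finally show ?thesis
          using xk L'U' unfolding j L'_def[symmetric] U'_def[symmetric] by (simp add: g_def algebra_simps)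
      qed
      have small: "(\<Sum>j\<in>p2. cmod (f (u j) - f (l j))) < e / 2"
      proof (rule \<delta>[rule_format])
        show "l j \<le> u j \<and> {l j..u j} \<subseteq> {a..b}" if "j \<in> p2" for j
          using that lu[of "fst j" "snd j"] by (auto simp: p2_def)
        show disj: "disjoint_family_on (\<lambda>j. {l j<..<u j}) p2"
          unfolding disjoint_family_on_def
        proof (intro ballI impI)
          fix i j assume ij: "i \<in> p2" "j \<in> p2" "i \<noteq> j"
          then have "interior (snd i) \<inter> interior (snd j) = {}"
            using tagged_division_ofD(5)[OF p, of "fst i" "snd i" "fst j" "snd j"] by (auto simp: p2_def prod_eq_iff)
          moreover have "interior (snd m) = {l m<..<u m}" if "m \<in> p2" for m
            using that lu[of "fst m" "snd m"] interior_atLeastAtMost_real[of "l m" "u m"] by (auto simp: p2_def)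
          ultimately show "{l i<..<u i} \<inter> {l j<..<u j} = {}" using ij by auto
        qed
        have Ioo_finite: "emeasure lborel {s<..<t} \<noteq> top" for s t :: real
          using emeasure_lborel_box_finite[of s t] by simp
        have "(\<Sum>j\<in>p2. u j - l j) = (\<Sum>j\<in>p2. measure lebesgue {l j<..<u j})"
          using lu by (intro sum.cong) (fastforce simp: p2_def)+
        also have "\<dots> = measure lebesgue (\<Union>j\<in>p2. {l j<..<u j})"
          by (rule measure_finite_Union[symmetric]) (use disj p12 Ioo_finite in auto)
        also have "\<dots> \<le> measure lebesgue U"
        proof (rule measure_mono_fmeasurable[OF _ _ U(3)])
          show "(\<Union>j\<in>p2. {l j<..<u j}) \<subseteq> U"
          proof
            fix y assume "y \<in> (\<Union>j\<in>p2. {l j<..<u j})"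
            then obtain x k where xk: "(x,k) \<in> p" "x \<in> N" "y \<in> {l (x,k)<..<u (x,k)}" by (auto simp: p2_def)
            then have "y \<in> {l (x,k)..u (x,k)}" by auto
            then have "y \<in> ball x (d x)" using lu[OF xk(1)] by blast
            then show "y \<in> U" using d(3)[OF xk(2)] by blast
          qed
        qed (use p12 in auto)
        also have "\<dots> < \<delta>" by fact
        finally show "(\<Sum>j\<in>p2. u j - l j) < \<delta>" .
      qed (use p12 in auto)
      have "(\<Sum>(x,k)\<in>p. measure lborel k *\<^sub>R g x) - (f b - f a)
          = (\<Sum>j\<in>p. measure lborel (snd j) *\<^sub>R g (fst j) - (f (u j) - f (l j)))"
        by (simp add: sumf[symmetric] sum_subtractf split_def)
      also have "\<dots> = (\<Sum>j\<in>p1. measure lborel (snd j) *\<^sub>R g (fst j) - (f (u j) - f (l j)))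
          - (\<Sum>j\<in>p2. f (u j) - f (l j))"
      proof -
        have "(\<Sum>j\<in>p2. measure lborel (snd j) *\<^sub>R g (fst j) - (f (u j) - f (l j))) = - (\<Sum>j\<in>p2. f (u j) - f (l j))"
          unfolding sum_negf[symmetric] by (intro sum.cong) (auto simp: p2_def g_def)
        then show ?thesis using p12 by (simp add: sum.union_disjoint)
      qed
      also have "norm \<dots> \<le> (\<Sum>j\<in>p1. \<epsilon> * (u j - l j)) + (\<Sum>j\<in>p2. cmod (f (u j) - f (l j)))"
        by (intro order_trans[OF norm_triangle_ineq4] add_mono sum_norm_le good order_refl)
      also have "\<dots> < e / 2 + e / 2"
      proof (intro add_le_less_mono small)
        have "(\<Sum>j\<in>p1. u j - l j) \<le> (\<Sum>j\<in>p. u j - l j)"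
          using lu by (intro sum_mono2 \<open>finite p\<close>) (force simp: p1_def)+
        then have "\<epsilon> * (\<Sum>j\<in>p1. u j - l j) \<le> \<epsilon> * (b - a)"
          using \<epsilon> sumlen by (intro mult_left_mono) auto
        then show "(\<Sum>j\<in>p1. \<epsilon> * (u j - l j)) \<le> e / 2" using \<epsilon> by (simp add: sum_distrib_left)
      qed
      finally show "norm ((\<Sum>(x,k)\<in>p. measure lborel k *\<^sub>R g x) - (f b - f a)) < e" by simp
    qed
  qed
  then show ?thesis
    by (rule has_integral_spike[OF N, rotated]) (auto simp: g_def)
qed

section \<open>Square-integrable functions\<close>

lemma AE_lebesgue_on_iff_negligible:
  assumes "S \<in> sets lebesgue"
  shows "(AE x in lebesgue_on S. P x) \<longleftrightarrow> negligible {x\<in>S. \<not> P x}"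
proof -
  have "(AE x in lebesgue_on S. P x) \<longleftrightarrow> (AE x in lebesgue. x \<in> S \<longrightarrow> P x)"
    using assms by (subst AE_restrict_space_iff) auto
  also have "\<dots> \<longleftrightarrow> (\<exists>N. negligible N \<and> {x\<in>S. \<not> P x} \<subseteq> N)"
    by (simp add: eventually_ae_filter_negligible)
  also have "\<dots> \<longleftrightarrow> negligible {x\<in>S. \<not> P x}"
    using negligible_subset by blast
  finally show ?thesis .
qed

lemma L2_borel_measurable [measurable_dest]: "f \<in> L2 S \<Longrightarrow> f \<in> borel_measurable (lebesgue_on S)"
  by (simp add: L2_def)

lemma L2_square_integrable: "f \<in> L2 S \<Longrightarrow> integrable (lebesgue_on S) (\<lambda>x. (cmod (f x))\<^sup>2)"
  by (simp add: L2_def)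

text \<open>
  The measurability of \<open>f\<close> has to be assumed: the bound concerns its modulus only.
\<close>
lemma L2_dominated:
  assumes "f \<in> borel_measurable (lebesgue_on S)" "integrable (lebesgue_on S) q"
    "AE x in lebesgue_on S. (cmod (f x))\<^sup>2 \<le> q x"
  shows "f \<in> L2 S"
  unfolding L2_def mem_Collect_eq
proof (intro conjI assms(1) Bochner_Integration.integrable_bound[OF assms(2)])
  show "(\<lambda>x. (cmod (f x))\<^sup>2) \<in> borel_measurable (lebesgue_on S)"
    using assms(1) by measurable
  show "AE x in lebesgue_on S. norm ((cmod (f x))\<^sup>2) \<le> norm (q x)"
    using assms(3) by eventually_elim auto
qed

lemma L2_cong_AE:
  assumes "f \<in> L2 S" "AE x in lebesgue_on S. f x = g x" "g \<in> borel_measurable (lebesgue_on S)"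
  shows "g \<in> L2 S"
  by (rule L2_dominated[OF assms(3) L2_square_integrable[OF assms(1)]])
    (use assms(2) in \<open>eventually_elim, auto\<close>)

lemma L2_zero [simp]: "(\<lambda>x. 0) \<in> L2 S"
  by (simp add: L2_def)

lemma L2_scale:
  assumes "f \<in> L2 S" shows "(\<lambda>x. c * f x) \<in> L2 S"
  by (rule L2_dominated[where q="\<lambda>x. (cmod c)\<^sup>2 * (cmod (f x))\<^sup>2"])
    (use assms in \<open>auto simp: L2_def norm_mult power_mult_distrib\<close>)

lemma L2_add:
  assumes "f \<in> L2 S" "g \<in> L2 S" shows "(\<lambda>x. f x + g x) \<in> L2 S"
proof (rule L2_dominated[where q="\<lambda>x. 2 * (cmod (f x))\<^sup>2 + 2 * (cmod (g x))\<^sup>2"])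
  have "(cmod (a + b))\<^sup>2 \<le> 2 * (cmod a)\<^sup>2 + 2 * (cmod b)\<^sup>2" for a b
  proof -
    have "(cmod (a + b))\<^sup>2 \<le> (cmod a + cmod b)\<^sup>2" by (simp add: norm_triangle_ineq power_mono)
    also have "\<dots> \<le> 2 * (cmod a)\<^sup>2 + 2 * (cmod b)\<^sup>2"
      using sum_squares_bound[of "cmod a" "cmod b"] by (simp add: power2_sum)
    finally show ?thesis .
  qed
  then show "AE x in lebesgue_on S. (cmod (f x + g x))\<^sup>2 \<le> 2 * (cmod (f x))\<^sup>2 + 2 * (cmod (g x))\<^sup>2"
    by simp
qed (use assms in \<open>auto simp: L2_def\<close>)

lemma L2_diff:
  assumes "f \<in> L2 S" "g \<in> L2 S" shows "(\<lambda>x. f x - g x) \<in> L2 S"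
  using L2_add[OF assms(1) L2_scale[OF assms(2), of "-1"]] by simp

lemma L2_mult_bounded:
  assumes "f \<in> borel_measurable (lebesgue_on S)" "\<And>x. x \<in> S \<Longrightarrow> cmod (f x) \<le> K" "g \<in> L2 S"
  shows "(\<lambda>x. f x * g x) \<in> L2 S"
proof (rule L2_dominated[where q="\<lambda>x. K\<^sup>2 * (cmod (g x))\<^sup>2"])
  show "AE x in lebesgue_on S. (cmod (f x * g x))\<^sup>2 \<le> K\<^sup>2 * (cmod (g x))\<^sup>2"
    using assms(2) by (auto intro!: AE_I2 mult_right_mono power_mono simp: norm_mult power_mult_distrib)
qed (use assms in \<open>auto simp: L2_def\<close>)

lemma L2_bounded:
  assumes "S \<in> lmeasurable" "f \<in> borel_measurable (lebesgue_on S)" "\<And>x. x \<in> S \<Longrightarrow> cmod (f x) \<le> K"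
  shows "f \<in> L2 S"
proof (rule L2_dominated[where q="\<lambda>x. K\<^sup>2"])
  show "integrable (lebesgue_on S) (\<lambda>x. K\<^sup>2)"
    using finite_measure.integrable_const[OF finite_measure_lebesgue_on[OF assms(1)]] .
  show "AE x in lebesgue_on S. (cmod (f x))\<^sup>2 \<le> K\<^sup>2"
    using assms(3) by (auto intro!: AE_I2 power_mono)
qed (use assms in auto)

lemma L2_integrable_product:
  assumes "f \<in> L2 S" "g \<in> L2 S"
  shows "integrable (lebesgue_on S) (\<lambda>x. f x * g x)"
proof (rule Bochner_Integration.integrable_bound[where f="\<lambda>x. (cmod (f x))\<^sup>2 + (cmod (g x))\<^sup>2"])
  have "cmod (a * b) \<le> (cmod a)\<^sup>2 + (cmod b)\<^sup>2" for a b
    using sum_squares_bound[of "cmod a" "cmod b"] zero_le_power2[of "cmod a"] zero_le_power2[of "cmod b"]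
    unfolding norm_mult by linarith
  then show "AE x in lebesgue_on S. norm (f x * g x) \<le> norm ((cmod (f x))\<^sup>2 + (cmod (g x))\<^sup>2)"
    by simp
qed (use assms in \<open>auto simp: L2_def\<close>)

lemma L2_compose_cmod_preserving:
  assumes "f \<in> L2 S" "continuous_on UNIV h" "\<And>z. cmod (h z) = cmod z"
  shows "(\<lambda>x. h (f x)) \<in> L2 S"
  using assms borel_measurable_continuous_onI[OF assms(2)]
  by (auto simp: L2_def intro: measurable_compose)

lemma L2_cnj: "f \<in> L2 S \<Longrightarrow> (\<lambda>x. cnj (f x)) \<in> L2 S"
  by (rule L2_compose_cmod_preserving) (auto intro: continuous_intros)

lemma L2_integrable:
  assumes "f \<in> L2 S" "S \<in> lmeasurable"
  shows "integrable (lebesgue_on S) f"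
  using L2_integrable_product[OF assms(1) L2_bounded[OF assms(2), of "\<lambda>x. 1" 1]] by simp

lemma integrable_lebesgue_on_subset:
  fixes f :: "'a::euclidean_space \<Rightarrow> 'b::euclidean_space"
  assumes "integrable (lebesgue_on S) f" "T \<subseteq> S" "S \<in> sets lebesgue" "T \<in> sets lebesgue"
  shows "integrable (lebesgue_on T) f"
proof -
  have "set_integrable lebesgue S f"
    using assms by (simp add: set_integrable_def integrable_restrict_space)
  then have "set_integrable lebesgue T f"
    using assms by (auto intro: set_integrable_subset)
  then show ?thesis
    using assms by (simp add: set_integrable_def integrable_restrict_space)
qed

lemma L2_subset:
  assumes "f \<in> L2 S" "T \<subseteq> S" "S \<in> sets lebesgue" "T \<in> sets lebesgue"
  shows "f \<in> L2 T"
  using assms by (auto simp: L2_def intro: integrable_lebesgue_on_subset measurable_restrict_mono)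

lemma L2_integrable_on:
  assumes "f \<in> L2 S" "T \<subseteq> S" "S \<in> lmeasurable" "T \<in> sets lebesgue"
  shows "f integrable_on T" "(\<lambda>x. cmod (f x)) integrable_on T" "integrable (lebesgue_on T) f"
proof -
  show *: "integrable (lebesgue_on T) f"
    by (rule integrable_lebesgue_on_subset[OF L2_integrable[OF assms(1,3)]]) (use assms in auto)
  then show "f integrable_on T" "(\<lambda>x. cmod (f x)) integrable_on T"
    using assms(4) by (auto intro!: integrable_on_lebesgue_on)
qed

lemma L2_inner_integrable:
  assumes "f \<in> L2 S" "g \<in> L2 S" shows "integrable (lebesgue_on S) (\<lambda>x. cnj (f x) * g x)"
  by (rule L2_integrable_product[OF L2_cnj]) (use assms in auto)

lemma L2_inner_add_right:
  "\<lbrakk>f \<in> L2 S; g \<in> L2 S; h \<in> L2 S\<rbrakk> \<Longrightarrow> L2_inner S f (\<lambda>x. g x + h x) = L2_inner S f g + L2_inner S f h"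
  unfolding L2_inner_def by (simp add: distrib_left L2_inner_integrable)

lemma L2_inner_diff_right:
  "\<lbrakk>f \<in> L2 S; g \<in> L2 S; h \<in> L2 S\<rbrakk> \<Longrightarrow> L2_inner S f (\<lambda>x. g x - h x) = L2_inner S f g - L2_inner S f h"
  unfolding L2_inner_def by (simp add: right_diff_distrib L2_inner_integrable)

lemma L2_inner_scale_right: "L2_inner S f (\<lambda>x. c * g x) = c * L2_inner S f g"
  unfolding L2_inner_def by (simp add: mult.left_commute[of _ c])

lemma L2_inner_commute: "L2_inner S f g = cnj (L2_inner S g f)"
proof -
  have "cnj (L2_inner S g f) = (LINT x|lebesgue_on S. cnj (cnj (g x) * f x))"
    unfolding L2_inner_def by (rule Bochner_Integration.integral_cnj[symmetric])
  then show ?thesis by (simp add: L2_inner_def mult.commute)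
qed

lemma L2_inner_scale_left: "L2_inner S (\<lambda>x. c * f x) g = cnj c * L2_inner S f g"
  using L2_inner_scale_right[of S g c f] L2_inner_commute[of S "\<lambda>x. c * f x" g] L2_inner_commute[of S f g]
  by simp

lemma L2_inner_diff_left:
  assumes "f \<in> L2 S" "g \<in> L2 S" "h \<in> L2 S"
  shows "L2_inner S (\<lambda>x. g x - h x) f = L2_inner S g f - L2_inner S h f"
  using L2_inner_diff_right[OF assms] by (metis L2_inner_commute complex_cnj_diff)

lemma L2_norm_nonneg [simp]: "0 \<le> L2_norm S f"
  by (simp add: L2_norm_def)

lemma L2_inner_self: "L2_inner S f f = of_real ((L2_norm S f)\<^sup>2)"
proof -
  have "L2_inner S f f = (LINT x|lebesgue_on S. of_real ((cmod (f x))\<^sup>2))"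
    unfolding L2_inner_def by (intro Bochner_Integration.integral_cong refl) (simp add: complex_norm_square mult.commute del: of_real_power)
  then show ?thesis by (simp add: L2_norm_def del: of_real_power)
qed

lemma L2_inner_cong_AE:
  assumes "AE x in lebesgue_on S. f x = f' x" "AE x in lebesgue_on S. g x = g' x"
    "f \<in> L2 S" "f' \<in> L2 S" "g \<in> L2 S" "g' \<in> L2 S"
  shows "L2_inner S f g = L2_inner S f' g'"
  unfolding L2_inner_def
proof (rule integral_cong_AE)
  show "AE x in lebesgue_on S. cnj (f x) * g x = cnj (f' x) * g' x"
    using assms(1,2) by eventually_elim simp
qed (intro borel_measurable_integrable L2_inner_integrable assms)+

lemma L2_norm_eq_0_iff:
  assumes "f \<in> L2 S"
  shows "L2_norm S f = 0 \<longleftrightarrow> ae_eq S f (\<lambda>x. 0)"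
  unfolding L2_norm_def ae_eq_def
  using integral_nonneg_eq_0_iff_AE[OF L2_square_integrable[OF assms]] by simp

lemma L2_inner_eq_0_AE:
  assumes "ae_eq S f (\<lambda>x. 0)" "f \<in> L2 S" "g \<in> L2 S"
  shows "L2_inner S f g = 0"
  using L2_inner_cong_AE[where S=S and f=f and f'="\<lambda>x. 0" and g=g and g'=g] assms by (simp add: ae_eq_def L2_inner_def)

lemma L2_norm_diff_sq:
  assumes "f \<in> L2 S" "g \<in> L2 S"
  shows "(L2_norm S (\<lambda>x. f x - g x))\<^sup>2 = (L2_norm S f)\<^sup>2 - 2 * Re (L2_inner S f g) + (L2_norm S g)\<^sup>2"
proof -
  have d: "(\<lambda>x. f x - g x) \<in> L2 S" using L2_diff assms .
  have "of_real ((L2_norm S (\<lambda>x. f x - g x))\<^sup>2) = L2_inner S (\<lambda>x. f x - g x) (\<lambda>x. f x - g x)"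
    by (simp add: L2_inner_self)
  also have "\<dots> = L2_inner S f f - L2_inner S f g - (L2_inner S g f - L2_inner S g g)"
    using assms d by (simp add: L2_inner_diff_right L2_inner_diff_left)
  also have "\<dots> = of_real ((L2_norm S f)\<^sup>2) - (L2_inner S f g + cnj (L2_inner S f g)) + of_real ((L2_norm S g)\<^sup>2)"
    by (simp add: L2_inner_self L2_inner_commute[of S g f])
  also have "L2_inner S f g + cnj (L2_inner S f g) = of_real (2 * Re (L2_inner S f g))"
    by (rule complex_add_cnj)
  finally show ?thesis by (metis (no_types, lifting) of_real_add of_real_diff of_real_eq_iff)
qed

lemma L2_norm_scale: "L2_norm S (\<lambda>x. c * f x) = cmod c * L2_norm S f"
  unfolding L2_norm_def by (simp add: norm_mult power_mult_distrib real_sqrt_mult)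

text \<open>
  Expand the square of the norm of \<open>f - c g\<close>, where \<open>c g\<close> is the orthogonal projection of \<open>f\<close> onto \<open>g\<close>.
\<close>
lemma L2_Cauchy_Schwarz:
  assumes "f \<in> L2 S" "g \<in> L2 S"
  shows "cmod (L2_inner S f g) \<le> L2_norm S f * L2_norm S g"
proof (cases "L2_norm S g = 0")
  case True
  then have "L2_inner S g f = 0"
    using assms by (intro L2_inner_eq_0_AE) (auto simp: L2_norm_eq_0_iff)
  then show ?thesis using L2_inner_commute[of S f g] True by simp
next
  case False
  define a b p where "a = L2_norm S f" and "b = L2_norm S g" and "p = L2_inner S f g"
  have "b > 0" using False by (simp add: b_def order.strict_iff_order)
  define c where "c = cnj p / of_real (b\<^sup>2)"
  have "0 \<le> (L2_norm S (\<lambda>x. f x - c * g x))\<^sup>2" by simp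
  also have "\<dots> = a\<^sup>2 - 2 * Re (c * p) + (cmod c)\<^sup>2 * b\<^sup>2"
    using L2_norm_diff_sq[OF assms(1) L2_scale[OF assms(2), of c]]
    by (simp add: L2_inner_scale_right L2_norm_scale power_mult_distrib a_def b_def p_def)
  also have "c * p = of_real ((cmod p)\<^sup>2 / b\<^sup>2)"
    by (simp add: c_def complex_norm_square mult.commute del: of_real_power)
  also have "(cmod c)\<^sup>2 * b\<^sup>2 = (cmod p)\<^sup>2 / b\<^sup>2"
    using \<open>b > 0\<close> by (simp add: c_def norm_divide norm_mult power_divide norm_power field_simps power2_eq_square)
  finally have "(cmod p)\<^sup>2 \<le> (a * b)\<^sup>2"
    using \<open>b > 0\<close> by (simp add: field_simps power_mult_distrib)
  then show ?thesis
    unfolding a_def b_def p_def by (rule power2_le_imp_le) simp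
qed

lemma L2_norm_diff_le:
  assumes "f \<in> L2 S" "g \<in> L2 S"
  shows "L2_norm S (\<lambda>x. f x - g x) \<le> L2_norm S f + L2_norm S g"
proof (rule power2_le_imp_le)
  have "- Re (L2_inner S f g) \<le> L2_norm S f * L2_norm S g"
    using L2_Cauchy_Schwarz[OF assms] abs_Re_le_cmod[of "L2_inner S f g"] by linarith
  then show "(L2_norm S (\<lambda>x. f x - g x))\<^sup>2 \<le> (L2_norm S f + L2_norm S g)\<^sup>2"
    by (simp add: L2_norm_diff_sq[OF assms] power2_sum)
qed simp

lemma L2_norm_bounded:
  assumes "S \<in> lmeasurable" "f \<in> L2 S" "\<And>x. x \<in> S \<Longrightarrow> cmod (f x) \<le> K" "0 \<le> K"
  shows "L2_norm S f \<le> sqrt (measure lebesgue S) * K"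
proof -
  have "(LINT x|lebesgue_on S. (cmod (f x))\<^sup>2) \<le> (LINT x|lebesgue_on S. K\<^sup>2)"
    using assms finite_measure.integrable_const[OF finite_measure_lebesgue_on[OF assms(1)]]
    by (intro integral_mono L2_square_integrable) (auto intro: power_mono)
  also have "\<dots> = measure lebesgue S * K\<^sup>2"
    using assms(1) by (simp add: measure_restrict_space fmeasurableD)
  finally have "L2_norm S f \<le> sqrt (measure lebesgue S * K\<^sup>2)"
    unfolding L2_norm_def by simp
  then show ?thesis using assms(4) by (simp add: real_sqrt_mult)
qed

text \<open>
  The Cauchy-Schwarz inequality with the constant function 1.
\<close>
lemma L2_L1_bound:
  assumes "S \<in> lmeasurable" "f \<in> L2 S" "T \<subseteq> S" "T \<in> sets lebesgue"
  shows "integral T (\<lambda>x. cmod (f x)) \<le> sqrt (measure lebesgue S) * L2_norm S f"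
proof -
  have f': "(\<lambda>x. complex_of_real (cmod (f x))) \<in> L2 S"
    using L2_compose_cmod_preserving[OF assms(2), of "\<lambda>z. of_real (cmod z)"] by (auto intro: continuous_intros)
  have one: "(\<lambda>x. 1) \<in> L2 S" using assms(1) by (rule L2_bounded[where K=1]) auto
  have int: "integrable (lebesgue_on S) (\<lambda>x. cmod (f x))"
    using L2_integrable[OF assms(2,1)] by simp
  have "integral T (\<lambda>x. cmod (f x)) \<le> integral S (\<lambda>x. cmod (f x))"
    using L2_integrable_on[OF assms(2) _ assms(1)] assms by (intro integral_subset_le) auto
  also have "\<dots> = (LINT x|lebesgue_on S. cmod (f x))"
    using lebesgue_integral_eq_integral[OF int] assms(1) by (simp add: fmeasurableD)
  also have "\<dots> = cmod (L2_inner S (\<lambda>x. 1) (\<lambda>x. complex_of_real (cmod (f x))))"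
    unfolding L2_inner_def by (simp add: integral_nonneg_AE)
  also have "\<dots> \<le> L2_norm S (\<lambda>x. 1) * L2_norm S (\<lambda>x. complex_of_real (cmod (f x)))"
    by (rule L2_Cauchy_Schwarz[OF one f'])
  also have "L2_norm S (\<lambda>x. complex_of_real (cmod (f x))) = L2_norm S f"
    by (simp add: L2_norm_def)
  also have "L2_norm S (\<lambda>x. 1) \<le> sqrt (measure lebesgue S)"
    using L2_norm_bounded[OF assms(1) one, of 1] by simp
  finally show ?thesis by (simp add: mult_right_mono)
qed

section \<open>Primitives of square-integrable functions\<close>

text \<open>
  Square integrability makes the absolute continuity of the integral elementary: since
  \<open>\<bar>g\<bar> \<le> 1 / \<eta> + \<eta> \<bar>g\<bar>\<^sup>2\<close>, the integral of \<open>\<bar>g\<bar>\<close> over a set of measure \<open>\<delta>\<close> is at most \<open>\<delta> / \<eta>\<close>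
  plus \<open>\<eta>\<close> times the integral of \<open>\<bar>g\<bar>\<^sup>2\<close> over \<open>S\<close>.
\<close>
lemma abs_continuous_on_L2_bound:
  assumes S: "S \<in> lmeasurable" and g: "g \<in> L2 S"
    and bound: "\<And>u v. \<lbrakk>u \<le> v; {u..v} \<subseteq> S\<rbrakk> \<Longrightarrow> cmod (f v - f u) \<le> integral {u..v} (\<lambda>x. cmod (g x))"
  shows "abs_continuous_on S f"
  unfolding abs_continuous_on_def
proof (intro allI impI)
  fix \<epsilon> :: real assume "\<epsilon> > 0"
  define q where "q x = (cmod (g x))\<^sup>2" for x
  define Q where "Q = integral S q"
  have q_int: "set_integrable lebesgue T q" if "T \<subseteq> S" "T \<in> sets lebesgue" for T
    using integrable_lebesgue_on_subset[OF L2_square_integrable[OF g] that(1) _ that(2)] S that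
    by (simp add: set_integrable_def integrable_restrict_space q_def[abs_def] fmeasurableD)
  have "Q \<ge> 0"
    unfolding Q_def using q_int[of S] S
    by (intro integral_nonneg set_lebesgue_integral_eq_integral(1)) (auto simp: q_def fmeasurableD)
  define \<eta> where "\<eta> = \<epsilon> / (2 * (Q + 1))"
  have \<eta>: "\<eta> > 0" "\<eta> * Q < \<epsilon> / 2"
    using \<open>\<epsilon> > 0\<close> \<open>Q \<ge> 0\<close> by (auto simp: \<eta>_def field_simps add_pos_nonneg)
  have young: "cmod (g x) \<le> 1 / \<eta> + \<eta> * q x" for x
  proof (cases "cmod (g x) \<le> 1 / \<eta>")
    case True
    then show ?thesis using \<eta> by (auto simp: q_def intro: add_increasing2)
  next
    case False
    then have "1 \<le> \<eta> * cmod (g x)" using \<eta> by (simp add: field_simps)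
    then have "1 * cmod (g x) \<le> (\<eta> * cmod (g x)) * cmod (g x)" by (intro mult_right_mono) auto
    then show ?thesis using \<eta> by (auto simp: q_def power2_eq_square intro: add_increasing)
  qed
  have interval_bound: "cmod (f v - f u) \<le> (v - u) / \<eta> + \<eta> * (LINT x:{u<..<v}|lebesgue. q x)"
    if uv: "u \<le> v" "{u..v} \<subseteq> S" for u v
  proof -
    have q_on: "q integrable_on {u..v}"
      using set_lebesgue_integral_eq_integral(1)[OF q_int[OF uv(2)]] by simp
    then have rhs_on: "(\<lambda>x. \<eta> * q x) integrable_on {u..v}"
      using integrable_cmul[OF q_on, of \<eta>] by simp
    have "integral {u..v} (\<lambda>x. cmod (g x)) \<le> integral {u..v} (\<lambda>x. 1 / \<eta> + \<eta> * q x)"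
      using L2_integrable_on(2)[OF g uv(2) S] rhs_on
      by (intro integral_le young integrable_add) auto
    also have "\<dots> = (v - u) / \<eta> + \<eta> * integral {u..v} q"
      using uv Henstock_Kurzweil_Integration.integral_add[OF Henstock_Kurzweil_Integration.integrable_const_ivl rhs_on, of "1 / \<eta>"] by simp
    also have "integral {u..v} q = (LINT x:{u<..<v}|lebesgue. q x)"
    proof -
      have "{u<..<v} \<subseteq> S" using uv(2) by (auto simp: subset_iff)
      then show ?thesis
        using set_lebesgue_integral_eq_integral(2)[OF q_int[of "{u<..<v}"]]
        by (simp add: integral_open_interval_real)
    qed
    finally show ?thesis using bound[OF uv] by linarith
  qed
  \<comment> \<open>The two terms of the interval bound then contribute less than \<open>\<epsilon> / 2\<close> each.\<close>
  define \<delta> where "\<delta> = \<eta> * \<epsilon> / 2"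
  show "\<exists>\<delta>>0. \<forall>(n::nat) l u. (\<forall>i<n. l i \<le> u i \<and> {l i..u i} \<subseteq> S) \<and>
      disjoint_family_on (\<lambda>i. {l i<..<u i}) {..<n} \<and> (\<Sum>i<n. u i - l i) < \<delta> \<longrightarrow>
      (\<Sum>i<n. cmod (f (u i) - f (l i))) < \<epsilon>"
  proof (intro exI conjI allI impI; (elim conjE)?)
    show "\<delta> > 0" using \<eta> \<open>\<epsilon> > 0\<close> by (simp add: \<delta>_def)
    fix n :: nat and l u :: "nat \<Rightarrow> real"
    assume lu: "\<forall>i<n. l i \<le> u i \<and> {l i..u i} \<subseteq> S"
      and disj: "disjoint_family_on (\<lambda>i. {l i<..<u i}) {..<n}" and len: "(\<Sum>i<n. u i - l i) < \<delta>"
    have sub: "{l i<..<u i} \<subseteq> S" if "i < n" for i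
      using lu that by (force simp: subset_iff)
    have "(\<Sum>i<n. cmod (f (u i) - f (l i))) \<le> (\<Sum>i<n. (u i - l i) / \<eta> + \<eta> * (LINT x:{l i<..<u i}|lebesgue. q x))"
      using lu by (intro sum_mono interval_bound) auto
    also have "\<dots> = (\<Sum>i<n. u i - l i) / \<eta> + \<eta> * (LINT x:(\<Union>i<n. {l i<..<u i})|lebesgue. q x)"
      using sub by (subst set_integral_finite_Union)
        (auto simp: sum.distrib sum_divide_distrib sum_distrib_left disj intro!: q_int)
    also have "\<dots> < \<epsilon> / 2 + \<epsilon> / 2"
    proof (rule add_less_le_mono)
      show "(\<Sum>i<n. u i - l i) / \<eta> < \<epsilon> / 2" using len \<eta> by (simp add: \<delta>_def field_simps)
      have U: "(\<Union>i<n. {l i<..<u i}) \<subseteq> S" using sub by blast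
      have "(LINT x:(\<Union>i<n. {l i<..<u i})|lebesgue. q x) = integral (\<Union>i<n. {l i<..<u i}) q"
        by (rule set_lebesgue_integral_eq_integral(2)[OF q_int[OF U]]) auto
      also have "\<dots> \<le> Q"
        unfolding Q_def using S
        by (intro integral_subset_le U set_lebesgue_integral_eq_integral(1) q_int) (auto simp: q_def)
      finally have "\<eta> * (LINT x:(\<Union>i<n. {l i<..<u i})|lebesgue. q x) \<le> \<eta> * Q"
        using \<eta> by (intro mult_left_mono) auto
      then show "\<eta> * (LINT x:(\<Union>i<n. {l i<..<u i})|lebesgue. q x) \<le> \<epsilon> / 2"
        using \<eta> by linarith
    qed
    finally show "(\<Sum>i<n. cmod (f (u i) - f (l i))) < \<epsilon>" by simp
  qed
qed

lemma abs_continuous_on_subset: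
  "abs_continuous_on S f \<Longrightarrow> T \<subseteq> S \<Longrightarrow> abs_continuous_on T f"
  unfolding abs_continuous_on_def by (meson subset_trans)

text \<open>
  On an interval, this describes the absolutely continuous functions \<open>f\<close> with square-integrable
  derivative \<open>g\<close>, without mentioning derivatives: linear combinations, restrictions to subintervals
  and changes of \<open>g\<close> on null sets are easier to handle in this form.
\<close>
definition L2_primitive :: "real \<Rightarrow> real \<Rightarrow> (real \<Rightarrow> complex) \<Rightarrow> (real \<Rightarrow> complex) \<Rightarrow> bool" where
  "L2_primitive l r f g \<longleftrightarrow> g \<in> L2 {l..r} \<and> (\<forall>x\<in>{l..r}. f x = f l + integral {l..x} g)"

lemma L2_primitive_L2: "L2_primitive l r f g \<Longrightarrow> g \<in> L2 {l..r}"
  by (simp add: L2_primitive_def)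

lemma L2_primitive_eq:
  "L2_primitive l r f g \<Longrightarrow> x \<in> {l..r} \<Longrightarrow> f x = f l + integral {l..x} g"
  unfolding L2_primitive_def by blast

lemma L2_interval_integrable_on:
  assumes "g \<in> L2 {l..r}" "{u..v} \<subseteq> {l..r::real}"
  shows "g integrable_on {u..v}" "(\<lambda>x. cmod (g x)) integrable_on {u..v}"
  using L2_integrable_on(1,2)[OF assms(1,2)] by auto

lemma L2_primitive_diff:
  assumes "L2_primitive l r f g" "l \<le> u" "u \<le> v" "v \<le> r"
  shows "f v - f u = integral {u..v} g"
proof -
  have "g integrable_on {l..v}"
    using assms L2_interval_integrable_on(1)[OF L2_primitive_L2[OF assms(1)], of l v] by auto
  then have "integral {l..u} g + integral {u..v} g = integral {l..v} g"
    using assms by (intro Henstock_Kurzweil_Integration.integral_combine) auto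
  moreover have "f v = f l + integral {l..v} g"
    by (rule L2_primitive_eq[OF assms(1)]) (use assms in auto)
  moreover have "f u = f l + integral {l..u} g"
    by (rule L2_primitive_eq[OF assms(1)]) (use assms in auto)
  ultimately show ?thesis by (metis add_diff_cancel_left add_diff_cancel_left')
qed

lemma L2_primitive_diff_bound:
  assumes "L2_primitive l r f g" "l \<le> u" "u \<le> v" "v \<le> r"
  shows "cmod (f v - f u) \<le> integral {u..v} (\<lambda>x. cmod (g x))"
  unfolding L2_primitive_diff[OF assms]
  using L2_interval_integrable_on[OF L2_primitive_L2[OF assms(1)], of u v] assms
  by (intro integral_norm_bound_integral) auto

lemma L2_primitive_continuous_on:
  assumes "L2_primitive l r f g" shows "continuous_on {l..r} f"
proof -
  have "continuous_on {l..r} (\<lambda>x. f l + integral {l..x} g)"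
    using L2_interval_integrable_on(1)[OF L2_primitive_L2[OF assms], of l r]
    by (intro continuous_intros indefinite_integral_continuous_1) auto
  then show ?thesis
    by (rule continuous_on_eq) (rule L2_primitive_eq[OF assms, symmetric])
qed

lemma L2_primitive_derivative:
  assumes "L2_primitive l r f g"
  shows "negligible {x\<in>{l..r}. \<not> (f has_vector_derivative g x) (at x)}"
proof -
  let ?B = "{x\<in>{l<..<r}. \<not> ((\<lambda>y. integral {l..y} g) has_vector_derivative g x) (at x)}"
  have "g integrable_on {l..r}"
    using L2_interval_integrable_on(1)[OF L2_primitive_L2[OF assms]] by simp
  then have "negligible ?B" by (rule indefinite_integral_has_derivative_AE)
  moreover have "(f has_vector_derivative g x) (at x)"
    if x: "x \<in> {l<..<r}" and der: "((\<lambda>y. integral {l..y} g) has_vector_derivative g x) (at x)" for x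
  proof -
    have "((\<lambda>y. f l + integral {l..y} g) has_vector_derivative g x) (at x)"
      using der by (auto intro: derivative_eq_intros)
    then show ?thesis
      by (rule has_vector_derivative_transform_within_open[where S="{l<..<r}"])
        (use x in \<open>auto intro!: L2_primitive_eq[OF assms, symmetric]\<close>)
  qed
  then have "{x\<in>{l..r}. \<not> (f has_vector_derivative g x) (at x)} \<subseteq> insert l (insert r ?B)"
    by force
  ultimately show ?thesis by (meson negligible_insert negligible_subset)
qed

lemma L2_primitiveI_abs_continuous:
  assumes "abs_continuous_on {l..r} f" "g \<in> L2 {l..r}" "negligible N"
    and der: "\<And>x. x \<in> {l..r} - N \<Longrightarrow> (f has_vector_derivative g x) (at x within {l..r})"
  shows "L2_primitive l r f g"
  unfolding L2_primitive_def
proof (intro conjI ballI assms(2))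
  fix x assume x: "x \<in> {l..r}"
  have "(g has_integral f x - f l) {l..x}"
  proof (rule fundamental_theorem_of_calculus_abs_continuous[OF _ _ assms(3)])
    show "abs_continuous_on {l..x} f" using assms(1) x by (auto intro: abs_continuous_on_subset)
    show "(f has_vector_derivative g y) (at y within {l..x})" if "y \<in> {l..x} - N" for y
      using der[of y] that x by (auto intro: has_vector_derivative_within_subset)
  qed (use x in auto)
  then show "f x = f l + integral {l..x} g" by (simp add: integral_unique)
qed

lemma L2_primitive_cong_AE:
  assumes "L2_primitive l r f g" "AE x in lebesgue_on {l..r}. g x = h x" "h \<in> L2 {l..r}"
  shows "L2_primitive l r f h"
  unfolding L2_primitive_def
proof (intro conjI ballI assms(3))
  fix x assume x: "x \<in> {l..r}"
  have "negligible {x\<in>{l..r}. g x \<noteq> h x}"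
    using assms(2) by (simp add: AE_lebesgue_on_iff_negligible)
  then have "integral {l..x} g = integral {l..x} h"
    by (rule integral_spike) (use x in auto)
  then show "f x = f l + integral {l..x} h" using L2_primitive_eq[OF assms(1) x] by simp
qed

lemma L2_primitive_cong:
  assumes "L2_primitive l r f g" "l \<le> r"
    "\<And>x. x \<in> {l..r} \<Longrightarrow> f x = f' x" "\<And>x. x \<in> {l..r} \<Longrightarrow> g x = g' x"
  shows "L2_primitive l r f' g'"
proof -
  have "g' \<in> L2 {l..r}"
  proof (rule L2_cong_AE[OF L2_primitive_L2[OF assms(1)]])
    show "g' \<in> borel_measurable (lebesgue_on {l..r})"
      using L2_borel_measurable[OF L2_primitive_L2[OF assms(1)]] assms(4)
      by (subst measurable_cong[where g=g]) auto
  qed (use assms(4) in \<open>auto intro: AE_I2\<close>)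
  moreover have "f' x = f' l + integral {l..x} g'" if x: "x \<in> {l..r}" for x
  proof -
    have "integral {l..x} g = integral {l..x} g'"
      using assms(4) x by (intro Henstock_Kurzweil_Integration.integral_cong) auto
    then show ?thesis
      using L2_primitive_eq[OF assms(1) x] assms(3)[OF x] assms(3)[of l] assms(2) by simp
  qed
  ultimately show ?thesis unfolding L2_primitive_def by blast
qed

lemma L2_primitive_add:
  assumes "L2_primitive l r f g" "L2_primitive l r f' g'"
  shows "L2_primitive l r (\<lambda>x. f x + f' x) (\<lambda>x. g x + g' x)"
  unfolding L2_primitive_def
proof (intro conjI ballI)
  show "(\<lambda>x. g x + g' x) \<in> L2 {l..r}" using assms by (intro L2_add L2_primitive_L2)
  fix x assume x: "x \<in> {l..r}"
  have "integral {l..x} (\<lambda>x. g x + g' x) = integral {l..x} g + integral {l..x} g'"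
    using x L2_interval_integrable_on(1)[OF L2_primitive_L2[OF assms(1)], of l x]
      L2_interval_integrable_on(1)[OF L2_primitive_L2[OF assms(2)], of l x]
    by (intro Henstock_Kurzweil_Integration.integral_add) auto
  then show "f x + f' x = f l + f' l + integral {l..x} (\<lambda>x. g x + g' x)"
    using L2_primitive_eq[OF assms(1) x] L2_primitive_eq[OF assms(2) x] by simp
qed

lemma L2_primitive_scale:
  assumes "L2_primitive l r f g"
  shows "L2_primitive l r (\<lambda>x. c * f x) (\<lambda>x. c * g x)"
  unfolding L2_primitive_def
proof (intro conjI ballI)
  show "(\<lambda>x. c * g x) \<in> L2 {l..r}" using assms by (intro L2_scale L2_primitive_L2)
  fix x assume x: "x \<in> {l..r}"
  show "c * f x = c * f l + integral {l..x} (\<lambda>x. c * g x)"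
    using L2_primitive_eq[OF assms x] by (simp add: distrib_left)
qed

lemma L2_primitive_cnj:
  assumes "L2_primitive l r f g"
  shows "L2_primitive l r (\<lambda>x. cnj (f x)) (\<lambda>x. cnj (g x))"
  unfolding L2_primitive_def
proof (intro conjI ballI)
  show "(\<lambda>x. cnj (g x)) \<in> L2 {l..r}" using assms by (intro L2_cnj L2_primitive_L2)
  fix x assume x: "x \<in> {l..r}"
  show "cnj (f x) = cnj (f l) + integral {l..x} (\<lambda>x. cnj (g x))"
    using L2_primitive_eq[OF assms x]
    by (simp add: Henstock_Kurzweil_Integration.integral_cnj[symmetric])
qed

lemma continuous_on_interval_bounded:
  fixes f :: "real \<Rightarrow> complex"
  assumes "continuous_on {l..r} f"
  obtains K where "0 \<le> K" "\<And>x. x \<in> {l..r} \<Longrightarrow> cmod (f x) \<le> K"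
proof -
  have "bounded (f ` {l..r})"
    using compact_imp_bounded[OF compact_continuous_image[OF assms]] by simp
  then obtain K where "\<forall>y \<in> f ` {l..r}. cmod y \<le> K" by (auto simp only: bounded_iff)
  then show thesis by (intro that[of "max 0 K"]) (auto simp: max.coboundedI2)
qed

lemma L2_continuous_on:
  assumes "continuous_on {l..r} f" shows "f \<in> L2 {l..r}"
proof -
  obtain K where "\<And>x. x \<in> {l..r} \<Longrightarrow> cmod (f x) \<le> K"
    using continuous_on_interval_bounded[OF assms] by blast
  then show ?thesis
    using assms by (intro L2_bounded[where K=K] continuous_imp_measurable_on_sets_lebesgue) auto
qed

lemma L2_primitiveI_C1:
  assumes "\<And>x. (f has_vector_derivative g x) (at x)" "continuous_on UNIV g"
  shows "L2_primitive l r f g"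
  unfolding L2_primitive_def
proof (intro conjI ballI)
  show "g \<in> L2 {l..r}" using assms(2) by (intro L2_continuous_on) (auto intro: continuous_on_subset)
  fix x assume "x \<in> {l..r}"
  then have "(g has_integral f x - f l) {l..x}"
    using assms(1) by (intro fundamental_theorem_of_calculus) (auto intro: has_vector_derivative_at_within)
  then show "f x = f l + integral {l..x} g" by (simp add: integral_unique)
qed

text \<open>
  The product rule holds at almost every point, and the product is absolutely continuous, so the
  fundamental theorem of calculus turns the rule into integration by parts.
\<close>
lemma L2_primitive_mult:
  assumes f: "L2_primitive l r f f'" and g: "L2_primitive l r g g'"
  shows "L2_primitive l r (\<lambda>x. f x * g x) (\<lambda>x. f' x * g x + f x * g' x)"
proof -
  have cont: "continuous_on {l..r} f" "continuous_on {l..r} g"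
    using f g by (auto intro: L2_primitive_continuous_on)
  obtain K1 where K1: "\<And>x. x \<in> {l..r} \<Longrightarrow> cmod (f x) \<le> K1"
    using continuous_on_interval_bounded[OF cont(1)] by blast
  obtain K2 where K2: "\<And>x. x \<in> {l..r} \<Longrightarrow> cmod (g x) \<le> K2"
    using continuous_on_interval_bounded[OF cont(2)] by blast
  define K where "K = max 0 (max K1 K2)"
  have K: "cmod (f x) \<le> K" "cmod (g x) \<le> K" if "x \<in> {l..r}" for x
    using K1[OF that] K2[OF that] by (auto simp: K_def)
  have f'2: "f' \<in> L2 {l..r}" and g'2: "g' \<in> L2 {l..r}" using f g by (auto intro: L2_primitive_L2)
  have meas: "f \<in> borel_measurable (lebesgue_on {l..r})" "g \<in> borel_measurable (lebesgue_on {l..r})"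
    using cont by (auto intro: continuous_imp_measurable_on_sets_lebesgue)
  have deriv2: "(\<lambda>x. f' x * g x + f x * g' x) \<in> L2 {l..r}"
    using L2_add[OF L2_mult_bounded[OF meas(2) K(2) f'2] L2_mult_bounded[OF meas(1) K(1) g'2]]
    by (simp add: mult.commute)
  define h where "h x = complex_of_real (K * cmod (f' x) + K * cmod (g' x))" for x
  have h2: "h \<in> L2 {l..r}"
    using L2_add[OF L2_scale[OF L2_compose_cmod_preserving[OF f'2, of "\<lambda>z. of_real (cmod z)"], of K]
       L2_scale[OF L2_compose_cmod_preserving[OF g'2, of "\<lambda>z. of_real (cmod z)"], of K]]
    by (simp add: h_def[abs_def] continuous_intros)
  have h_cmod: "cmod (h x) = K * cmod (f' x) + K * cmod (g' x)" for x
    unfolding h_def norm_of_real by (rule abs_of_nonneg) (simp add: K_def)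
  have AC: "abs_continuous_on {l..r} (\<lambda>x. f x * g x)"
  proof (rule abs_continuous_on_L2_bound[OF _ h2])
    fix u v assume uv: "u \<le> v" "{u..v} \<subseteq> {l..r}"
    then have ends: "l \<le> u" "v \<le> r" "u \<in> {l..r}" "v \<in> {l..r}" by auto
    have "cmod (f v * g v - f u * g u) = cmod ((f v - f u) * g v + f u * (g v - g u))"
      by (simp add: algebra_simps)
    also have "\<dots> \<le> cmod (f v - f u) * cmod (g v) + cmod (f u) * cmod (g v - g u)"
      by (metis norm_mult norm_triangle_ineq)
    also have "\<dots> \<le> integral {u..v} (\<lambda>x. cmod (f' x)) * K + K * integral {u..v} (\<lambda>x. cmod (g' x))"
      using L2_primitive_diff_bound[OF f ends(1) uv(1) ends(2)]
        L2_primitive_diff_bound[OF g ends(1) uv(1) ends(2)] K[OF ends(3)] K[OF ends(4)]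
      by (intro add_mono mult_mono) (auto intro: order_trans[OF norm_ge_zero])
    also have "\<dots> = integral {u..v} (\<lambda>x. cmod (h x))"
      unfolding h_cmod
      using L2_interval_integrable_on(2)[OF f'2 uv(2)] L2_interval_integrable_on(2)[OF g'2 uv(2)]
      by (subst Henstock_Kurzweil_Integration.integral_add)
        (simp_all add: integrable_on_mult_right mult.commute)
    finally show "cmod (f v * g v - f u * g u) \<le> integral {u..v} (\<lambda>x. cmod (h x))" .
  qed auto
  show ?thesis
  proof (rule L2_primitiveI_abs_continuous[OF AC deriv2])
    show "negligible ({x\<in>{l..r}. \<not> (f has_vector_derivative f' x) (at x)} \<union>
        {x\<in>{l..r}. \<not> (g has_vector_derivative g' x) (at x)})" (is "negligible ?N")
      using L2_primitive_derivative[OF f] L2_primitive_derivative[OF g] by (rule negligible_Un)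
    fix x assume "x \<in> {l..r} - ?N"
    then have "(f has_vector_derivative f' x) (at x)" "(g has_vector_derivative g' x) (at x)" by auto
    then have "((\<lambda>x. f x * g x) has_vector_derivative f x * g' x + f' x * g x) (at x)"
      by (rule has_vector_derivative_mult)
    then show "((\<lambda>x. f x * g x) has_vector_derivative f' x * g x + f x * g' x) (at x within {l..r})"
      by (simp add: add.commute has_vector_derivative_at_within)
  qed
qed

text \<open>
  The derivative in the definition of the momentum operator is taken within \<open>S\<close>; it is the ordinary
  one except at the four endpoints. The gap between the two intervals ensures that an interval
  contained in \<open>S\<close> lies in one of them.
\<close>
lemma momentum_dom_iff_L2_primitive:
  fixes a b c d :: real
  assumes abcd: "a < b" "b < c" "c < d" and h: "h \<in> L2 ({a..b} \<union> {c..d})"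
  defines "S \<equiv> {a..b} \<union> {c..d}"
  shows "f \<in> momentum_dom S \<and> ae_eq S (momentum S f) h \<longleftrightarrow>
      L2_primitive a b f (\<lambda>x. 2 * of_real pi * \<i> * h x) \<and> L2_primitive c d f (\<lambda>x. 2 * of_real pi * \<i> * h x)"
    (is "?L \<longleftrightarrow> ?R")
proof
  have S: "S \<in> lmeasurable" "S \<in> sets lebesgue" by (auto simp: S_def)
  define H where "H x = 2 * of_real pi * \<i> * h x" for x
  have H: "H \<in> L2 S" unfolding H_def[abs_def] S_def by (rule L2_scale[OF h])
  define Df where "Df x = vector_derivative f (at x within S)" for x
  have Df_H: "Df x = H x" if "momentum S f x = h x" for x
    using that by (simp add: Df_def H_def momentum_def field_simps)
  {
    assume ?L
    then have AC: "abs_continuous_on S f" and diff: "AE x in lebesgue_on S. f differentiable (at x within S)"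
      and Df2: "Df \<in> L2 S" and eq: "AE x in lebesgue_on S. momentum S f x = h x"
      by (auto simp: momentum_dom_def Df_def[abs_def] ae_eq_def)
    define N where "N = {x\<in>S. \<not> f differentiable (at x within S)}"
    have N: "negligible N"
      using diff S by (simp add: N_def AE_lebesgue_on_iff_negligible)
    have eqH: "AE x in lebesgue_on S. Df x = H x"
      using eq by eventually_elim (rule Df_H)
    have "L2_primitive l r f H" if lr: "{l..r} \<subseteq> S" for l r
    proof (rule L2_primitive_cong_AE)
      show "L2_primitive l r f Df"
      proof (rule L2_primitiveI_abs_continuous[OF abs_continuous_on_subset[OF AC lr] L2_subset[OF Df2 lr S(2)] N])
        fix x assume "x \<in> {l..r} - N"
        then have "f differentiable (at x within S)" using lr by (auto simp: N_def)
        then have "(f has_vector_derivative Df x) (at x within S)"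
          unfolding Df_def by (simp add: vector_derivative_works)
        then show "(f has_vector_derivative Df x) (at x within {l..r})"
          using lr by (rule has_vector_derivative_within_subset)
      qed auto
      have "negligible {x\<in>S. \<not> Df x = H x}"
        using eqH S by (simp add: AE_lebesgue_on_iff_negligible)
      then have "negligible {x\<in>{l..r}. \<not> Df x = H x}"
        by (rule negligible_subset) (use lr in auto)
      then show "AE x in lebesgue_on {l..r}. Df x = H x"
        by (simp add: AE_lebesgue_on_iff_negligible)
      show "H \<in> L2 {l..r}" by (rule L2_subset[OF H lr S(2)]) auto
    qed
    then have "L2_primitive a b f H" "L2_primitive c d f H" by (auto simp: S_def)
    then show ?R by (simp add: H_def[abs_def])
  }
  {
    assume ?R
    then have prim: "L2_primitive a b f H" "L2_primitive c d f H" by (simp_all add: H_def[abs_def])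
    have AC: "abs_continuous_on S f"
    proof (rule abs_continuous_on_L2_bound[OF S(1) H])
      fix u v assume uv: "u \<le> v" "{u..v} \<subseteq> S"
      have "(b + c) / 2 \<notin> S" using abcd by (auto simp: S_def)
      then have "\<not> (u \<le> (b + c) / 2 \<and> (b + c) / 2 \<le> v)" using uv by (meson atLeastAtMost_iff subsetD)
      moreover have "u \<in> S" "v \<in> S" using uv by auto
      ultimately have "(a \<le> u \<and> v \<le> b) \<or> (c \<le> u \<and> v \<le> d)" using uv abcd by (auto simp: S_def)
      then show "cmod (f v - f u) \<le> integral {u..v} (\<lambda>x. cmod (H x))"
        using L2_primitive_diff_bound[OF prim(1), of u v] L2_primitive_diff_bound[OF prim(2), of u v] uv by auto
    qed
    define N where "N = {x\<in>{a..b}. \<not> (f has_vector_derivative H x) (at x)} \<union>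
        {x\<in>{c..d}. \<not> (f has_vector_derivative H x) (at x)} \<union> {a,b,c,d}"
    have N: "negligible N"
      unfolding N_def using prim by (intro negligible_Un L2_primitive_derivative) auto
    have good: "(f has_vector_derivative H x) (at x within S)" "Df x = H x" if "x \<in> S - N" for x
    proof -
      have "x \<in> {a<..<b} \<union> {c<..<d}" using that by (auto simp: S_def N_def)
      moreover have "open ({a<..<b} \<union> {c<..<d})" "{a<..<b} \<union> {c<..<d} \<subseteq> S" by (auto simp: S_def)
      ultimately have "x \<in> interior S" by (meson interiorI)
      then have at: "at x within S = at x" by (rule at_within_interior)
      have der: "(f has_vector_derivative H x) (at x)" using that by (auto simp: N_def S_def)
      then show "(f has_vector_derivative H x) (at x within S)" by (simp add: at)
      show "Df x = H x" using der by (simp add: Df_def at vector_derivative_at)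
    qed
    have AE_good: "AE x in lebesgue_on S. f differentiable (at x within S) \<and> Df x = H x"
    proof -
      have "negligible {x\<in>S. \<not> (f differentiable (at x within S) \<and> Df x = H x)}"
        by (rule negligible_subset[OF N]) (use good differentiableI_vector in blast)
      then show ?thesis using S(2) by (subst AE_lebesgue_on_iff_negligible) auto
    qed
    have "Df \<in> borel_measurable (lebesgue_on S)"
    proof -
      have "N \<inter> S \<in> null_sets lebesgue"
        using N negligible_Int by (auto simp: negligible_iff_null_sets[symmetric])
      then have null: "N \<inter> S \<in> null_sets (lebesgue_on S)"
        using S(2) by (subst null_sets_restrict_space) auto
      have "H \<in> borel_measurable (lebesgue_on (S - N \<inter> S))"
        using L2_borel_measurable[OF H] borel_measurable_diff_null[OF null S(2)] by blast
      then have "Df \<in> borel_measurable (lebesgue_on (S - N \<inter> S))"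
        using good(2) by (subst measurable_cong[where g=H]) auto
      then show ?thesis using borel_measurable_diff_null[OF null S(2)] by blast
    qed
    then have "Df \<in> L2 S"
      using AE_good by (intro L2_cong_AE[OF H]) (auto elim: AE_mp)
    moreover have "ae_eq S (momentum S f) h"
      using AE_good unfolding ae_eq_def
      by eventually_elim (simp add: Df_def H_def momentum_def field_simps)
    ultimately show ?L
      using AC AE_good by (auto simp: momentum_dom_def Df_def[abs_def])
  }
qed

section \<open>The differential equation on one interval\<close>

text \<open>
  The function \<open>e(z x)\<close> for complex frequencies \<open>z\<close>.
\<close>
definition wave :: "complex \<Rightarrow> real \<Rightarrow> complex" where
  "wave z x = exp (2 * of_real pi * \<i> * z * of_real x)"

lemma wave_0 [simp]: "wave z 0 = 1"
  by (simp add: wave_def)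

lemma wave_nonzero [simp]: "wave z x \<noteq> 0"
  by (simp add: wave_def)

lemma wave_add: "wave z (x + y) = wave z x * wave z y"
  by (simp add: wave_def exp_add[symmetric] algebra_simps)

lemma wave_cancel [simp]: "wave z (x - y) * wave z (y - x) = 1"
  by (simp flip: wave_add)

lemma wave_has_vector_derivative:
  "((\<lambda>x. wave z (x - l)) has_vector_derivative 2 * of_real pi * \<i> * z * wave z (x - l)) (at x)"
  "((\<lambda>x. wave z (l - x)) has_vector_derivative - (2 * of_real pi * \<i> * z * wave z (l - x))) (at x)"
proof -
  have "((\<lambda>w. exp (2 * of_real pi * \<i> * z * (w - of_real l))) has_field_derivative
      2 * of_real pi * \<i> * z * exp (2 * of_real pi * \<i> * z * (of_real x - of_real l))) (at (of_real x))"
    by (auto intro!: derivative_eq_intros)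
  from has_vector_derivative_real_field[OF this]
  show "((\<lambda>x. wave z (x - l)) has_vector_derivative 2 * of_real pi * \<i> * z * wave z (x - l)) (at x)"
    by (simp add: wave_def)
  have "((\<lambda>w. exp (2 * of_real pi * \<i> * z * (of_real l - w))) has_field_derivative
      - (2 * of_real pi * \<i> * z * exp (2 * of_real pi * \<i> * z * (of_real l - of_real x)))) (at (of_real x))"
    by (auto intro!: derivative_eq_intros)
  from has_vector_derivative_real_field[OF this]
  show "((\<lambda>x. wave z (l - x)) has_vector_derivative - (2 * of_real pi * \<i> * z * wave z (l - x))) (at x)"
    by (simp add: wave_def)
qed

lemma continuous_on_wave [continuous_intros]:
  "continuous_on A f \<Longrightarrow> continuous_on A (\<lambda>x. wave z (f x))"
  unfolding wave_def by (intro continuous_intros)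

lemma L2_primitive_wave:
  "L2_primitive a b (\<lambda>x. wave z (x - l)) (\<lambda>x. 2 * of_real pi * \<i> * z * wave z (x - l))"
  "L2_primitive a b (\<lambda>x. wave z (l - x)) (\<lambda>x. - (2 * of_real pi * \<i> * z * wave z (l - x)))"
  by (intro L2_primitiveI_C1 wave_has_vector_derivative continuous_intros)+

text \<open>
  The particular solution in the variation of constants formula, up to the factor \<open>e(z (x - l))\<close>.
\<close>
definition wave_integral :: "complex \<Rightarrow> real \<Rightarrow> (real \<Rightarrow> complex) \<Rightarrow> real \<Rightarrow> complex" where
  "wave_integral z l h x = integral {l..x} (\<lambda>t. wave z (l - t) * (2 * of_real pi * \<i> * h t))"

lemma wave_integral_zero [simp]: "wave_integral z l (\<lambda>x. 0) x = 0"
  by (simp add: wave_integral_def)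

lemma L2_primitive_wave_integral:
  assumes "h \<in> L2 {l..r}"
  shows "L2_primitive l r (\<lambda>x. c + wave_integral z l h x) (\<lambda>t. wave z (l - t) * (2 * of_real pi * \<i> * h t))"
proof -
  have cont: "continuous_on {l..r} (\<lambda>t. wave z (l - t))" by (intro continuous_intros)
  obtain K where "\<And>t. t \<in> {l..r} \<Longrightarrow> cmod (wave z (l - t)) \<le> K"
    using continuous_on_interval_bounded[OF cont] by blast
  then have "(\<lambda>t. wave z (l - t) * (2 * of_real pi * \<i> * h t)) \<in> L2 {l..r}"
    using cont by (intro L2_mult_bounded[where K=K] L2_scale assms continuous_imp_measurable_on_sets_lebesgue) auto
  then show ?thesis by (auto simp: L2_primitive_def wave_integral_def)
qed

text \<open>
  A bound that is uniform in \<open>x\<close> and linear in the norm of \<open>h\<close>; it makes the resolvent bounded.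
\<close>
lemma wave_integral_bound:
  assumes "S \<in> lmeasurable" "{l..r} \<subseteq> S"
  obtains K where "0 \<le> K" "\<And>h x. \<lbrakk>h \<in> L2 S; x \<in> {l..r}\<rbrakk> \<Longrightarrow> cmod (wave_integral z l h x) \<le> K * L2_norm S h"
proof -
  have cont: "continuous_on {l..r} (\<lambda>t. wave z (l - t))" by (intro continuous_intros)
  obtain K where K: "0 \<le> K" "\<And>t. t \<in> {l..r} \<Longrightarrow> cmod (wave z (l - t)) \<le> K"
    using continuous_on_interval_bounded[OF cont] by blast
  show thesis
  proof (rule that[of "(K * (2 * pi)) * sqrt (measure lebesgue S)"])
    show "0 \<le> K * (2 * pi) * sqrt (measure lebesgue S)" using K by simp
    fix h x assume h: "h \<in> L2 S" and x: "x \<in> {l..r}"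
    have sub: "{l..x} \<subseteq> S" "{l..x} \<subseteq> {l..r}" using x assms by auto
    have h': "h \<in> L2 {l..r}" using assms by (intro L2_subset[OF h]) auto
    have int: "(\<lambda>t. wave z (l - t) * (2 * of_real pi * \<i> * h t)) integrable_on {l..x}"
      using L2_interval_integrable_on(1)[OF L2_primitive_L2[OF L2_primitive_wave_integral[OF h']] sub(2)] .
    have "cmod (wave_integral z l h x) \<le> integral {l..x} (\<lambda>t. (K * (2 * pi)) * cmod (h t))"
      unfolding wave_integral_def
    proof (rule integral_norm_bound_integral[OF int])
      show "(\<lambda>t. K * (2 * pi) * cmod (h t)) integrable_on {l..x}"
        using L2_interval_integrable_on(2)[OF h' sub(2)] by (rule integrable_on_mult_right)
      fix t assume "t \<in> {l..x}"
      then have "cmod (wave z (l - t)) \<le> K" using x by (intro K) auto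
      then show "norm (wave z (l - t) * (2 * of_real pi * \<i> * h t)) \<le> K * (2 * pi) * cmod (h t)"
        using K(1) by (auto simp: norm_mult mult.assoc intro!: mult_mono)
    qed
    also have "\<dots> = (K * (2 * pi)) * integral {l..x} (\<lambda>t. cmod (h t))" by simp
    also have "\<dots> \<le> (K * (2 * pi)) * (sqrt (measure lebesgue S) * L2_norm S h)"
      using K by (intro mult_left_mono L2_L1_bound[OF assms(1) h sub(1)]) auto
    finally show "cmod (wave_integral z l h x) \<le> K * (2 * pi) * sqrt (measure lebesgue S) * L2_norm S h"
      by (simp add: mult_ac)
  qed
qed

text \<open>
  Variation of constants: multiply by the integrating factor \<open>e(-z (x - l))\<close> and use the product rule.
\<close>
lemma L2_primitive_resolvent_iff:
  assumes h: "h \<in> L2 {l..r}" and lr: "l \<le> r"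
  shows "L2_primitive l r u (\<lambda>x. 2 * of_real pi * \<i> * (z * u x + h x)) \<longleftrightarrow>
    (\<forall>x\<in>{l..r}. u x = wave z (x - l) * (u l + wave_integral z l h x))" (is "?L \<longleftrightarrow> ?R")
proof
  assume ?L
  have "L2_primitive l r (\<lambda>x. wave z (l - x) * u x) (\<lambda>x. wave z (l - x) * (2 * of_real pi * \<i> * h x))"
    by (rule L2_primitive_cong[OF L2_primitive_mult[OF L2_primitive_wave(2) \<open>?L\<close>] lr])
      (auto simp: algebra_simps)
  from L2_primitive_eq[OF this] have eq: "wave z (l - x) * u x = u l + wave_integral z l h x" if "x \<in> {l..r}" for x
    using that by (simp add: wave_integral_def)
  show ?R
  proof
    fix x assume "x \<in> {l..r}"
    have "u x = wave z (x - l) * (wave z (l - x) * u x)"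
      by (simp add: mult.assoc[symmetric])
    then show "u x = wave z (x - l) * (u l + wave_integral z l h x)"
      using eq[OF \<open>x \<in> {l..r}\<close>] by simp
  qed
next
  assume R: ?R
  have "L2_primitive l r (\<lambda>x. wave z (x - l) * (u l + wave_integral z l h x))
     (\<lambda>x. 2 * of_real pi * \<i> * z * wave z (x - l) * (u l + wave_integral z l h x)
        + wave z (x - l) * (wave z (l - x) * (2 * of_real pi * \<i> * h x)))"
    by (intro L2_primitive_mult L2_primitive_wave L2_primitive_wave_integral h)
  then show ?L
  proof (rule L2_primitive_cong[OF _ lr])
    fix x assume x: "x \<in> {l..r}"
    show "wave z (x - l) * (u l + wave_integral z l h x) = u x" by (rule bspec[OF R x, symmetric])
    have "2 * of_real pi * \<i> * z * wave z (x - l) * (u l + wave_integral z l h x)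
        + wave z (x - l) * (wave z (l - x) * (2 * of_real pi * \<i> * h x))
       = 2 * of_real pi * \<i> * (z * (wave z (x - l) * (u l + wave_integral z l h x))) + 2 * of_real pi * \<i> * h x"
      by (simp add: mult.assoc[symmetric])
    also have "\<dots> = 2 * of_real pi * \<i> * (z * u x + h x)"
      by (simp only: bspec[OF R x, symmetric]) (simp only: distrib_left)
    finally show "2 * of_real pi * \<i> * z * wave z (x - l) * (u l + wave_integral z l h x)
        + wave z (x - l) * (wave z (l - x) * (2 * of_real pi * \<i> * h x)) = 2 * of_real pi * \<i> * (z * u x + h x)" .
  qed
qed

section \<open>The momentum operator with a unitary boundary condition\<close>

text \<open>
  The boundary matrix enters only through the orthonormality of its columns and a nonzero entry
  off the diagonal.
\<close>
locale two_interval_momentum =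
  fixes \<alpha> \<beta> :: real and b11 b12 b21 b22 :: complex
  assumes one_less: "1 < \<alpha>" and less: "\<alpha> < \<beta>"
    and unit1: "cnj b11 * b11 + cnj b21 * b21 = 1"
    and unit2: "cnj b12 * b12 + cnj b22 * b22 = 1"
    and orth: "cnj b11 * b12 + cnj b21 * b22 = 0"
    and b12_nonzero: "b12 \<noteq> 0"
begin

definition S :: "real set" where "S = {0..1} \<union> {\<alpha>..\<beta>}"

lemma S_lmeasurable: "S \<in> lmeasurable" and S_sets: "S \<in> sets lebesgue"
  by (auto simp: S_def)

lemma S_sub: "{0..1} \<subseteq> S" "{\<alpha>..\<beta>} \<subseteq> S"
  by (auto simp: S_def)

text \<open>
  The maximal momentum operator as a relation: \<open>u\<close> is in its domain and \<open>a\<close> represents \<open>P u\<close>. A relation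
  is convenient because \<open>P u\<close> is determined up to null sets only.
\<close>
definition momentum_max :: "(real \<Rightarrow> complex) \<Rightarrow> (real \<Rightarrow> complex) \<Rightarrow> bool" where
  "momentum_max u a \<longleftrightarrow> a \<in> L2 S \<and> L2_primitive 0 1 u (\<lambda>x. 2 * of_real pi * \<i> * a x) \<and>
     L2_primitive \<alpha> \<beta> u (\<lambda>x. 2 * of_real pi * \<i> * a x)"

definition boundary_condition :: "(real \<Rightarrow> complex) \<Rightarrow> bool" where
  "boundary_condition u \<longleftrightarrow> b11 * u 1 + b12 * u \<beta> = u 0 \<and> b21 * u 1 + b22 * u \<beta> = u \<alpha>"

definition momentum_B :: "(real \<Rightarrow> complex) \<Rightarrow> (real \<Rightarrow> complex) \<Rightarrow> bool" where
  "momentum_B u a \<longleftrightarrow> momentum_max u a \<and> boundary_condition u"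

lemma momentum_max_lin:
  assumes "momentum_max u a" "momentum_max v b"
  shows "momentum_max (\<lambda>x. u x + c * v x) (\<lambda>x. a x + c * b x)"
proof -
  have *: "L2_primitive l r (\<lambda>x. u x + c * v x) (\<lambda>x. 2 * of_real pi * \<i> * (a x + c * b x))"
    if "L2_primitive l r u (\<lambda>x. 2 * of_real pi * \<i> * a x)" "L2_primitive l r v (\<lambda>x. 2 * of_real pi * \<i> * b x)"
    for l r
  proof -
    have "(\<lambda>x. 2 * of_real pi * \<i> * a x + c * (2 * of_real pi * \<i> * b x)) = (\<lambda>x. 2 * of_real pi * \<i> * (a x + c * b x))"
      by (simp add: fun_eq_iff algebra_simps)
    then show ?thesis using L2_primitive_add[OF that(1) L2_primitive_scale[OF that(2), of c]] by simp
  qed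
  then show ?thesis using assms by (auto simp: momentum_max_def intro: L2_add L2_scale)
qed

lemma momentum_B_lin:
  assumes "momentum_B u a" "momentum_B v b"
  shows "momentum_B (\<lambda>x. u x + c * v x) (\<lambda>x. a x + c * b x)"
  unfolding momentum_B_def
proof
  show "momentum_max (\<lambda>x. u x + c * v x) (\<lambda>x. a x + c * b x)"
    using assms by (intro momentum_max_lin) (auto simp: momentum_B_def)
  have "b11 * (u 1 + c * v 1) + b12 * (u \<beta> + c * v \<beta>) = (b11 * u 1 + b12 * u \<beta>) + c * (b11 * v 1 + b12 * v \<beta>)"
    "b21 * (u 1 + c * v 1) + b22 * (u \<beta> + c * v \<beta>) = (b21 * u 1 + b22 * u \<beta>) + c * (b21 * v 1 + b22 * v \<beta>)"
    by (simp_all add: algebra_simps)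
  then show "boundary_condition (\<lambda>x. u x + c * v x)"
    using assms by (simp add: momentum_B_def boundary_condition_def)
qed

lemma continuous_on_S_L2:
  assumes "continuous_on S f" shows "f \<in> L2 S"
proof -
  have "compact S" by (auto simp: S_def)
  then have "bounded (f ` S)" using assms by (intro compact_imp_bounded compact_continuous_image)
  then obtain K where "\<forall>y \<in> f ` S. cmod y \<le> K" by (auto simp only: bounded_iff)
  then show ?thesis
    using assms S_lmeasurable S_sets by (intro L2_bounded[where K=K] continuous_imp_measurable_on_sets_lebesgue) auto
qed

lemma momentum_max_continuous_on:
  assumes "momentum_max u a" shows "continuous_on S u"
  unfolding S_def using assms
  by (intro continuous_on_closed_Un) (auto simp: momentum_max_def intro: L2_primitive_continuous_on)

lemma momentum_max_L2: "momentum_max u a \<Longrightarrow> u \<in> L2 S" "momentum_max u a \<Longrightarrow> a \<in> L2 S"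
  by (rule continuous_on_S_L2[OF momentum_max_continuous_on]) (simp_all add: momentum_max_def)

lemma momentum_B_L2: "momentum_B u a \<Longrightarrow> u \<in> L2 S" "momentum_B u a \<Longrightarrow> a \<in> L2 S"
  by (auto simp: momentum_B_def intro: momentum_max_L2)

lemma momentum_B_cong_AE:
  assumes "momentum_B u a" "AE x in lebesgue_on S. a x = b x" "b \<in> L2 S"
  shows "momentum_B u b"
proof -
  have "L2_primitive l r u (\<lambda>x. 2 * of_real pi * \<i> * b x)"
    if "L2_primitive l r u (\<lambda>x. 2 * of_real pi * \<i> * a x)" "{l..r} \<subseteq> S" for l r
  proof (rule L2_primitive_cong_AE[OF that(1)])
    have "negligible {x\<in>S. \<not> a x = b x}" using assms(2) S_sets by (simp add: AE_lebesgue_on_iff_negligible)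
    then have "negligible {x\<in>{l..r}. \<not> 2 * of_real pi * \<i> * a x = 2 * of_real pi * \<i> * b x}"
      by (rule negligible_subset) (use that in auto)
    then show "AE x in lebesgue_on {l..r}. 2 * of_real pi * \<i> * a x = 2 * of_real pi * \<i> * b x"
      by (subst AE_lebesgue_on_iff_negligible) auto
    show "(\<lambda>x. 2 * of_real pi * \<i> * b x) \<in> L2 {l..r}"
      by (rule L2_subset[OF L2_scale[OF assms(3)] that(2) S_sets]) auto
  qed
  then show ?thesis using assms S_sub by (simp add: momentum_B_def momentum_max_def)
qed

lemma L2_inner_split:
  assumes "f \<in> L2 S" "g \<in> L2 S"
  shows "L2_inner S f g = integral {0..1} (\<lambda>x. cnj (f x) * g x) + integral {\<alpha>..\<beta>} (\<lambda>x. cnj (f x) * g x)"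
    "(\<lambda>x. cnj (f x) * g x) integrable_on {0..1}" "(\<lambda>x. cnj (f x) * g x) integrable_on {\<alpha>..\<beta>}"
proof -
  have int: "integrable (lebesgue_on S) (\<lambda>x. cnj (f x) * g x)" by (rule L2_inner_integrable[OF assms])
  show 1: "(\<lambda>x. cnj (f x) * g x) integrable_on {0..1}" and 2: "(\<lambda>x. cnj (f x) * g x) integrable_on {\<alpha>..\<beta>}"
    by (rule integrable_on_lebesgue_on[OF integrable_lebesgue_on_subset[OF int]]; simp add: S_sets S_sub)+
  have "L2_inner S f g = integral S (\<lambda>x. cnj (f x) * g x)"
    unfolding L2_inner_def by (rule lebesgue_integral_eq_integral[OF int S_sets])
  also have "{0..1} \<inter> {\<alpha>..\<beta>} = {}" using one_less by auto
  then have "integral S (\<lambda>x. cnj (f x) * g x) = integral {0..1} (\<lambda>x. cnj (f x) * g x) + integral {\<alpha>..\<beta>} (\<lambda>x. cnj (f x) * g x)"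
    unfolding S_def by (intro Henstock_Kurzweil_Integration.integral_Un 1 2) auto
  finally show "L2_inner S f g = integral {0..1} (\<lambda>x. cnj (f x) * g x) + integral {\<alpha>..\<beta>} (\<lambda>x. cnj (f x) * g x)" .
qed

text \<open>
  Integrate the derivative of \<open>cnj u * v\<close> over both intervals.
\<close>
lemma green_formula:
  assumes u: "momentum_max u a" and v: "momentum_max v b"
  shows "2 * of_real pi * \<i> * (L2_inner S u b - L2_inner S a v) =
    (cnj (u 1) * v 1 + cnj (u \<beta>) * v \<beta>) - (cnj (u 0) * v 0 + cnj (u \<alpha>) * v \<alpha>)"
proof -
  note L2s = momentum_max_L2[OF u] momentum_max_L2[OF v]
  note ub = L2_inner_split[OF L2s(1,4)] and av = L2_inner_split[OF L2s(2,3)]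
  have "2 * of_real pi * \<i> * (integral {l..r} (\<lambda>x. cnj (u x) * b x) - integral {l..r} (\<lambda>x. cnj (a x) * v x)) =
     cnj (u r) * v r - cnj (u l) * v l"
    if p: "L2_primitive l r u (\<lambda>x. 2 * of_real pi * \<i> * a x)" "L2_primitive l r v (\<lambda>x. 2 * of_real pi * \<i> * b x)"
     and int: "(\<lambda>x. cnj (u x) * b x) integrable_on {l..r}" "(\<lambda>x. cnj (a x) * v x) integrable_on {l..r}" and lr: "l \<le> r" for l r
  proof -
    have "L2_primitive l r (\<lambda>x. cnj (u x) * v x) (\<lambda>x. 2 * of_real pi * \<i> * (cnj (u x) * b x - cnj (a x) * v x))"
      by (rule L2_primitive_cong[OF L2_primitive_mult[OF L2_primitive_cnj[OF p(1)] p(2)] lr])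
        (auto simp: algebra_simps)
    from L2_primitive_eq[OF this, of r] lr int show ?thesis
      by (simp add: Henstock_Kurzweil_Integration.integral_diff)
  qed
  note * = this
  have "2 * of_real pi * \<i> * (integral {0..1} (\<lambda>x. cnj (u x) * b x) - integral {0..1} (\<lambda>x. cnj (a x) * v x)) =
     cnj (u 1) * v 1 - cnj (u 0) * v 0"
    by (rule *) (use u v ub av in \<open>auto simp: momentum_max_def\<close>)
  moreover have "2 * of_real pi * \<i> * (integral {\<alpha>..\<beta>} (\<lambda>x. cnj (u x) * b x) - integral {\<alpha>..\<beta>} (\<lambda>x. cnj (a x) * v x)) =
     cnj (u \<beta>) * v \<beta> - cnj (u \<alpha>) * v \<alpha>"
    by (rule *) (use u v ub av less in \<open>auto simp: momentum_max_def\<close>)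
  moreover have "c * ((i1 + i2) - (j1 + j2)) = c * (i1 - j1) + c * (i2 - j2)" for c i1 i2 j1 j2 :: complex
    by (simp add: algebra_simps)
  ultimately show ?thesis
    unfolding ub(1) av(1) by simp
qed

lemma B_isometry:
  "cnj (b11 * p + b12 * q) * (b11 * p' + b12 * q') + cnj (b21 * p + b22 * q) * (b21 * p' + b22 * q')
    = cnj p * p' + cnj q * q'"
proof -
  have orth': "cnj b12 * b11 + cnj b22 * b21 = 0"
    using arg_cong[OF orth, of cnj] by (simp add: mult.commute)
  have "cnj (b11 * p + b12 * q) * (b11 * p' + b12 * q') + cnj (b21 * p + b22 * q) * (b21 * p' + b22 * q')
     = (cnj b11 * b11 + cnj b21 * b21) * (cnj p * p') + (cnj b12 * b12 + cnj b22 * b22) * (cnj q * q')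
      + (cnj b11 * b12 + cnj b21 * b22) * (cnj p * q') + (cnj b12 * b11 + cnj b22 * b21) * (cnj q * p')"
    by (simp add: algebra_simps)
  then show ?thesis by (simp add: unit1 unit2 orth orth')
qed

text \<open>
  The boundary terms of the Green formula cancel because \<open>B\<close> is an isometry.
\<close>
lemma momentum_B_symmetric:
  assumes "momentum_B u a" "momentum_B v b"
  shows "L2_inner S u b = L2_inner S a v"
proof -
  have "cnj (u 0) * v 0 + cnj (u \<alpha>) * v \<alpha> = cnj (u 1) * v 1 + cnj (u \<beta>) * v \<beta>"
    using assms B_isometry[of "u 1" "u \<beta>" "v 1" "v \<beta>"] by (simp add: momentum_B_def boundary_condition_def)
  then show ?thesis
    using green_formula[of u a v b] assms by (simp add: momentum_B_def)
qed

lemma momentum_max_resolvent_iff: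
  assumes h: "h \<in> L2 S"
  shows "momentum_max u (\<lambda>x. z * u x + h x) \<longleftrightarrow>
    (\<forall>x\<in>{0..1}. u x = wave z x * (u 0 + wave_integral z 0 h x)) \<and>
    (\<forall>x\<in>{\<alpha>..\<beta>}. u x = wave z (x - \<alpha>) * (u \<alpha> + wave_integral z \<alpha> h x))" (is "?L \<longleftrightarrow> ?R")
proof -
  have h': "h \<in> L2 {0..1}" "h \<in> L2 {\<alpha>..\<beta>}"
    by (rule L2_subset[OF h S_sub(1) S_sets], simp, rule L2_subset[OF h S_sub(2) S_sets], simp)
  have iffs: "L2_primitive 0 1 u (\<lambda>x. 2 * of_real pi * \<i> * (z * u x + h x)) \<longleftrightarrow>
      (\<forall>x\<in>{0..1}. u x = wave z x * (u 0 + wave_integral z 0 h x))"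
    "L2_primitive \<alpha> \<beta> u (\<lambda>x. 2 * of_real pi * \<i> * (z * u x + h x)) \<longleftrightarrow>
      (\<forall>x\<in>{\<alpha>..\<beta>}. u x = wave z (x - \<alpha>) * (u \<alpha> + wave_integral z \<alpha> h x))"
    using L2_primitive_resolvent_iff[OF h'(1) zero_le_one, of u z]
      L2_primitive_resolvent_iff[OF h'(2) less_imp_le[OF less], of u z] by (simp_all only: diff_zero)
  show ?thesis
  proof
    assume ?L then show ?R unfolding momentum_max_def using iffs by blast
  next
    assume ?R
    then have p: "L2_primitive 0 1 u (\<lambda>x. 2 * of_real pi * \<i> * (z * u x + h x))"
      "L2_primitive \<alpha> \<beta> u (\<lambda>x. 2 * of_real pi * \<i> * (z * u x + h x))"
      using iffs by blast+
    then have "continuous_on S u"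
      unfolding S_def by (intro continuous_on_closed_Un) (auto intro: L2_primitive_continuous_on)
    then have "(\<lambda>x. z * u x + h x) \<in> L2 S" by (intro L2_add L2_scale continuous_on_S_L2 h)
    then show ?L using p by (simp add: momentum_max_def)
  qed
qed

text \<open>
  The norm of a solution is controlled by its starting values and the norm of the right-hand side.
\<close>
lemma resolvent_sup_bound:
  obtains K where "0 \<le> K" "\<And>u h. \<lbrakk>h \<in> L2 S; momentum_max u (\<lambda>x. z * u x + h x)\<rbrakk> \<Longrightarrow>
      L2_norm S u \<le> K * (cmod (u 0) + cmod (u \<alpha>) + L2_norm S h)"
proof -
  obtain K1 where K1: "0 \<le> K1" "\<And>h x. \<lbrakk>h \<in> L2 S; x \<in> {0..1}\<rbrakk> \<Longrightarrow> cmod (wave_integral z 0 h x) \<le> K1 * L2_norm S h"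
    using wave_integral_bound[OF S_lmeasurable S_sub(1)] by blast
  obtain K2 where K2: "0 \<le> K2" "\<And>h x. \<lbrakk>h \<in> L2 S; x \<in> {\<alpha>..\<beta>}\<rbrakk> \<Longrightarrow> cmod (wave_integral z \<alpha> h x) \<le> K2 * L2_norm S h"
    using wave_integral_bound[OF S_lmeasurable S_sub(2)] by blast
  have "continuous_on {0..1} (wave z)" "continuous_on {\<alpha>..\<beta>} (\<lambda>x. wave z (x - \<alpha>))"
    by (auto intro!: continuous_intros)
  then obtain K3 K4 where K3: "0 \<le> K3" "\<And>x. x \<in> {0..1} \<Longrightarrow> cmod (wave z x) \<le> K3"
    and K4: "0 \<le> K4" "\<And>x. x \<in> {\<alpha>..\<beta>} \<Longrightarrow> cmod (wave z (x - \<alpha>)) \<le> K4"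
    using continuous_on_interval_bounded by metis
  define L where "L = 1 + K1 + K2"
  show thesis
  proof (rule that[of "sqrt (measure lebesgue S) * ((K3 + K4) * L)"])
    show "0 \<le> sqrt (measure lebesgue S) * ((K3 + K4) * L)"
      using K1 K2 K3 K4 by (simp add: L_def)
    fix u h assume h: "h \<in> L2 S" and u: "momentum_max u (\<lambda>x. z * u x + h x)"
    define M where "M = cmod (u 0) + cmod (u \<alpha>) + L2_norm S h"
    have M: "0 \<le> M" by (simp add: M_def)
    have M_h: "L2_norm S h \<le> M" by (simp add: M_def)
    have aux: "cmod (w * (c + J)) \<le> ((K3 + K4) * L) * M"
      if "cmod w \<le> K3 + K4" "cmod J \<le> k * L2_norm S h" "k \<le> K1 + K2" "0 \<le> k" "cmod c + L2_norm S h \<le> M" for w c J k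
    proof -
      have "cmod (c + J) \<le> cmod c + k * L2_norm S h" using that norm_triangle_ineq[of c J] by linarith
      also have "k * L2_norm S h \<le> (K1 + K2) * L2_norm S h" using that by (intro mult_right_mono) auto
      also have "cmod c + (K1 + K2) * L2_norm S h \<le> M + (K1 + K2) * M"
        using that(5) K1(1) K2(1) M_h L2_norm_nonneg[of S h] by (intro add_mono mult_left_mono) linarith+
      finally have "cmod (c + J) \<le> L * M" by (simp add: L_def algebra_simps)
      then have "cmod w * cmod (c + J) \<le> (K3 + K4) * (L * M)"
        using that K3 K4 by (intro mult_mono) auto
      then show ?thesis by (simp add: norm_mult mult.assoc)
    qed
    have bound: "cmod (u x) \<le> ((K3 + K4) * L) * M" if "x \<in> S" for x
    proof (cases "x \<in> {0..1}")
      case True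
      then have "u x = wave z x * (u 0 + wave_integral z 0 h x)"
        using u momentum_max_resolvent_iff[OF h] by blast
      moreover have "cmod (wave z x * (u 0 + wave_integral z 0 h x)) \<le> ((K3 + K4) * L) * M"
        using K3(2)[OF True] K4(1) K1(1) K2(1) by (intro aux[of _ _ K1] K1(2) True h) (auto simp: M_def)
      ultimately show ?thesis by simp
    next
      case False
      then have x: "x \<in> {\<alpha>..\<beta>}" using that by (auto simp: S_def)
      then have "u x = wave z (x - \<alpha>) * (u \<alpha> + wave_integral z \<alpha> h x)"
        using u momentum_max_resolvent_iff[OF h] by blast
      moreover have "cmod (wave z (x - \<alpha>) * (u \<alpha> + wave_integral z \<alpha> h x)) \<le> ((K3 + K4) * L) * M"
        using K4(2)[OF x] K3(1) K1(1) K2(1) by (intro aux[of _ _ K2] K2(2) x h) (auto simp: M_def)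
      ultimately show ?thesis by simp
    qed
    have "L2_norm S u \<le> sqrt (measure lebesgue S) * (((K3 + K4) * L) * M)"
      using K1 K2 K3 K4 M by (intro L2_norm_bounded[OF S_lmeasurable momentum_max_L2(1)[OF u] bound]) (auto simp: L_def)
    then show "L2_norm S u \<le> sqrt (measure lebesgue S) * ((K3 + K4) * L) * (cmod (u 0) + cmod (u \<alpha>) + L2_norm S h)"
      by (simp add: M_def mult_ac)
  qed
qed

section \<open>Eigenfunctions and the resolvent\<close>

abbreviation d12 :: "complex \<Rightarrow> complex" where "d12 z \<equiv> b12 * wave z (\<beta> - \<alpha>)"

text \<open>
  The starting value on the second interval that the first row of the boundary condition assigns to
  the starting value 1 on the first interval, when \<open>h = 0\<close>.
\<close>
definition slope :: "complex \<Rightarrow> complex" where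
  "slope z = (1 - b11 * wave z 1) / d12 z"

text \<open>
  The determinant of \<open>B \<Lambda> - 1\<close>, where the diagonal matrix \<open>\<Lambda>\<close> maps the starting values of a solution of
  \<open>P u = z u\<close> to its final values.
\<close>
definition char_det :: "complex \<Rightarrow> complex" where
  "char_det z = (b11 * wave z 1 - 1) * (b22 * wave z (\<beta> - \<alpha>) - 1) - d12 z * (b21 * wave z 1)"

definition eigenfn :: "complex \<Rightarrow> real \<Rightarrow> complex" where
  "eigenfn z x = (if x \<le> 1 then wave z x else slope z * wave z (x - \<alpha>))"

lemma d12_nonzero: "d12 z \<noteq> 0" using b12_nonzero by simp

lemma slope_eq: "d12 z * slope z = 1 - b11 * wave z 1"
  using d12_nonzero[of z] by (simp add: slope_def)

lemma eigenfn_simps [simp]: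
  "eigenfn z 0 = 1" "eigenfn z 1 = wave z 1" "eigenfn z \<alpha> = slope z" "eigenfn z \<beta> = slope z * wave z (\<beta> - \<alpha>)"
  using one_less less by (auto simp: eigenfn_def)

text \<open>
  Otherwise orthogonality of the columns would give \<open>b11 = 0\<close>, and the first column would vanish.
\<close>
lemma b21_nonzero: "b21 \<noteq> 0"
proof
  assume "b21 = 0"
  with orth b12_nonzero have "b11 = 0" by simp
  with \<open>b21 = 0\<close> unit1 show False by simp
qed

lemma slope_nonzero:
  assumes "char_det z = 0" shows "slope z \<noteq> 0"
proof
  assume "slope z = 0"
  then have "b11 * wave z 1 = 1" using slope_eq[of z] by simp
  then show False using assms d12_nonzero[of z] b21_nonzero by (simp add: char_det_def)
qed

text \<open>
  The two components of \<open>B\<close> applied to the final values of the solution with starting values zero.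
\<close>
definition start_defect :: "complex \<Rightarrow> (real \<Rightarrow> complex) \<Rightarrow> complex" where
  "start_defect z h = b11 * (wave z 1 * wave_integral z 0 h 1) + b12 * (wave z (\<beta> - \<alpha>) * wave_integral z \<alpha> h \<beta>)"

definition end_defect :: "complex \<Rightarrow> (real \<Rightarrow> complex) \<Rightarrow> complex" where
  "end_defect z h = b21 * (wave z 1 * wave_integral z 0 h 1) + b22 * (wave z (\<beta> - \<alpha>) * wave_integral z \<alpha> h \<beta>)"

text \<open>
  The boundary condition as a linear system for the starting values. The first row is solved for
  \<open>u \<alpha>\<close>; eliminating \<open>u \<alpha>\<close> from the second row leaves \<open>char_det z\<close> as the coefficient of \<open>u 0\<close>.
\<close>
lemma boundary_condition_resolvent_iff:
  assumes "h \<in> L2 S" and u: "momentum_max u (\<lambda>x. z * u x + h x)"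
  shows "b11 * u 1 + b12 * u \<beta> = u 0 \<longleftrightarrow> u \<alpha> = slope z * u 0 - start_defect z h / d12 z"
    "boundary_condition u \<longleftrightarrow> u \<alpha> = slope z * u 0 - start_defect z h / d12 z \<and>
      char_det z * u 0 = d12 z * end_defect z h - (b22 * wave z (\<beta> - \<alpha>) - 1) * start_defect z h"
proof -
  define w1 w2 J1 J2 r1 r2 where "w1 = wave z 1" and "w2 = wave z (\<beta> - \<alpha>)"
    and "J1 = wave_integral z 0 h 1" and "J2 = wave_integral z \<alpha> h \<beta>"
    and "r1 = start_defect z h" and "r2 = end_defect z h"
  note defs = w1_def[symmetric] w2_def[symmetric] J1_def[symmetric] J2_def[symmetric]
    r1_def[symmetric] r2_def[symmetric]
  have R: "\<forall>x\<in>{0..1}. u x = wave z x * (u 0 + wave_integral z 0 h x)"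
    "\<forall>x\<in>{\<alpha>..\<beta>}. u x = wave z (x - \<alpha>) * (u \<alpha> + wave_integral z \<alpha> h x)"
    using u momentum_max_resolvent_iff[OF assms(1)] by blast+
  have u1: "u 1 = w1 * (u 0 + J1)"
    unfolding w1_def J1_def by (rule bspec[OF R(1)]) simp
  have u\<beta>: "u \<beta> = w2 * (u \<alpha> + J2)"
    unfolding w2_def J2_def by (rule bspec[OF R(2)]) (use less in simp)
  have r: "r1 = b11 * (w1 * J1) + b12 * (w2 * J2)" "r2 = b21 * (w1 * J1) + b22 * (w2 * J2)"
    by (simp_all add: r1_def r2_def start_defect_def end_defect_def w1_def w2_def J1_def J2_def)
  have d: "b12 * w2 \<noteq> 0" using d12_nonzero[of z] by (simp add: w2_def)
  have s: "b12 * w2 * slope z = 1 - b11 * w1" using slope_eq[of z] by (simp add: w1_def w2_def)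
  have "u \<alpha> = slope z * u 0 - r1 / (b12 * w2) \<longleftrightarrow> (b12 * w2) * u \<alpha> = (b12 * w2) * slope z * u 0 - r1"
    using d by (simp add: field_simps)
  also have "\<dots> \<longleftrightarrow> b11 * u 1 + b12 * u \<beta> = u 0"
    unfolding s u1 u\<beta> r by (auto simp: algebra_simps)
  finally have first: "b11 * u 1 + b12 * u \<beta> = u 0 \<longleftrightarrow> u \<alpha> = slope z * u 0 - r1 / (b12 * w2)" ..
  then show "b11 * u 1 + b12 * u \<beta> = u 0 \<longleftrightarrow> u \<alpha> = slope z * u 0 - start_defect z h / d12 z"
    by (simp add: defs)
  have "b21 * u 1 + b22 * u \<beta> = u \<alpha> \<longleftrightarrow> char_det z * u 0 = b12 * w2 * r2 - (b22 * w2 - 1) * r1"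
    if u\<alpha>: "b11 * u 1 + b12 * u \<beta> = u 0"
  proof -
    have "b12 * w2 * u \<alpha> = (1 - b11 * w1) * u 0 - r1"
      using u\<alpha> unfolding u1 u\<beta> r by (simp add: algebra_simps)
    then have e: "(b22 * w2 - 1) * (b12 * w2 * u \<alpha>) = (b22 * w2 - 1) * ((1 - b11 * w1) * u 0 - r1)" by simp
    have "b12 * w2 * (b21 * u 1 + b22 * u \<beta> - u \<alpha>)
        = b12 * w2 * b21 * w1 * u 0 + (b22 * w2 - 1) * (b12 * w2 * u \<alpha>) + b12 * w2 * r2"
      unfolding u1 u\<beta> r by (simp add: algebra_simps)
    also have "\<dots> = (b12 * w2 * r2 - (b22 * w2 - 1) * r1) - char_det z * u 0"
      unfolding e by (simp add: char_det_def defs algebra_simps)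
    finally have "b12 * w2 * (b21 * u 1 + b22 * u \<beta> - u \<alpha>)
      = (b12 * w2 * r2 - (b22 * w2 - 1) * r1) - char_det z * u 0" .
    moreover have "b21 * u 1 + b22 * u \<beta> = u \<alpha> \<longleftrightarrow> b12 * w2 * (b21 * u 1 + b22 * u \<beta> - u \<alpha>) = 0"
      using d by simp
    ultimately show ?thesis by auto
  qed
  with first show "boundary_condition u \<longleftrightarrow> u \<alpha> = slope z * u 0 - start_defect z h / d12 z \<and>
      char_det z * u 0 = d12 z * end_defect z h - (b22 * wave z (\<beta> - \<alpha>) - 1) * start_defect z h"
    unfolding boundary_condition_def defs by blast
qed

lemma defect_zero [simp]: "start_defect z (\<lambda>x. 0) = 0" "end_defect z (\<lambda>x. 0) = 0"
  by (simp_all add: start_defect_def end_defect_def)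

text \<open>
  For every \<open>z\<close> the function \<open>eigenfn z\<close> solves \<open>P u = z u\<close> and satisfies the first row of the boundary
  condition; the second row holds if and only if the determinant vanishes.
\<close>
lemma momentum_max_eigenfn: "momentum_max (eigenfn z) (\<lambda>x. z * eigenfn z x)"
proof -
  have "momentum_max (eigenfn z) (\<lambda>x. z * eigenfn z x + 0)"
    using one_less by (subst momentum_max_resolvent_iff) (auto simp: eigenfn_def)
  then show ?thesis by simp
qed

lemma eigenfn_L2 [simp]: "eigenfn z \<in> L2 S"
  using momentum_max_L2(1)[OF momentum_max_eigenfn] .

lemma momentum_B_eigenfn:
  assumes "char_det z = 0" shows "momentum_B (eigenfn z) (\<lambda>x. z * eigenfn z x)"
  using boundary_condition_resolvent_iff(2)[of "\<lambda>x. 0" "eigenfn z" z] momentum_max_eigenfn[of z] assms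
  by (simp add: momentum_B_def)

lemma momentum_B_kernel:
  assumes u: "momentum_B u (\<lambda>x. z * u x)"
  shows "x \<in> S \<Longrightarrow> u x = u 0 * eigenfn z x" "char_det z * u 0 = 0"
proof -
  have u': "momentum_max u (\<lambda>x. z * u x + 0)" using u by (simp add: momentum_B_def)
  have "u \<alpha> = slope z * u 0" "char_det z * u 0 = 0"
    using boundary_condition_resolvent_iff(2)[OF L2_zero u'] u by (auto simp: momentum_B_def)
  then show "char_det z * u 0 = 0" by simp
  have R: "\<forall>x\<in>{0..1}. u x = wave z x * u 0" "\<forall>x\<in>{\<alpha>..\<beta>}. u x = wave z (x - \<alpha>) * u \<alpha>"
    using iffD1[OF momentum_max_resolvent_iff[OF L2_zero] u', unfolded wave_integral_zero add_0_right]
    by blast+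
  show "u x = u 0 * eigenfn z x" if "x \<in> S"
  proof (cases "x \<in> {0..1}")
    case True
    then show ?thesis using bspec[OF R(1) True] by (simp add: eigenfn_def)
  next
    case False
    then have "x \<in> {\<alpha>..\<beta>}" using that by (auto simp: S_def)
    from bspec[OF R(2) this] show ?thesis
      using one_less \<open>x \<in> {\<alpha>..\<beta>}\<close> \<open>u \<alpha> = slope z * u 0\<close> by (simp add: eigenfn_def)
  qed
qed

lemma eigenfn_norm_pos: "0 < L2_norm S (eigenfn z)"
proof -
  have "\<not> ae_eq S (eigenfn z) (\<lambda>x. 0)"
  proof
    assume "ae_eq S (eigenfn z) (\<lambda>x. 0)"
    then have "negligible {x\<in>S. eigenfn z x \<noteq> 0}"
      using S_sets by (simp add: ae_eq_def AE_lebesgue_on_iff_negligible)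
    moreover have "{0..1} \<subseteq> {x\<in>S. eigenfn z x \<noteq> 0}" by (auto simp: S_def eigenfn_def)
    ultimately have "negligible {0..1::real}" by (rule negligible_subset)
    then show False using negligible_interval(1)[of 0 "1::real"] by simp
  qed
  then have "L2_norm S (eigenfn z) \<noteq> 0" by (simp add: L2_norm_eq_0_iff)
  then show ?thesis using L2_norm_nonneg[of S "eigenfn z"] by linarith
qed

text \<open>
  By symmetry the inner product of \<open>u\<close> with \<open>z u + h\<close> is real, so its imaginary part
  \<open>Im z \<parallel>u\<parallel>\<^sup>2 + Im \<langle>u, h\<rangle>\<close> vanishes.
\<close>
lemma resolvent_nonreal_bound:
  assumes u: "momentum_B u (\<lambda>x. z * u x + h x)" and h: "h \<in> L2 S"
  shows "\<bar>Im z\<bar> * L2_norm S u \<le> L2_norm S h"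
proof (cases "L2_norm S u = 0")
  case False
  then have pos: "L2_norm S u > 0" using L2_norm_nonneg[of S u] by linarith
  note u2 = momentum_B_L2(1)[OF u]
  have zu: "(\<lambda>x. z * u x) \<in> L2 S" using u2 by (rule L2_scale)
  have 1: "L2_inner S u (\<lambda>x. z * u x + h x) = z * of_real ((L2_norm S u)\<^sup>2) + L2_inner S u h"
    by (simp add: L2_inner_add_right[OF u2 zu h] L2_inner_scale_right L2_inner_self)
  have "L2_inner S u (\<lambda>x. z * u x + h x) = cnj (L2_inner S u (\<lambda>x. z * u x + h x))"
    using momentum_B_symmetric[OF u u] L2_inner_commute by metis
  then have "Im (z * of_real ((L2_norm S u)\<^sup>2) + L2_inner S u h) = 0"
    unfolding 1 by (metis Reals_cnj_iff complex_is_Real_iff)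
  then have "\<bar>Im z * (L2_norm S u)\<^sup>2\<bar> = \<bar>Im (L2_inner S u h)\<bar>"
    by (simp del: of_real_power)
  also have "\<dots> \<le> L2_norm S u * L2_norm S h"
    using abs_Im_le_cmod L2_Cauchy_Schwarz[OF u2 h] order_trans by blast
  finally have "L2_norm S u * (\<bar>Im z\<bar> * L2_norm S u) \<le> L2_norm S u * L2_norm S h"
    by (simp add: abs_mult power2_eq_square mult_ac)
  then show ?thesis using pos by simp
qed simp

text \<open>
  The preceding bound with \<open>h = 0\<close>, applied to the eigenfunction.
\<close>
lemma char_det_zero_real:
  assumes "char_det z = 0" shows "Im z = 0"
proof -
  have "\<bar>Im z\<bar> * L2_norm S (eigenfn z) \<le> L2_norm S (\<lambda>x. 0 :: complex)"
    using momentum_B_eigenfn[OF assms] by (intro resolvent_nonreal_bound) auto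
  also have "L2_norm S (\<lambda>x. 0 :: complex) = 0" by (simp add: L2_norm_def)
  finally show ?thesis using eigenfn_norm_pos[of z] by (simp add: mult_le_0_iff)
qed

lemma inner_eigenfn:
  assumes "char_det z = 0" "momentum_B u (\<lambda>x. y * u x + h x)" "h \<in> L2 S"
  shows "L2_inner S (eigenfn z) h = (z - y) * L2_inner S (eigenfn z) u"
proof -
  have zr: "cnj z = z" using char_det_zero_real[OF assms(1)] by (simp add: complex_eq_iff)
  note u2 = momentum_B_L2(1)[OF assms(2)]
  have "L2_inner S (eigenfn z) (\<lambda>x. y * u x + h x) = L2_inner S (\<lambda>x. z * eigenfn z x) u"
    by (rule momentum_B_symmetric[OF momentum_B_eigenfn[OF assms(1)] assms(2)])
  then show ?thesis
    using u2 assms(3) zr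
    by (simp add: L2_inner_add_right L2_scale L2_inner_scale_right L2_inner_scale_left algebra_simps)
qed

lemma eigenfn_orthogonal:
  assumes "char_det z = 0" "char_det y = 0" "z \<noteq> y"
  shows "L2_inner S (eigenfn z) (eigenfn y) = 0"
  using inner_eigenfn[OF assms(1), of "eigenfn y" y "\<lambda>x. 0"] momentum_B_eigenfn[OF assms(2)] assms(3)
  by (simp add: L2_inner_def)

lemma momentum_max_solution_exists:
  assumes h: "h \<in> L2 S"
  obtains u where "momentum_max u (\<lambda>x. z * u x + h x)" "u 0 = c" "u \<alpha> = e"
proof -
  define u where "u x = (if x \<le> 1 then wave z x * (c + wave_integral z 0 h x)
    else wave z (x - \<alpha>) * (e + wave_integral z \<alpha> h x))" for x
  have "wave_integral z 0 h 0 = 0" "wave_integral z \<alpha> h \<alpha> = 0" by (simp_all add: wave_integral_def)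
  then have "u 0 = c" "u \<alpha> = e" using one_less by (auto simp: u_def)
  moreover from this have "momentum_max u (\<lambda>x. z * u x + h x)"
    using one_less by (subst momentum_max_resolvent_iff[OF h]) (auto simp: u_def)
  ultimately show thesis using that by blast
qed

text \<open>
  Where the determinant is zero, the solution that starts with \<open>u 0 = 0\<close> can be made to satisfy the
  first row of the boundary condition. The Green formula against the eigenfunction shows that the
  second row then follows from the orthogonality of \<open>h\<close> to the eigenfunction, because the
  eigenfunction does not vanish at \<open>\<alpha>\<close>.
\<close>
lemma resolvent_solvable:
  assumes h: "h \<in> L2 S" and perp: "char_det z = 0 \<Longrightarrow> L2_inner S (eigenfn z) h = 0"
  obtains u where "momentum_B u (\<lambda>x. z * u x + h x)"
proof (cases "char_det z = 0")
  case False
  define c where "c = (d12 z * end_defect z h - (b22 * wave z (\<beta> - \<alpha>) - 1) * start_defect z h) / char_det z"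
  obtain u where u: "momentum_max u (\<lambda>x. z * u x + h x)" "u 0 = c" "u \<alpha> = slope z * c - start_defect z h / d12 z"
    using momentum_max_solution_exists[OF h] .
  then have "boundary_condition u"
    using False by (subst boundary_condition_resolvent_iff(2)[OF h u(1)]) (simp add: c_def)
  then show thesis using that u by (simp add: momentum_B_def)
next
  case True
  note v = momentum_B_eigenfn[OF True]
  have zr: "cnj z = z" using char_det_zero_real[OF True] by (simp add: complex_eq_iff)
  obtain u where u: "momentum_max u (\<lambda>x. z * u x + h x)" "u 0 = 0" "u \<alpha> = slope z * 0 - start_defect z h / d12 z"
    using momentum_max_solution_exists[OF h] .
  then have first: "b11 * u 1 + b12 * u \<beta> = u 0"
    by (subst boundary_condition_resolvent_iff(1)[OF h u(1)]) simp
  have "L2_inner S (eigenfn z) (\<lambda>x. z * u x + h x) = L2_inner S (\<lambda>x. z * eigenfn z x) u"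
    using momentum_max_L2(1)[OF u(1)] h zr perp[OF True]
    by (simp add: L2_inner_add_right L2_scale L2_inner_scale_right L2_inner_scale_left)
  then have "cnj (eigenfn z 1) * u 1 + cnj (eigenfn z \<beta>) * u \<beta> = cnj (eigenfn z 0) * u 0 + cnj (eigenfn z \<alpha>) * u \<alpha>"
    using green_formula[OF momentum_max_eigenfn[of z] u(1)] by simp
  moreover have "cnj (eigenfn z 0) * (b11 * u 1 + b12 * u \<beta>) + cnj (eigenfn z \<alpha>) * (b21 * u 1 + b22 * u \<beta>)
     = cnj (eigenfn z 1) * u 1 + cnj (eigenfn z \<beta>) * u \<beta>"
    using B_isometry[of "eigenfn z 1" "eigenfn z \<beta>" "u 1" "u \<beta>"] v
    unfolding momentum_B_def boundary_condition_def by (elim conjE) (simp only:)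
  ultimately have "cnj (eigenfn z \<alpha>) * (b21 * u 1 + b22 * u \<beta>) = cnj (eigenfn z \<alpha>) * u \<alpha>"
    unfolding first by simp
  then have "b21 * u 1 + b22 * u \<beta> = u \<alpha>"
    using slope_nonzero[OF True] by simp
  then have "momentum_B u (\<lambda>x. z * u x + h x)"
    unfolding momentum_B_def boundary_condition_def using u(1) first by blast
  then show thesis by (rule that)
qed

lemma defect_bound:
  obtains K where "0 \<le> K" "\<And>h. h \<in> L2 S \<Longrightarrow> cmod (start_defect z h) \<le> K * L2_norm S h"
    "\<And>h. h \<in> L2 S \<Longrightarrow> cmod (end_defect z h) \<le> K * L2_norm S h"
proof -
  obtain K1 where K1: "0 \<le> K1" "\<And>h x. \<lbrakk>h \<in> L2 S; x \<in> {0..1}\<rbrakk> \<Longrightarrow> cmod (wave_integral z 0 h x) \<le> K1 * L2_norm S h"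
    using wave_integral_bound[OF S_lmeasurable S_sub(1)] by blast
  obtain K2 where K2: "0 \<le> K2" "\<And>h x. \<lbrakk>h \<in> L2 S; x \<in> {\<alpha>..\<beta>}\<rbrakk> \<Longrightarrow> cmod (wave_integral z \<alpha> h x) \<le> K2 * L2_norm S h"
    using wave_integral_bound[OF S_lmeasurable S_sub(2)] by blast
  have aux: "cmod (p * (w * wave_integral z 0 h 1) + q * (v * wave_integral z \<alpha> h \<beta>))
      \<le> (cmod p * cmod w * K1 + cmod q * cmod v * K2) * L2_norm S h" if "h \<in> L2 S" for p q v w h
  proof -
    have "cmod (p * (w * wave_integral z 0 h 1)) \<le> cmod p * cmod w * (K1 * L2_norm S h)"
      using K1(2)[OF that, of 1] by (simp add: norm_mult mult.assoc mult_left_mono)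
    moreover have "cmod (q * (v * wave_integral z \<alpha> h \<beta>)) \<le> cmod q * cmod v * (K2 * L2_norm S h)"
      using K2(2)[OF that, of \<beta>] less by (simp add: norm_mult mult.assoc mult_left_mono)
    ultimately show ?thesis by (intro order_trans[OF norm_triangle_ineq]) (simp add: algebra_simps)
  qed
  define k where "k p q = cmod p * cmod (wave z 1) * K1 + cmod q * cmod (wave z (\<beta> - \<alpha>)) * K2" for p q
  have k: "0 \<le> k p q" for p q using K1 K2 by (simp add: k_def)
  show thesis
  proof (rule that[of "k b11 b12 + k b21 b22"])
    fix h assume h: "h \<in> L2 S"
    show "cmod (start_defect z h) \<le> (k b11 b12 + k b21 b22) * L2_norm S h"
      using aux[OF h, of b11 "wave z 1" b12 "wave z (\<beta> - \<alpha>)"] k[of b21 b22]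
      by (auto simp: start_defect_def k_def[symmetric] distrib_right intro: add_increasing2)
    show "cmod (end_defect z h) \<le> (k b11 b12 + k b21 b22) * L2_norm S h"
      using aux[OF h, of b21 "wave z 1" b22 "wave z (\<beta> - \<alpha>)"] k[of b11 b12]
      by (auto simp: end_defect_def k_def[symmetric] distrib_right intro: add_increasing)
  qed (use k in \<open>auto intro: add_nonneg_nonneg\<close>)
qed

text \<open>
  Where the determinant is nonzero, the linear system bounds the starting values by the norm of \<open>h\<close>.
  Where it is zero, subtracting \<open>u 0\<close> times the eigenfunction makes the first starting value zero,
  and does not decrease the norm when \<open>u\<close> is orthogonal to the eigenfunction.
\<close>
lemma resolvent_bound:
  obtains K where "0 < K" "\<And>u h. \<lbrakk>h \<in> L2 S; momentum_B u (\<lambda>x. z * u x + h x);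
     char_det z = 0 \<Longrightarrow> L2_inner S (eigenfn z) u = 0\<rbrakk> \<Longrightarrow> L2_norm S u \<le> K * L2_norm S h"
proof -
  obtain K0 where K0: "0 \<le> K0" "\<And>u h. \<lbrakk>h \<in> L2 S; momentum_max u (\<lambda>x. z * u x + h x)\<rbrakk> \<Longrightarrow>
      L2_norm S u \<le> K0 * (cmod (u 0) + cmod (u \<alpha>) + L2_norm S h)"
    using resolvent_sup_bound[of z] by blast
  obtain K1 where K1: "0 \<le> K1" "\<And>h. h \<in> L2 S \<Longrightarrow> cmod (start_defect z h) \<le> K1 * L2_norm S h"
    "\<And>h. h \<in> L2 S \<Longrightarrow> cmod (end_defect z h) \<le> K1 * L2_norm S h"
    using defect_bound[of z] by blast
  define c where "c = (if char_det z = 0 then 0 else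
     (cmod (d12 z) * K1 + cmod (b22 * wave z (\<beta> - \<alpha>) - 1) * K1) / cmod (char_det z))"
  define e where "e = cmod (slope z) * c + K1 / cmod (d12 z)"
  have ce: "0 \<le> c" "0 \<le> e" using K1 by (auto simp: c_def e_def)
  have main: "L2_norm S u \<le> K0 * (c + e + 1) * L2_norm S h"
    if h: "h \<in> L2 S" and u: "momentum_B u (\<lambda>x. z * u x + h x)" and u0: "cmod (u 0) \<le> c * L2_norm S h" for u h
  proof -
    have um: "momentum_max u (\<lambda>x. z * u x + h x)" using u by (simp add: momentum_B_def)
    have "u \<alpha> = slope z * u 0 - start_defect z h / d12 z"
      using boundary_condition_resolvent_iff(2)[OF h um] u by (simp add: momentum_B_def)
    then have "cmod (u \<alpha>) \<le> cmod (slope z) * cmod (u 0) + cmod (start_defect z h) / cmod (d12 z)"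
      by (metis norm_divide norm_mult norm_triangle_ineq4)
    also have "\<dots> \<le> cmod (slope z) * (c * L2_norm S h) + K1 * L2_norm S h / cmod (d12 z)"
      by (intro add_mono mult_left_mono divide_right_mono u0 K1 h) auto
    also have "\<dots> = e * L2_norm S h" by (simp add: e_def algebra_simps)
    finally have "cmod (u 0) + cmod (u \<alpha>) + L2_norm S h \<le> (c + e + 1) * L2_norm S h"
      using u0 by (simp add: algebra_simps)
    then have "K0 * (cmod (u 0) + cmod (u \<alpha>) + L2_norm S h) \<le> K0 * ((c + e + 1) * L2_norm S h)"
      using K0(1) by (rule mult_left_mono)
    then show ?thesis using K0(2)[OF h um] by (simp add: mult.assoc)
  qed
  show thesis
  proof (rule that[of "K0 * (c + e + 1) + 1"])
    show "0 < K0 * (c + e + 1) + 1" using K0 ce by (simp add: add_nonneg_pos)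
    fix u h assume h: "h \<in> L2 S" and u: "momentum_B u (\<lambda>x. z * u x + h x)"
      and perp: "char_det z = 0 \<Longrightarrow> L2_inner S (eigenfn z) u = 0"
    note u2 = momentum_B_L2(1)[OF u]
    have um: "momentum_max u (\<lambda>x. z * u x + h x)" using u by (simp add: momentum_B_def)
    have "L2_norm S u \<le> K0 * (c + e + 1) * L2_norm S h"
    proof (cases "char_det z = 0")
      case False
      have "char_det z * u 0 = d12 z * end_defect z h - (b22 * wave z (\<beta> - \<alpha>) - 1) * start_defect z h"
        using boundary_condition_resolvent_iff(2)[OF h um] u by (simp add: momentum_B_def)
      then have "cmod (char_det z) * cmod (u 0) \<le> cmod (d12 z) * cmod (end_defect z h)
          + cmod (b22 * wave z (\<beta> - \<alpha>) - 1) * cmod (start_defect z h)"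
        by (metis norm_mult norm_triangle_ineq4)
      also have "\<dots> \<le> cmod (d12 z) * (K1 * L2_norm S h) + cmod (b22 * wave z (\<beta> - \<alpha>) - 1) * (K1 * L2_norm S h)"
        by (intro add_mono mult_left_mono K1 h) auto
      finally have "cmod (u 0) \<le> c * L2_norm S h"
        using False by (simp add: c_def field_simps)
      then show ?thesis using main[OF h u] by blast
    next
      case True
      define v where "v x = u x + (- u 0) * eigenfn z x" for x
      have v: "momentum_B v (\<lambda>x. z * v x + h x)"
      proof -
        have "(\<lambda>x. z * u x + h x + - u 0 * (z * eigenfn z x)) = (\<lambda>x. z * v x + h x)"
          by (simp add: v_def fun_eq_iff algebra_simps)
        then show ?thesis
          using momentum_B_lin[OF u momentum_B_eigenfn[OF True], of "- u 0"] by (simp add: v_def[abs_def])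
      qed
      have "cmod (v 0) \<le> c * L2_norm S h" using ce by (simp add: v_def)
      then have "L2_norm S v \<le> K0 * (c + e + 1) * L2_norm S h" using main[OF h v] by blast
      moreover have "(L2_norm S u)\<^sup>2 \<le> (L2_norm S v)\<^sup>2"
      proof -
        have "L2_inner S u (eigenfn z) = 0" using perp[OF True] L2_inner_commute[of S u "eigenfn z"] by simp
        then show ?thesis
          using L2_norm_diff_sq[OF u2 L2_scale[OF eigenfn_L2[of z], of "u 0"]]
          by (simp add: v_def[abs_def] L2_inner_scale_right)
      qed
      then have "L2_norm S u \<le> L2_norm S v" by (rule power2_le_imp_le) simp
      ultimately show ?thesis by linarith
    qed
    then show "L2_norm S u \<le> (K0 * (c + e + 1) + 1) * L2_norm S h"
      using L2_norm_nonneg[of S h] unfolding distrib_right by linarith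
  qed
qed

end

section \<open>Completeness of the eigenfunctions\<close>

text \<open>
  The factor \<open>w\<^sup>2 - R\<^sup>2\<close> has modulus \<open>2 R \<bar>Im w\<bar>\<close> on the circle of radius \<open>R\<close>, so it cancels the
  singularities of the bound at the two real points of the circle. The maximum principle then gives
  a bound of order \<open>1 / R\<close> for \<open>g z\<close>.
\<close>
lemma entire_eq_0_if_bounded_by_inverse_Im:
  fixes g :: "complex \<Rightarrow> complex"
  assumes g: "g holomorphic_on UNIV" and C: "\<And>w. \<bar>Im w\<bar> * cmod (g w) \<le> C"
  shows "g z = 0"
proof -
  have "0 \<le> C" using C[of 0] by simp
  have bound: "cmod (g z) \<le> 8 * C / (3 * R)" if R: "R > 0" "2 * cmod z \<le> R" for R
  proof -
    have "cmod ((z\<^sup>2 - of_real (R\<^sup>2)) * g z) \<le> 2 * R * C"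
    proof (rule maximum_modulus_frontier[where S="cball 0 R" and f="\<lambda>w. (w\<^sup>2 - of_real (R\<^sup>2)) * g w"])
      show "(\<lambda>w. (w\<^sup>2 - of_real (R\<^sup>2)) * g w) holomorphic_on interior (cball 0 R)"
        using g by (intro holomorphic_intros) (auto intro: holomorphic_on_subset)
      show "continuous_on (closure (cball 0 R)) (\<lambda>w. (w\<^sup>2 - of_real (R\<^sup>2)) * g w)"
        using g by (intro holomorphic_on_imp_continuous_on holomorphic_intros) (auto intro: holomorphic_on_subset)
      fix w :: complex assume "w \<in> frontier (cball 0 R)"
      then have w: "cmod w = R" using R by auto
      \<comment> \<open>On the circle, \<open>w\<^sup>2 - R\<^sup>2 = w (w - cnj w) = 2 \<i> w Im w\<close>.\<close>
      have "of_real (R\<^sup>2) = w * cnj w" by (simp add: w[symmetric] complex_norm_square del: of_real_power)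
      then have "w\<^sup>2 - of_real (R\<^sup>2) = w * (w - cnj w)" by (simp add: power2_eq_square algebra_simps)
      also have "w - cnj w = 2 * \<i> * of_real (Im w)" by (simp add: complex_eq_iff)
      finally have "cmod ((w\<^sup>2 - of_real (R\<^sup>2)) * g w) = 2 * R * (\<bar>Im w\<bar> * cmod (g w))"
        by (simp add: norm_mult w)
      also have "\<dots> \<le> 2 * R * C" using R by (intro mult_left_mono C) auto
      finally show "cmod ((w\<^sup>2 - of_real (R\<^sup>2)) * g w) \<le> 2 * R * C" .
    qed (use R in auto)
    moreover have "3 / 4 * R\<^sup>2 \<le> cmod (z\<^sup>2 - of_real (R\<^sup>2))"
    proof -
      have "cmod z ^ 2 \<le> (R / 2) ^ 2" using R by (intro power_mono) auto
      moreover have "R\<^sup>2 - cmod z ^ 2 \<le> cmod (z\<^sup>2 - of_real (R\<^sup>2))"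
        using norm_triangle_ineq2[of "complex_of_real (R\<^sup>2)" "z\<^sup>2"]
        by (simp add: norm_power norm_minus_commute)
      ultimately show ?thesis by (simp add: power_divide)
    qed
    from mult_right_mono[OF this norm_ge_zero[of "g z"]]
    have "3 / 4 * R\<^sup>2 * cmod (g z) \<le> cmod ((z\<^sup>2 - of_real (R\<^sup>2)) * g z)"
      unfolding norm_mult .
    ultimately have "R * (3 * R * cmod (g z)) \<le> R * (8 * C)"
      by (simp add: power2_eq_square)
    then have "3 * R * cmod (g z) \<le> 8 * C" using R by simp
    then show ?thesis using R by (simp add: field_simps)
  qed
  have "cmod (g z) \<le> 0"
  proof (rule field_le_epsilon)
    fix e :: real assume "e > 0"
    define R where "R = max (2 * cmod z + 1) (8 * C / (3 * e) + 1)"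
    have R: "R > 0" "2 * cmod z \<le> R" "8 * C / (3 * e) \<le> R"
      by (auto simp: R_def le_max_iff_disj less_max_iff_disj add_nonneg_pos)
    have "8 * C / (3 * R) \<le> e" using R \<open>e > 0\<close> by (simp add: field_simps)
    then show "cmod (g z) \<le> 0 + e" using bound[OF R(1,2)] by simp
  qed
  then show ?thesis by simp
qed

lemma has_field_derivative_quadratic_remainder:
  fixes g :: "complex \<Rightarrow> complex"
  assumes "r > 0" "\<And>w. cmod (w - z) < r \<Longrightarrow> cmod (g w - g z - (w - z) * D) \<le> C * (cmod (w - z))\<^sup>2"
  shows "(g has_field_derivative D) (at z)"
  unfolding has_field_derivative_def has_derivative_at_alt
proof (intro conjI allI impI)
  show "bounded_linear ((*) D)" by (rule bounded_linear_mult_right)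
  fix e :: real assume "e > 0"
  define d where "d = min r (e / (\<bar>C\<bar> + 1))"
  have "d > 0" using assms(1) \<open>e > 0\<close> by (simp add: d_def add_nonneg_pos)
  have "cmod (g w - g z - D * (w - z)) \<le> e * cmod (w - z)" if "cmod (w - z) < d" for w
  proof -
    have "cmod (w - z) \<le> e / (\<bar>C\<bar> + 1)" using that by (simp add: d_def)
    then have "(\<bar>C\<bar> + 1) * cmod (w - z) \<le> e" by (simp add: field_simps add_nonneg_pos)
    moreover have "C * cmod (w - z) \<le> (\<bar>C\<bar> + 1) * cmod (w - z)" by (intro mult_right_mono) auto
    ultimately have "(C * cmod (w - z)) * cmod (w - z) \<le> e * cmod (w - z)"
      by (intro mult_right_mono) auto
    moreover have "cmod (g w - g z - (w - z) * D) \<le> C * (cmod (w - z))\<^sup>2"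
      using that by (intro assms(2)) (simp add: d_def)
    ultimately show ?thesis by (simp add: power2_eq_square mult.commute mult.left_commute)
  qed
  then show "\<exists>d>0. \<forall>w. cmod (w - z) < d \<longrightarrow> cmod (g w - g z - D * (w - z)) \<le> e * cmod (w - z)"
    using \<open>d > 0\<close> by blast
qed

text \<open>
  A continuous function that vanishes almost everywhere vanishes, so its derivative does, too.
\<close>
lemma L2_primitive_of_AE_zero:
  assumes prim: "L2_primitive l r u g" and zero: "negligible {x\<in>{l..r}. u x \<noteq> 0}"
  shows "negligible {x\<in>{l..r}. g x \<noteq> 0}"
proof -
  have "continuous_on {l<..<r} u"
    using L2_primitive_continuous_on[OF prim] by (rule continuous_on_subset) auto
  then have "open ({l<..<r} \<inter> u -` (- {0}))"
    by (rule continuous_open_preimage) auto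
  moreover have "negligible ({l<..<r} \<inter> u -` (- {0}))"
    by (rule negligible_subset[OF zero]) auto
  ultimately have "{l<..<r} \<inter> u -` (- {0}) = {}"
    using open_not_negligible by blast
  then have u0: "u x = 0" if "x \<in> {l<..<r}" for x using that by blast
  let ?N = "{x\<in>{l..r}. \<not> (u has_vector_derivative g x) (at x)}"
  have "g x = 0" if x: "x \<in> {l<..<r}" "(u has_vector_derivative g x) (at x)" for x
  proof -
    have "((\<lambda>_. 0) has_vector_derivative g x) (at x)"
      by (rule has_vector_derivative_transform_within_open[OF x(2), of "{l<..<r}"]) (use x u0 in auto)
    then show ?thesis
      using vector_derivative_unique_at[of "\<lambda>_. 0" "g x" x 0] by simp
  qed
  then have "{x\<in>{l..r}. g x \<noteq> 0} \<subseteq> ?N \<union> {l, r}" by force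
  moreover have "negligible (?N \<union> {l, r})"
    using L2_primitive_derivative[OF prim] by (intro negligible_Un) auto
  ultimately show ?thesis by (rule negligible_subset[rotated])
qed

context two_interval_momentum begin

definition eigen_perp :: "(real \<Rightarrow> complex) set" where
  "eigen_perp = {h \<in> L2 S. \<forall>z. char_det z = 0 \<longrightarrow> L2_inner S (eigenfn z) h = 0}"

lemma eigen_perp_L2: "h \<in> eigen_perp \<Longrightarrow> h \<in> L2 S"
  by (simp add: eigen_perp_def)

lemma eigen_perp_lin:
  "\<lbrakk>g \<in> eigen_perp; h \<in> eigen_perp\<rbrakk> \<Longrightarrow> (\<lambda>x. g x + c * h x) \<in> eigen_perp"
  by (auto simp: eigen_perp_def L2_add L2_scale L2_inner_add_right L2_inner_scale_right)

text \<open>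
  If \<open>z\<close> is an eigenvalue, the component of the solution along the eigenfunction is removed. The
  orthogonality to the other eigenfunctions is automatic by symmetry.
\<close>
lemma eigen_perp_resolvent:
  assumes h: "h \<in> eigen_perp"
  shows "\<exists>u. u \<in> eigen_perp \<and> momentum_B u (\<lambda>x. z * u x + h x)"
proof -
  have h2: "h \<in> L2 S" using h by (rule eigen_perp_L2)
  obtain u where u: "momentum_B u (\<lambda>x. z * u x + h x)"
    using resolvent_solvable[OF h2, of z] h by (auto simp: eigen_perp_def)
  note u2 = momentum_B_L2(1)[OF u]
  have other: "L2_inner S (eigenfn y) u = 0" if "char_det y = 0" "y \<noteq> z" for y
    using inner_eigenfn[OF that(1) u h2] h that by (simp add: eigen_perp_def)
  show ?thesis
  proof (cases "char_det z = 0")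
    case False
    then have "u \<in> eigen_perp" using other u2 by (auto simp: eigen_perp_def)
    then show ?thesis using u by blast
  next
    case True
    \<comment> \<open>Adding \<open>c\<close> times the eigenfunction removes the component of \<open>u\<close> along it.\<close>
    define c where "c = - L2_inner S (eigenfn z) u / L2_inner S (eigenfn z) (eigenfn z)"
    define v where "v x = u x + c * eigenfn z x" for x
    have "(\<lambda>x. z * u x + h x + c * (z * eigenfn z x)) = (\<lambda>x. z * v x + h x)"
      by (simp add: v_def fun_eq_iff algebra_simps)
    then have v: "momentum_B v (\<lambda>x. z * v x + h x)"
      using momentum_B_lin[OF u momentum_B_eigenfn[OF True], of c] by (simp add: v_def[abs_def])
    have inner: "L2_inner S (eigenfn y) v = L2_inner S (eigenfn y) u + c * L2_inner S (eigenfn y) (eigenfn z)" for y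
      unfolding v_def[abs_def] using u2 by (simp add: L2_inner_add_right L2_scale L2_inner_scale_right)
    have "L2_inner S (eigenfn y) v = 0" if "char_det y = 0" for y
    proof (cases "y = z")
      case True
      have "L2_inner S (eigenfn z) (eigenfn z) \<noteq> 0"
        using eigenfn_norm_pos[of z] by (simp add: L2_inner_self)
      then show ?thesis using True by (simp add: inner c_def)
    next
      case False
      then show ?thesis using other[OF that] eigenfn_orthogonal[OF that True] by (simp add: inner)
    qed
    then have "v \<in> eigen_perp" using momentum_B_L2(1)[OF v] by (auto simp: eigen_perp_def)
    then show ?thesis using v by blast
  qed
qed

text \<open>
  A bound at \<open>z0\<close> persists, with twice the constant, for all \<open>z\<close> so near to \<open>z0\<close> that the term
  \<open>(z - z0) u\<close> can be absorbed.
\<close>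
lemma eigen_perp_resolvent_bound:
  obtains K r where "0 < K" "0 < r" "\<And>z u h. \<lbrakk>cmod (z - z0) < r; u \<in> eigen_perp; h \<in> L2 S;
     momentum_B u (\<lambda>x. z * u x + h x)\<rbrakk> \<Longrightarrow> L2_norm S u \<le> K * L2_norm S h"
proof -
  obtain K where K: "0 < K" "\<And>u h. \<lbrakk>h \<in> L2 S; momentum_B u (\<lambda>x. z0 * u x + h x);
     char_det z0 = 0 \<Longrightarrow> L2_inner S (eigenfn z0) u = 0\<rbrakk> \<Longrightarrow> L2_norm S u \<le> K * L2_norm S h"
    using resolvent_bound[of z0] by blast
  show thesis
  proof (rule that[of "2 * K" "1 / (2 * K)"])
    fix z u h assume z: "cmod (z - z0) < 1 / (2 * K)" and u: "u \<in> eigen_perp" and h: "h \<in> L2 S"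
      and mom: "momentum_B u (\<lambda>x. z * u x + h x)"
    note u2 = eigen_perp_L2[OF u]
    have h': "(\<lambda>x. h x - (z0 - z) * u x) \<in> L2 S" using u2 h by (intro L2_diff L2_scale)
    have "(\<lambda>x. z * u x + h x) = (\<lambda>x. z0 * u x + (h x - (z0 - z) * u x))"
      by (simp add: fun_eq_iff algebra_simps)
    then have "L2_norm S u \<le> K * L2_norm S (\<lambda>x. h x - (z0 - z) * u x)"
      using mom u by (intro K(2)[OF h']) (auto simp: eigen_perp_def)
    also have "\<dots> \<le> K * (L2_norm S h + cmod (z0 - z) * L2_norm S u)"
      using K(1) L2_norm_diff_le[OF h L2_scale[OF u2, of "z0 - z"]] by (simp add: L2_norm_scale)
    also have "\<dots> = K * L2_norm S h + (K * cmod (z - z0)) * L2_norm S u"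
      by (simp add: algebra_simps norm_minus_commute)
    also have "(K * cmod (z - z0)) * L2_norm S u \<le> 1 / 2 * L2_norm S u"
      using K(1) z by (intro mult_right_mono) (auto simp: field_simps)
    finally show "L2_norm S u \<le> 2 * K * L2_norm S h" by simp
  qed (use K in auto)
qed

lemma char_det_i: "char_det \<i> \<noteq> 0"
  using char_det_zero_real[of \<i>] by auto

text \<open>
  The resolvent identity
  \<open>R z h - R z0 h - (z - z0) (R z0)\<^sup>2 h = (z - z0)\<^sup>2 R z (R z0)\<^sup>2 h\<close> together with the locally uniform
  bound makes the inner products of \<open>R z h\<close> with a fixed vector holomorphic in the whole plane.
\<close>
lemma eigen_perp_trivial:
  assumes h: "h \<in> eigen_perp"
  shows "ae_eq S h (\<lambda>x. 0)"
proof -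
  obtain R where R: "\<And>z. R z \<in> eigen_perp" "\<And>z. momentum_B (R z) (\<lambda>x. z * R z x + h x)"
    using eigen_perp_resolvent[OF h] by metis
  note h2 = eigen_perp_L2[OF h] and R2 = eigen_perp_L2[OF R(1)]
  \<comment> \<open>The fixed vector \<open>R \<i>\<close> makes \<open>g \<i>\<close> the square of a norm.\<close>
  define g where "g z = L2_inner S (R \<i>) (R z)" for z
  have "\<exists>D. (g has_field_derivative D) (at z0)" for z0
  proof -
    obtain w where w: "w \<in> eigen_perp" "momentum_B w (\<lambda>x. z0 * w x + R z0 x)"
      using eigen_perp_resolvent[OF R(1)] by blast
    note w2 = eigen_perp_L2[OF w(1)]
    obtain K r where K: "0 < K" "0 < r" "\<And>z u h. \<lbrakk>cmod (z - z0) < r; u \<in> eigen_perp; h \<in> L2 S;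
     momentum_B u (\<lambda>x. z * u x + h x)\<rbrakk> \<Longrightarrow> L2_norm S u \<le> K * L2_norm S h"
      using eigen_perp_resolvent_bound[of z0] by blast
    have "cmod (g z - g z0 - (z - z0) * L2_inner S (R \<i>) w)
        \<le> (L2_norm S (R \<i>) * (K * L2_norm S w)) * (cmod (z - z0))\<^sup>2" if z: "cmod (z - z0) < r" for z
    proof -
      \<comment> \<open>The remainder in the resolvent identity; \<open>w\<close> stands for \<open>(R z0)\<^sup>2 h\<close>.\<close>
      define v where "v x = (R z x + (-1) * R z0 x) + (- (z - z0)) * w x" for x
      have v: "v \<in> eigen_perp" unfolding v_def by (intro eigen_perp_lin R w)
      have "momentum_B v (\<lambda>x. ((z * R z x + h x) + (-1) * (z0 * R z0 x + h x)) + (- (z - z0)) * (z0 * w x + R z0 x))"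
        unfolding v_def by (intro momentum_B_lin R w)
      also have "(\<lambda>x. ((z * R z x + h x) + (-1) * (z0 * R z0 x + h x)) + (- (z - z0)) * (z0 * w x + R z0 x))
        = (\<lambda>x. z * v x + (z - z0)\<^sup>2 * w x)"
        by (simp add: v_def fun_eq_iff algebra_simps power2_eq_square)
      finally have "L2_norm S v \<le> K * L2_norm S (\<lambda>x. (z - z0)\<^sup>2 * w x)"
        using w2 by (intro K(3)[OF z v]) (auto intro: L2_scale)
      then have vK: "L2_norm S v \<le> K * L2_norm S w * (cmod (z - z0))\<^sup>2"
        unfolding L2_norm_scale norm_power by (simp add: mult_ac)
      have "L2_inner S (R \<i>) v = (g z + (-1) * g z0) + (- (z - z0)) * L2_inner S (R \<i>) w"
        unfolding v_def[abs_def] g_def using R2 w2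
        by (simp only: L2_inner_add_right L2_inner_scale_right L2_add L2_scale)
      then have "L2_inner S (R \<i>) v = g z - g z0 - (z - z0) * L2_inner S (R \<i>) w"
        by (simp add: algebra_simps)
      then have "cmod (g z - g z0 - (z - z0) * L2_inner S (R \<i>) w) \<le> L2_norm S (R \<i>) * L2_norm S v"
        using L2_Cauchy_Schwarz[OF R2[of \<i>] eigen_perp_L2[OF v]] by simp
      also have "\<dots> \<le> L2_norm S (R \<i>) * (K * L2_norm S w * (cmod (z - z0))\<^sup>2)"
        by (intro mult_left_mono vK) simp
      finally show ?thesis by (simp add: mult_ac)
    qed
    then show ?thesis using has_field_derivative_quadratic_remainder[OF K(2)] by blast
  qed
  then have "g holomorphic_on UNIV"
    by (auto simp: holomorphic_on_def field_differentiable_def)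
  moreover have "\<bar>Im z\<bar> * cmod (g z) \<le> L2_norm S (R \<i>) * L2_norm S h" for z
  proof -
    have "\<bar>Im z\<bar> * cmod (g z) \<le> \<bar>Im z\<bar> * (L2_norm S (R \<i>) * L2_norm S (R z))"
      unfolding g_def by (intro mult_left_mono L2_Cauchy_Schwarz R2) auto
    also have "\<dots> = L2_norm S (R \<i>) * (\<bar>Im z\<bar> * L2_norm S (R z))" by simp
    also have "\<dots> \<le> L2_norm S (R \<i>) * L2_norm S h"
      by (intro mult_left_mono resolvent_nonreal_bound[OF R(2) h2]) simp
    finally show ?thesis .
  qed
  ultimately have "g \<i> = 0" by (rule entire_eq_0_if_bounded_by_inverse_Im)
  then have "L2_norm S (R \<i>) = 0" by (simp add: g_def L2_inner_self)
  then have R0: "AE x in lebesgue_on S. R \<i> x = 0"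
    using L2_norm_eq_0_iff[OF R2] by (simp add: ae_eq_def)
  \<comment> \<open>Now \<open>h\<close> is \<open>P\<close> applied to a function that is zero almost everywhere.\<close>
  then have "momentum_B (R \<i>) h"
    using R0 by (intro momentum_B_cong_AE[OF R(2) _ h2]) (auto elim: AE_mp)
  then have prim: "L2_primitive 0 1 (R \<i>) (\<lambda>x. 2 * of_real pi * \<i> * h x)"
    "L2_primitive \<alpha> \<beta> (R \<i>) (\<lambda>x. 2 * of_real pi * \<i> * h x)"
    by (auto simp: momentum_B_def momentum_max_def)
  have "negligible {x\<in>S. R \<i> x \<noteq> 0}"
    using R0 S_sets by (simp add: AE_lebesgue_on_iff_negligible)
  then have "negligible {x\<in>{0..1}. R \<i> x \<noteq> 0}" "negligible {x\<in>{\<alpha>..\<beta>}. R \<i> x \<noteq> 0}"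
    by (auto elim!: negligible_subset simp: S_def)
  then have "negligible {x\<in>{0..1}. h x \<noteq> 0}" "negligible {x\<in>{\<alpha>..\<beta>}. h x \<noteq> 0}"
    using L2_primitive_of_AE_zero[OF prim(1)] L2_primitive_of_AE_zero[OF prim(2)] by simp_all
  then have "negligible ({x\<in>{0..1}. h x \<noteq> 0} \<union> {x\<in>{\<alpha>..\<beta>}. h x \<noteq> 0})" by (rule negligible_Un)
  then have "negligible {x\<in>S. h x \<noteq> 0}"
    by (rule negligible_subset) (auto simp: S_def)
  then show ?thesis
    using S_sets by (simp add: ae_eq_def AE_lebesgue_on_iff_negligible)
qed

section \<open>The spectrum\<close>

definition boundary_matrix :: "complex^2^2" where
  "boundary_matrix = vector [vector [b11, b12], vector [b21, b22]]"

abbreviation dom_B :: "(real \<Rightarrow> complex) set" where "dom_B \<equiv> PB_dom \<alpha> \<beta> boundary_matrix"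

lemma boundary_condition_matrix:
  "boundary_matrix *v (vector [f 1, f \<beta>] :: complex^2) = vector [f 0, f \<alpha>] \<longleftrightarrow> boundary_condition f"
  by (simp add: boundary_matrix_def boundary_condition_def matrix_vector_mult_def vec_eq_iff forall_2 sum_2)

lemma momentum_B_iff:
  assumes "h \<in> L2 S"
  shows "f \<in> dom_B \<and> ae_eq S (momentum S f) h \<longleftrightarrow> momentum_B f h"
  using momentum_dom_iff_L2_primitive[of 0 1 \<alpha> \<beta> h f] assms one_less less
  by (auto simp: PB_dom_def S_def[symmetric] boundary_condition_matrix momentum_B_def momentum_max_def)

lemma dom_momentum_B:
  assumes "f \<in> dom_B" shows "momentum_B f (momentum S f)"
proof -
  have "momentum S f \<in> L2 S"
    using assms L2_scale unfolding momentum_def PB_dom_def momentum_dom_def S_def by blast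
  then show ?thesis using momentum_B_iff assms by (auto simp: ae_eq_def)
qed

lemma momentum_B_dom:
  assumes "momentum_B f h"
  shows "f \<in> dom_B" "ae_eq S (momentum S f) h"
  using momentum_B_iff[OF momentum_B_L2(2)[OF assms]] assms by auto

lemma resolvent_set_eq: "resolvent_set S dom_B (momentum S) = {z. char_det z \<noteq> 0}"
proof (intro set_eqI iffI; clarify?)
  fix z assume z: "z \<in> resolvent_set S dom_B (momentum S)" "char_det z = 0"
  note v = momentum_B_dom[OF momentum_B_eigenfn[OF z(2)]]
  have "ae_eq S (\<lambda>x. momentum S (eigenfn z) x - z * eigenfn z x) (\<lambda>x. 0)"
    using v(2) by (auto simp: ae_eq_def)
  then have "ae_eq S (eigenfn z) (\<lambda>x. 0)" using z(1) v(1) by (auto simp: resolvent_set_def)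
  then show False using eigenfn_norm_pos[of z] by (simp add: L2_norm_eq_0_iff[symmetric])
next
  fix z assume z: "char_det z \<noteq> 0"
  obtain K where K: "\<And>u h. \<lbrakk>h \<in> L2 S; momentum_B u (\<lambda>x. z * u x + h x)\<rbrakk> \<Longrightarrow> L2_norm S u \<le> K * L2_norm S h"
    using resolvent_bound[of z] z by metis
  have res: "(\<lambda>x. momentum S f x - z * f x) \<in> L2 S" "momentum_B f (\<lambda>x. z * f x + (momentum S f x - z * f x))"
    if "f \<in> dom_B" for f
    using dom_momentum_B[OF that] momentum_B_L2[OF dom_momentum_B[OF that]] by (simp_all add: L2_diff L2_scale)
  have bound: "L2_norm S f \<le> K * L2_norm S (\<lambda>x. momentum S f x - z * f x)" if "f \<in> dom_B" for f
    by (rule K[OF res[OF that]])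
  have "ae_eq S f (\<lambda>x. 0)" if f: "f \<in> dom_B" "ae_eq S (\<lambda>x. momentum S f x - z * f x) (\<lambda>x. 0)" for f
  proof -
    have "L2_norm S (\<lambda>x. momentum S f x - z * f x) = 0" using f(2) res(1)[OF f(1)] by (simp add: L2_norm_eq_0_iff)
    then have "L2_norm S f = 0" using bound[OF f(1)] L2_norm_nonneg[of S f] by simp
    then show ?thesis using momentum_B_L2(1)[OF dom_momentum_B[OF f(1)]] by (simp add: L2_norm_eq_0_iff)
  qed
  moreover have "\<exists>f\<in>dom_B. ae_eq S (\<lambda>x. momentum S f x - z * f x) h" if h: "h \<in> L2 S" for h
  proof -
    obtain u where u: "momentum_B u (\<lambda>x. z * u x + h x)" using resolvent_solvable[OF h] z by blast
    have "ae_eq S (\<lambda>x. momentum S u x - z * u x) h"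
      using momentum_B_dom(2)[OF u] unfolding ae_eq_def by eventually_elim simp
    then show ?thesis using momentum_B_dom(1)[OF u] by blast
  qed
  ultimately show "z \<in> resolvent_set S dom_B (momentum S)"
    using bound unfolding resolvent_set_def by blast
qed

lemma op_spectrum_eq: "op_spectrum S dom_B (momentum S) = {z. char_det z = 0}"
  by (auto simp: op_spectrum_def resolvent_set_eq)

lemma eigenspace_eq:
  assumes z: "char_det z = 0"
  shows "eigenspace S dom_B (momentum S) z = spanned_by S (eigenfn z)"
proof (intro set_eqI iffI)
  fix f assume "f \<in> eigenspace S dom_B (momentum S) z"
  then obtain g where f: "f \<in> L2 S" and g: "g \<in> dom_B" and fg: "ae_eq S f g" "ae_eq S (momentum S g) (\<lambda>x. z * g x)"
    by (auto simp: eigenspace_def)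
  have g2: "g \<in> L2 S" using momentum_B_L2(1)[OF dom_momentum_B[OF g]] .
  then have "momentum_B g (\<lambda>x. z * g x)" using momentum_B_iff[OF L2_scale] g fg(2) by blast
  note ker = momentum_B_kernel(1)[OF this]
  have "ae_eq S f (\<lambda>x. g 0 * eigenfn z x)"
    using fg(1) unfolding ae_eq_def by (rule AE_mp) (auto intro!: AE_I2 ker)
  then show "f \<in> spanned_by S (eigenfn z)" using f by (auto simp: spanned_by_def)
next
  fix f assume "f \<in> spanned_by S (eigenfn z)"
  then obtain c where f: "f \<in> L2 S" "ae_eq S f (\<lambda>x. c * eigenfn z x)" by (auto simp: spanned_by_def)
  define g where "g x = 0 + c * eigenfn z x" for x
  have "momentum_B (\<lambda>x. 0) (\<lambda>x. 0)"
    by (auto simp: momentum_B_def momentum_max_def L2_primitive_def boundary_condition_def)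
  from momentum_B_lin[OF this momentum_B_eigenfn[OF z], of c]
  have "momentum_B g (\<lambda>x. z * g x)"
    by (simp add: g_def[abs_def] mult.left_commute)
  then have "g \<in> dom_B" "ae_eq S (momentum S g) (\<lambda>x. z * g x)" by (rule momentum_B_dom)+
  then show "f \<in> eigenspace S dom_B (momentum S) z" using f by (auto simp: eigenspace_def g_def[abs_def])
qed

lemma eigenvalues_eq: "eigenvalues S dom_B (momentum S) = {z. char_det z = 0}"
proof (intro set_eqI iffI; clarify?)
  fix z assume "z \<in> eigenvalues S dom_B (momentum S)"
  then obtain f g where f: "\<not> ae_eq S f (\<lambda>x. 0)" and g: "g \<in> dom_B" and fg: "ae_eq S f g" "ae_eq S (momentum S g) (\<lambda>x. z * g x)"
    by (auto simp: eigenspace_def eigenvalues_def)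
  have g2: "g \<in> L2 S" using momentum_B_L2(1)[OF dom_momentum_B[OF g]] .
  then have k: "momentum_B g (\<lambda>x. z * g x)" using momentum_B_iff[OF L2_scale] g fg(2) by blast
  show "char_det z = 0"
  proof (rule ccontr)
    assume "char_det z \<noteq> 0"
    then have "g 0 = 0" using momentum_B_kernel(2)[OF k] by simp
    then have "g x = 0" if "x \<in> S" for x
      using momentum_B_kernel(1)[OF k that] by simp
    then have "ae_eq S f (\<lambda>x. 0)"
      using fg(1) unfolding ae_eq_def by (elim AE_mp) (auto intro!: AE_I2)
    then show False using f by contradiction
  qed
next
  fix z assume z: "char_det z = 0"
  have "eigenfn z \<in> spanned_by S (eigenfn z)"
    by (auto simp: spanned_by_def ae_eq_def intro!: exI[of _ 1])
  moreover have "\<not> ae_eq S (eigenfn z) (\<lambda>x. 0)"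
    using eigenfn_norm_pos[of z] by (simp add: L2_norm_eq_0_iff[symmetric])
  ultimately show "z \<in> eigenvalues S dom_B (momentum S)"
    using eigenspace_eq[OF z] by (auto simp: eigenvalues_def)
qed

lemma pure_point_momentum: "pure_point S dom_B (momentum S)"
proof -
  define k :: "complex \<Rightarrow> complex" where "k z = of_real (1 / L2_norm S (eigenfn z))" for z
  define e where "e z x = k z * eigenfn z x" for z x
  have e2: "e z \<in> L2 S" for z unfolding e_def[abs_def] by (intro L2_scale eigenfn_L2)
  have inner_e: "L2_inner S (e y) (e z) = cnj (k y) * (k z * L2_inner S (eigenfn y) (eigenfn z))" for y z
    by (simp add: e_def[abs_def] L2_inner_scale_left L2_inner_scale_right)
  have norm_e: "L2_inner S (e z) (e z) = 1" for z
    using eigenfn_norm_pos[of z] unfolding inner_e by (simp add: k_def L2_inner_self power2_eq_square)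
  show ?thesis
    unfolding pure_point_def
  proof (intro exI[of _ "e ` {z. char_det z = 0}"] conjI ballI impI)
    show "e ` {z. char_det z = 0} \<subseteq> (\<Union>z. eigenspace S dom_B (momentum S) z)"
    proof clarify
      fix z assume z: "char_det z = 0"
      have "e z \<in> spanned_by S (eigenfn z)"
        using e2[of z] by (auto simp: spanned_by_def ae_eq_def e_def[abs_def])
      then show "e z \<in> (\<Union>z. eigenspace S dom_B (momentum S) z)" using eigenspace_eq[OF z] by blast
    qed
    show "L2_inner S u v = (if u = v then 1 else 0)"
      if "u \<in> e ` {z. char_det z = 0}" "v \<in> e ` {z. char_det z = 0}" for u v
    proof (cases "u = v")
      case True
      then show ?thesis using that norm_e by auto
    next
      case False
      from that obtain y z where "u = e y" "v = e z" "char_det y = 0" "char_det z = 0" by blast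
      moreover from this have "y \<noteq> z" using False by blast
      ultimately show ?thesis using False by (simp add: inner_e eigenfn_orthogonal)
    qed
    fix f assume f: "f \<in> L2 S" "\<forall>u\<in>e ` {z. char_det z = 0}. L2_inner S u f = 0"
    have "L2_inner S (eigenfn z) f = 0" if "char_det z = 0" for z
    proof -
      have "L2_inner S (e z) f = 0" using f(2) that by blast
      then have "cnj (k z) * L2_inner S (eigenfn z) f = 0"
        unfolding e_def[abs_def] L2_inner_scale_left .
      then show ?thesis using eigenfn_norm_pos[of z] by (simp add: k_def)
    qed
    then show "ae_eq S f (\<lambda>x. 0)" using f(1) by (intro eigen_perp_trivial) (auto simp: eigen_perp_def)
  qed
qed

lemma char_det_holomorphic: "char_det holomorphic_on A"
  unfolding char_det_def[abs_def] wave_def by (intro holomorphic_intros)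

lemma char_det_zero_isolated:
  assumes "char_det z = 0" shows "z isolated_in {z. char_det z = 0}"
proof -
  obtain r where r: "0 < r" "\<And>w. w \<in> ball z r - {z} \<Longrightarrow> char_det w \<noteq> 0"
    using isolated_zeros[OF char_det_holomorphic[of UNIV] open_UNIV connected_UNIV, of z \<i>] assms char_det_i
    by auto
  have "w = z" if "w \<in> ball z r" "char_det w = 0" for w
    using r(2)[of w] that by blast
  moreover have "z \<in> ball z r" using r(1) by simp
  ultimately have "ball z r \<inter> {z. char_det z = 0} = {z}" using assms by blast
  then show ?thesis unfolding isolated_in_def using assms open_ball by blast
qed

lemma countable_char_det_zeros: "countable {z. char_det z = 0}"
proof -
  have "countable {z\<in>UNIV. char_det z = 0}" if "char_det z0 = 0" for z0
  proof (rule holomorphic_countable_zeros[OF char_det_holomorphic])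
    show "\<not> char_det constant_on UNIV"
      using that char_det_i unfolding constant_on_def by (metis UNIV_I)
  qed auto
  then show ?thesis by (cases "\<exists>z. char_det z = 0") auto
qed

end

section \<open>The eigenvalue equation\<close>

lemma ee_cis: "ee x = cis (2 * pi * x)"
  by (simp add: ee_def cis_conv_exp)

lemma ee_add: "ee (x + y) = ee x * ee y"
  by (simp add: ee_cis cis_mult algebra_simps)

lemma ee_0 [simp]: "ee 0 = 1"
  by (simp add: ee_def)

lemma ee_minus_cancel: "ee (- x) * ee x = 1"
  by (simp flip: ee_add)

lemma ee_nonzero [simp]: "ee x \<noteq> 0"
  by (simp add: ee_cis)

lemma norm_ee [simp]: "cmod (ee x) = 1"
  by (simp add: ee_cis)

lemma cnj_ee: "cnj (ee x) = ee (- x)"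
  by (simp add: ee_cis cis_cnj)

lemma wave_of_real: "wave (of_real l) x = ee (l * x)"
  by (simp add: wave_def ee_def mult_ac)

text \<open>
  A nonzero factor relates the eigenfunction normalised at 0, which is natural for the linear
  system, to one normalised on the second interval.
\<close>
lemma spanned_by_scale:
  assumes "c \<noteq> 0" "\<And>x. x \<in> S \<Longrightarrow> v x = c * u x"
  shows "spanned_by S v = spanned_by S u"
proof -
  have "(\<exists>k. ae_eq S f (\<lambda>x. k * v x)) \<longleftrightarrow> (\<exists>k. ae_eq S f (\<lambda>x. k * u x))" for f
  proof
    assume "\<exists>k. ae_eq S f (\<lambda>x. k * v x)"
    then obtain k where "AE x in lebesgue_on S. f x = k * v x" by (auto simp: ae_eq_def)
    then have "AE x in lebesgue_on S. f x = (k * c) * u x"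
      by (elim AE_mp) (auto intro!: AE_I2 simp: assms(2))
    then show "\<exists>k. ae_eq S f (\<lambda>x. k * u x)" unfolding ae_eq_def by blast
  next
    assume "\<exists>k. ae_eq S f (\<lambda>x. k * u x)"
    then obtain k where "AE x in lebesgue_on S. f x = k * u x" by (auto simp: ae_eq_def)
    then have "AE x in lebesgue_on S. f x = (k / c) * v x"
      using assms(1) by (elim AE_mp) (auto intro!: AE_I2 simp: assms(2))
    then show "\<exists>k. ae_eq S f (\<lambda>x. k * v x)" unfolding ae_eq_def by blast
  qed
  then show ?thesis by (simp add: spanned_by_def)
qed

text \<open>
  With \<open>q = 1 - w e(\<phi> + l)\<close>, the right-hand side of the equation is \<open>- q / (e(\<phi> + l) cnj q)\<close>. As \<open>q\<close> stays
  in the right half-plane, \<open>q / cnj q\<close> has the continuous argument \<open>2 Im (Ln q)\<close>, and the equation holds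
  wherever the real function \<open>P\<close> takes an integer value. The intermediate value theorem provides a
  different solution for each natural number.
\<close>
lemma infinite_eigenvalue_equation:
  fixes m \<theta> \<phi> w :: real
  assumes w: "0 < w" "w < 1" and m: "0 < m"
  shows "infinite {l. ee (\<theta> - \<phi> + m * l) = (of_real w * ee (\<phi> + l) - 1) / (ee (\<phi> + l) - of_real w)}"
proof -
  define q where "q l = 1 - of_real w * ee (\<phi> + l)" for l
  define P where "P l = \<theta> + (m + 1) * l - 1/2 - Im (Ln (q l)) / pi" for l
  have Re_q: "Re (q l) > 0" for l
  proof -
    have "Re (of_real w * ee (\<phi> + l)) \<le> cmod (of_real w * ee (\<phi> + l))" by (rule complex_Re_le_cmod)
    also have "\<dots> = w" using w by (simp add: norm_mult)
    finally show ?thesis using w unfolding q_def minus_complex.simps one_complex.simps by linarith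
  qed
  then have q: "q l \<noteq> 0" "q l \<notin> \<real>\<^sub>\<le>\<^sub>0" for l
    by (metis less_irrefl zero_complex.simps(1)) (metis Re_q complex_nonpos_Reals_iff not_less)
  have eq: "ee (\<theta> - \<phi> + m * l) = (of_real w * ee (\<phi> + l) - 1) / (ee (\<phi> + l) - of_real w)" if P: "P l = real n" for l n
  proof -
    define t where "t = Im (Ln (q l))"
    have "\<theta> - \<phi> + m * l + (\<phi> + l) = real n + (1/2 + t / pi)"
      using P by (simp add: P_def t_def algebra_simps)
    then have "ee (\<theta> - \<phi> + m * l) * ee (\<phi> + l) = ee (real n) * ee (1/2 + t / pi)"
      by (simp only: ee_add[symmetric])
    also have "ee (real n) = 1" by (simp add: ee_cis cis_multiple_2pi)
    also have "ee (1/2 + t / pi) = - cis (2 * t)"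
      by (simp add: ee_add) (simp add: ee_cis)
    finally have 1: "ee (\<theta> - \<phi> + m * l) * ee (\<phi> + l) = - cis (2 * t)" by simp
    have 2: "q l = cis (2 * t) * cnj (q l)"
    proof -
      have "cis (2 * t) * cnj (q l) = exp (of_real (2 * t) * \<i>) * cnj (exp (Ln (q l)))"
        using q by (simp add: cis_conv_exp mult.commute)
      also have "\<dots> = exp (of_real (2 * t) * \<i> + cnj (Ln (q l)))"
        by (simp add: exp_add exp_cnj)
      also have "of_real (2 * t) * \<i> + cnj (Ln (q l)) = Ln (q l)"
        by (simp add: complex_eq_iff t_def)
      finally show ?thesis using q by simp
    qed
    have 3: "ee (\<phi> + l) - of_real w = ee (\<phi> + l) * cnj (q l)"
    proof -
      have "ee (\<phi> + l) * (of_real w * ee (- (\<phi> + l))) = of_real w"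
        using ee_minus_cancel[of "\<phi> + l"] by (simp add: mult_ac)
      then show ?thesis by (simp add: q_def cnj_ee right_diff_distrib)
    qed
    have "ee (\<theta> - \<phi> + m * l) * (ee (\<phi> + l) - of_real w) = - q l"
      unfolding 3 mult.assoc[symmetric] 1 using 2 by simp
    moreover have "ee (\<phi> + l) - of_real w \<noteq> 0" unfolding 3 using q by simp
    ultimately show ?thesis by (simp add: q_def field_simps)
  qed
  have "\<exists>l. P l = real n" for n :: nat
  proof -
    \<comment> \<open>The last term of \<open>P\<close> lies between -1 and 1, which gives the bracketing points.\<close>
    define l1 where "l1 = (real n - \<theta> - 1/2) / (m + 1)"
    define l2 where "l2 = (real n - \<theta> + 3/2) / (m + 1)"
    have arg: "\<bar>Im (Ln (q l)) / pi\<bar> \<le> 1" for l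
      using q mpi_less_Im_Ln[of "q l"] Im_Ln_le_pi[of "q l"] by (simp add: abs_le_iff field_simps)
    have "(m + 1) * l1 = real n - \<theta> - 1/2" "(m + 1) * l2 = real n - \<theta> + 3/2"
      using m by (simp_all add: l1_def l2_def)
    then have "P l1 \<le> real n" "real n \<le> P l2"
      using arg[of l1] arg[of l2] unfolding P_def abs_le_iff by linarith+
    moreover have "l1 \<le> l2" using m unfolding l1_def l2_def by (intro divide_right_mono) auto
    moreover have "continuous_on {l1..l2} P"
      unfolding P_def[abs_def]
    proof (intro continuous_intros)
      show "continuous_on {l1..l2} q" unfolding q_def[abs_def] ee_def by (intro continuous_intros)
    qed (use q in auto)
    ultimately show ?thesis using IVT'[of P l1 "real n" l2] by blast
  qed
  then obtain L where L: "\<And>n. P (L n) = real n" by metis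
  then have "inj L" by (metis injI of_nat_eq_iff)
  then have "infinite (range L)" using finite_imageD infinite_UNIV_nat by blast
  moreover have "range L \<subseteq> {l. ee (\<theta> - \<phi> + m * l) = (of_real w * ee (\<phi> + l) - 1) / (ee (\<phi> + l) - of_real w)}"
    using eq[OF L] by blast
  ultimately show ?thesis using infinite_super by blast
qed

theorem theorem3p14:
  fixes \<alpha> \<beta> \<phi> \<psi> \<theta> w :: real
    and I\<^sub>1 I\<^sub>2 S :: "real set"
    and D :: "(real \<Rightarrow> complex) set"
    and P\<^sub>B :: "(real \<Rightarrow> complex) \<Rightarrow> (real \<Rightarrow> complex)"
  assumes "1 < \<alpha>" and "\<alpha> < \<beta>" and "0 < w" and "w < 1"
  defines "I\<^sub>1 \<equiv> {0..1}" and "I\<^sub>2 \<equiv> {\<alpha>..\<beta>}"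
  defines "S \<equiv> I\<^sub>1 \<union> I\<^sub>2"
  defines "D \<equiv> PB_dom \<alpha> \<beta> (Bmat w \<phi> \<psi> \<theta>)"
  defines "P\<^sub>B \<equiv> momentum S"
  shows "\<exists>lam :: nat \<Rightarrow> real.
      inj lam \<and>
      range lam = {l. ee (\<theta> - \<phi> + (\<beta> - \<alpha>) * l) =
                      (of_real w * ee (\<phi> + l) - 1) / (ee (\<phi> + l) - of_real w)} \<and>
      pure_point S D P\<^sub>B \<and>
      eigenvalues S D P\<^sub>B = complex_of_real ` range lam \<and>
      op_spectrum S D P\<^sub>B = complex_of_real ` range lam \<and>
      (\<forall>n. complex_of_real (lam n) isolated_in op_spectrum S D P\<^sub>B) \<and>
      (\<forall>n. let a = of_real (sqrt (1 - w\<^sup>2)) * ee (\<theta> - \<psi> + \<beta> * lam n) /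
                   (of_real w * ee (\<phi> + lam n) - 1)
           in eigenspace S D P\<^sub>B (complex_of_real (lam n)) =
              spanned_by S (\<lambda>x. (a * indicator I\<^sub>1 x + indicator I\<^sub>2 x) * ee (lam n * x)))"
proof -
  define s where "s = sqrt (1 - w\<^sup>2)"
  have w2: "w\<^sup>2 < 1" using assms by (simp add: power_less_one_iff)
  have s: "s > 0" "s\<^sup>2 = 1 - w\<^sup>2" using w2 by (simp_all add: s_def)
  then have s2: "complex_of_real s * complex_of_real s = 1 - of_real w * of_real w"
    by (metis of_real_1 of_real_diff of_real_mult power2_eq_square)
  interpret M: two_interval_momentum \<alpha> \<beta> "of_real w * ee \<phi>" "- (of_real s * ee (\<theta> - \<psi>))"
    "of_real s * ee \<psi>" "of_real w * ee (\<theta> - \<phi>)"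
  proof
    have "cnj (of_real w * ee x) * (of_real w * ee x) = of_real w * of_real w"
      "cnj (of_real s * ee x) * (of_real s * ee x) = of_real s * of_real s" for x
      using ee_minus_cancel[of x] by (simp_all add: cnj_ee mult_ac)
    then show "cnj (of_real w * ee \<phi>) * (of_real w * ee \<phi>) + cnj (of_real s * ee \<psi>) * (of_real s * ee \<psi>) = 1"
      "cnj (- (of_real s * ee (\<theta> - \<psi>))) * - (of_real s * ee (\<theta> - \<psi>)) + cnj (of_real w * ee (\<theta> - \<phi>)) * (of_real w * ee (\<theta> - \<phi>)) = 1"
      by (simp_all add: s2)
    have "ee (- \<phi>) * ee (\<theta> - \<psi>) = ee (- \<psi>) * ee (\<theta> - \<phi>)" by (simp add: ee_add[symmetric] algebra_simps)
    then show "cnj (of_real w * ee \<phi>) * - (of_real s * ee (\<theta> - \<psi>)) + cnj (of_real s * ee \<psi>) * (of_real w * ee (\<theta> - \<phi>)) = 0"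
      by (simp add: cnj_ee mult_ac)
  qed (use assms s in auto)
  \<comment> \<open>From here on the objects of the locale are translated into those of the statement.\<close>
  have S_eq: "M.S = S" by (simp add: M.S_def S_def I\<^sub>1_def I\<^sub>2_def)
  have D_eq: "M.dom_B = D"
    unfolding D_def Bmat_def s_def[symmetric] M.boundary_matrix_def by (rule refl)
  define L where "L = {l. ee (\<theta> - \<phi> + (\<beta> - \<alpha>) * l) = (of_real w * ee (\<phi> + l) - 1) / (ee (\<phi> + l) - of_real w)}"
  have char_iff: "M.char_det (of_real l) = 0 \<longleftrightarrow> l \<in> L" for l
  proof -
    define z E where "z = ee (\<phi> + l)" and "E = ee (\<theta> - \<phi> + (\<beta> - \<alpha>) * l)"
    have "cmod z \<noteq> cmod (of_real w)" using assms(3,4) by (simp add: z_def)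
    then have "z \<noteq> of_real w" by auto
    have z1: "of_real w * ee \<phi> * wave (of_real l) 1 = of_real w * z"
      and E1: "of_real w * ee (\<theta> - \<phi>) * wave (of_real l) (\<beta> - \<alpha>) = of_real w * E"
      by (simp_all add: wave_of_real z_def E_def ee_add mult.commute)
    have "ee (\<theta> - \<psi>) * ee (l * (\<beta> - \<alpha>)) * (ee \<psi> * ee l) = E * z"
      by (simp add: E_def z_def ee_add[symmetric] algebra_simps)
    then have Ez: "- (of_real s * ee (\<theta> - \<psi>)) * wave (of_real l) (\<beta> - \<alpha>) * (of_real s * ee \<psi> * wave (of_real l) 1)
        = - (of_real s * of_real s * (E * z))"
      by (simp add: wave_of_real mult_ac)
    have "M.char_det (of_real l) = (of_real w * z - 1) * (of_real w * E - 1) + of_real s * of_real s * (E * z)"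
      unfolding M.char_det_def z1 E1 Ez by simp
    also have "\<dots> = E * (z - of_real w) - (of_real w * z - 1)"
      unfolding s2 by (simp add: algebra_simps)
    finally have "M.char_det (of_real l) = 0 \<longleftrightarrow> E * (z - of_real w) = of_real w * z - 1" by simp
    also have "\<dots> \<longleftrightarrow> E = (of_real w * z - 1) / (z - of_real w)"
      using \<open>z \<noteq> of_real w\<close> by (simp add: eq_divide_eq)
    finally show ?thesis by (simp add: L_def z_def E_def)
  qed
  have zeros: "{z. M.char_det z = 0} = complex_of_real ` L"
  proof (intro set_eqI iffI)
    fix z assume z: "z \<in> {z. M.char_det z = 0}"
    then obtain r where "z = complex_of_real r"
      using M.char_det_zero_real[of z] by (auto simp: complex_is_Real_iff[symmetric] elim: Reals_cases)
    then show "z \<in> complex_of_real ` L" using z char_iff[of r] by auto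
  qed (use char_iff in auto)
  have "countable (complex_of_real ` L)" using M.countable_char_det_zeros by (simp add: zeros)
  then have "countable L" by (rule countable_image_inj_on) (simp add: inj_on_def)
  moreover have "infinite L"
    unfolding L_def using infinite_eigenvalue_equation[of w "\<beta> - \<alpha>" \<theta> \<phi>] assms by simp
  ultimately have bij: "bij_betw (from_nat_into L) UNIV L" by (rule bij_betw_from_nat_into)
  define lam where "lam = from_nat_into L"
  have lam: "inj lam" "range lam = L" using bij by (simp_all add: lam_def bij_betw_def)
  have eigenspace: "eigenspace S D P\<^sub>B (complex_of_real l) =
      spanned_by S (\<lambda>x. (a * indicator I\<^sub>1 x + indicator I\<^sub>2 x) * ee (l * x))"
    if l: "l \<in> L" and a: "a = of_real (sqrt (1 - w\<^sup>2)) * ee (\<theta> - \<psi> + \<beta> * l) / (of_real w * ee (\<phi> + l) - 1)" for l a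
  proof -
    define z where "z = ee (\<phi> + l)"
    have "cmod (of_real w * z) \<noteq> cmod 1" using assms by (simp add: z_def norm_mult)
    then have wz: "of_real w * z - 1 \<noteq> 0" by auto
    have a': "a = of_real s * ee (\<theta> - \<psi> + \<beta> * l) / (of_real w * z - 1)" by (simp add: a s_def z_def)
    have slope: "M.slope (of_real l) = (of_real w * z - 1) / (of_real s * ee (\<theta> - \<psi>) * ee (l * (\<beta> - \<alpha>)))"
    proof -
      have "of_real w * ee \<phi> * wave (of_real l) 1 = of_real w * z"
        by (simp add: wave_of_real z_def ee_add)
      then show ?thesis unfolding M.slope_def by (simp add: wave_of_real minus_divide_right[symmetric] minus_divide_left)
    qed
    \<comment> \<open>So \<open>a\<close> times the locale eigenfunction is exactly \<open>e(l x)\<close> on the second interval.\<close>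
    have a_slope: "a * M.slope (of_real l) = ee (\<alpha> * l)"
    proof -
      have "ee (\<theta> - \<psi> + \<beta> * l) = ee (\<alpha> * l) * (ee (\<theta> - \<psi>) * ee (l * (\<beta> - \<alpha>)))"
        by (simp add: ee_add[symmetric] algebra_simps)
      then show ?thesis using wz s by (simp add: a' slope)
    qed
    have "M.char_det (of_real l) = 0" using l char_iff by blast
    from M.eigenspace_eq[OF this]
    have "eigenspace S D P\<^sub>B (complex_of_real l) = spanned_by S (M.eigenfn (of_real l))"
      by (simp add: S_eq D_eq P\<^sub>B_def)
    also have "\<dots> = spanned_by S (\<lambda>x. (a * indicator I\<^sub>1 x + indicator I\<^sub>2 x) * ee (l * x))"
    proof (rule spanned_by_scale[symmetric])
      show "a \<noteq> 0" using wz s by (simp add: a')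
      fix x assume x: "x \<in> S"
      show "(a * indicator I\<^sub>1 x + indicator I\<^sub>2 x) * ee (l * x) = a * M.eigenfn (of_real l) x"
      proof (cases "x \<in> I\<^sub>1")
        case True
        then show ?thesis using assms(1) by (auto simp: I\<^sub>1_def I\<^sub>2_def M.eigenfn_def wave_of_real)
      next
        case False
        then have "x \<in> I\<^sub>2" "\<not> x \<le> 1" using x assms(1) by (auto simp: S_def I\<^sub>1_def I\<^sub>2_def)
        have "a * M.eigenfn (of_real l) x = (a * M.slope (of_real l)) * ee (l * (x - \<alpha>))"
          using \<open>\<not> x \<le> 1\<close> by (simp add: M.eigenfn_def wave_of_real)
        also have "\<dots> = ee (l * x)"
          unfolding a_slope by (simp add: ee_add[symmetric] algebra_simps)
        finally show ?thesis using \<open>x \<in> I\<^sub>2\<close> False by simp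
      qed
    qed
    finally show ?thesis .
  qed
  have spectrum: "op_spectrum S D P\<^sub>B = complex_of_real ` range lam"
    using M.op_spectrum_eq by (simp add: S_eq D_eq P\<^sub>B_def zeros lam)
  show ?thesis
  proof (intro exI[of _ lam] conjI allI)
    show "range lam = {l. ee (\<theta> - \<phi> + (\<beta> - \<alpha>) * l) = (of_real w * ee (\<phi> + l) - 1) / (ee (\<phi> + l) - of_real w)}"
      using lam by (simp add: L_def)
    show "pure_point S D P\<^sub>B"
      using M.pure_point_momentum by (simp add: S_eq D_eq P\<^sub>B_def)
    show "eigenvalues S D P\<^sub>B = complex_of_real ` range lam"
      using M.eigenvalues_eq by (simp add: S_eq D_eq P\<^sub>B_def zeros lam)
    show "complex_of_real (lam n) isolated_in op_spectrum S D P\<^sub>B" for n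
      using M.char_det_zero_isolated[of "of_real (lam n)"] char_iff[of "lam n"] lam
      unfolding spectrum zeros by auto
    show "let a = of_real (sqrt (1 - w\<^sup>2)) * ee (\<theta> - \<psi> + \<beta> * lam n) / (of_real w * ee (\<phi> + lam n) - 1)
           in eigenspace S D P\<^sub>B (complex_of_real (lam n)) =
              spanned_by S (\<lambda>x. (a * indicator I\<^sub>1 x + indicator I\<^sub>2 x) * ee (lam n * x))" for n
      unfolding Let_def by (rule eigenspace) (use lam in auto)
  qed (use lam spectrum in auto)
qed

end
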